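(* Let $H$ be a filter relative to $m$ and $\alpha^*$. Suppose there exists a positive number $\delta$ and a set $F\subseteq\widehat\Gamma$ of positive measure such that for all $\omega\in F$ the matrix $H(\omega)$ is in block form $$H(\omega)=\begin{pmatrix}A(\omega)&B(\omega)\\ C(\omega)&D(\omega)\end{pmatrix},$$ where the four blocks satisfy the following: (1) $A(\omega)$ is a square expansive matrix with the property that $\|A(\omega)^{-1}\|\le\frac{1}{1+\delta}$. (2) $\max(\|B(\omega)\|,\|C(\omega)\|,\|D(\omega)\|)<\epsilon=\min\left(\frac18,\frac{\delta}{8}\right)$. (The norm here can either be the operator norm of a matrix or the Euclidean norm.) Finally, assume that $F\cap\alpha^*(F)$ also has positive measure. Then the Ruelle operator $S_H$ is a pure isometry, i.e., $S_H$ has no eigenvector.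
   Context: Setting. $\Gamma$ is a countable abelian group, written additively, with dual group $\widehat\Gamma$, written multiplicatively and equipped with Haar measure $\mu$ of total mass 1 ("almost all" and "positive measure" refer to $\mu$). $\alpha$ is an isomorphism of $\Gamma$ into itself (an injective homomorphism $\Gamma\to\Gamma$) such that the index of $\alpha(\Gamma)$ in $\Gamma$ equals $N>1$ (finite) and $\bigcap_{n\ge 0}\alpha^n(\Gamma)=\{0\}$. $\alpha^*$ is the dual endomorphism of $\widehat\Gamma$ onto itself, $[\alpha^*(\omega)](\gamma)=\omega(\alpha(\gamma))$; its kernel contains exactly $N$ elements. $m:\widehat\Gamma\to\{0,1,2,\ldots,\infty\}$ is a Borel map, and for $i\ge 1$, $\sigma_i=\{\omega\in\widehat\Gamma: m(\omega)\ge i\}$, so $m=\sum_i\chi_{\sigma_i}$. Filter: a (possibly infinite) matrix $H=[h_{i,j}]$ of Borel complex-valued functions on $\widehat\Gamma$ is a filter relative to $m$ and $\alpha^*$ if for every $j$ the function $h_{i,j}$ is supported in $\sigma_j$, and $$\sum_{\alpha^*(\zeta)=1}\sum_j h_{i,j}(\omega\zeta)\overline{h_{i',j}(\omega\zeta)}=N\delta_{i,i'}\chi_{\sigma_i}(\alpha^*(\omega))$$ for almost all $\omega\in\widehat\Gamma$ and all $i,i'$ (here $\delta_{i,i'}$ is the Kronecker delta). Ruelle operator: $[S_H(f)](\omega)=H^t(\omega)f(\alpha^*(\omega))=\bigoplus_j\sum_i h_{i,j}(\omega)f_i(\alpha^*(\omega))$ for $f=\bigoplus_i f_i\in\bigoplus_i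 L^2(\sigma_i,\mu)$ (functions on $\sigma_i$ being extended by $0$ to $\widehat\Gamma$). It is a standing assumption that this formula defines a bounded operator from $\bigoplus_i L^2(\sigma_i,\mu)$ into itself. An isometry $S$ of a Hilbert space into itself is a pure isometry if $\bigcap_{n\ge1}\operatorname{Range}(S^n)=\{0\}$. The Euclidean norm of a matrix is the square root of the sum of the squared absolute values of its entries. A square matrix is expansive if all its eigenvalues have absolute value greater than 1. *)

theory Defs
  imports
    "HOL-Analysis.Analysis"
    "HOL-Probability.Probability_Measure"
    "Jordan_Normal_Form.Char_Poly"
begin

section \<open>The dual group\<close>

text \<open>The discrete group is the whole type \<open>'g\<close>.  Its dual is a subset of the function space
  \<open>'g \<Rightarrow> complex\<close>, whose library topology is the product topology; on the dual this is the
  topology of pointwise convergence.\<close>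

definition dual_group :: "('g::ab_group_add \<Rightarrow> complex) set" where
  "dual_group = {\<omega>. (\<forall>\<gamma>. cmod (\<omega> \<gamma>) = 1) \<and> (\<forall>\<gamma> \<gamma>'. \<omega> (\<gamma> + \<gamma>') = \<omega> \<gamma> * \<omega> \<gamma>')}"

definition dual_mult :: "('g \<Rightarrow> complex) \<Rightarrow> ('g \<Rightarrow> complex) \<Rightarrow> 'g \<Rightarrow> complex" where
  "dual_mult \<omega> \<zeta> = (\<lambda>\<gamma>. \<omega> \<gamma> * \<zeta> \<gamma>)"

definition dual_one :: "'g \<Rightarrow> complex" where
  "dual_one = (\<lambda>\<gamma>. 1)"

definition dual_hom :: "('g \<Rightarrow> 'g) \<Rightarrow> ('g \<Rightarrow> complex) \<Rightarrow> 'g \<Rightarrow> complex" where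
  "dual_hom \<alpha> \<omega> = (\<lambda>\<gamma>. \<omega> (\<alpha> \<gamma>))"

definition dual_kernel :: "('g::ab_group_add \<Rightarrow> 'g) \<Rightarrow> ('g \<Rightarrow> complex) set" where
  "dual_kernel \<alpha> = {\<zeta> \<in> dual_group. dual_hom \<alpha> \<zeta> = dual_one}"

text \<open>For a countable group the dual is compact and metrizable, so every Borel probability
  measure on it is regular and the following conditions determine Haar measure uniquely.\<close>

definition haar_prob :: "('g::ab_group_add \<Rightarrow> complex) measure \<Rightarrow> bool" where
  "haar_prob \<mu> \<longleftrightarrow>
     space \<mu> = dual_group \<and>
     sets \<mu> = sets (restrict_space borel dual_group) \<and>
     prob_space \<mu> \<and>
     (\<forall>\<eta>\<in>dual_group. \<forall>A\<in>sets \<mu>. emeasure \<mu> (dual_mult \<eta> ` A) = emeasure \<mu> A)"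

definition subgroup_index :: "('g::ab_group_add) set \<Rightarrow> nat" where
  "subgroup_index K = card (range (\<lambda>x. (+) x ` K))"

section \<open>Filters\<close>

text \<open>Throughout, the natural number \<open>i\<close> stands for the (one-based) index \<open>i + 1\<close>.
  Matrices of finite size are represented by padding with zeros.\<close>

definition level_set :: "(('g::ab_group_add \<Rightarrow> complex) \<Rightarrow> enat) \<Rightarrow> nat \<Rightarrow> ('g \<Rightarrow> complex) set" where
  "level_set m i = {\<omega> \<in> dual_group. enat (Suc i) \<le> m \<omega>}"

text \<open>Summability is required explicitly since \<open>suminf\<close> is unspecified on divergent series.\<close>

definition is_filter ::
  "('g::ab_group_add \<Rightarrow> complex) measure \<Rightarrow> (('g \<Rightarrow> complex) \<Rightarrow> enat) \<Rightarrow> ('g \<Rightarrow> 'g) \<Rightarrow> nat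
    \<Rightarrow> (nat \<Rightarrow> nat \<Rightarrow> ('g \<Rightarrow> complex) \<Rightarrow> complex) \<Rightarrow> bool" where
  "is_filter \<mu> m \<alpha> N h \<longleftrightarrow>
     (\<forall>i j. h i j \<in> borel_measurable \<mu>) \<and>
     (\<forall>i j. \<forall>\<omega>\<in>dual_group - level_set m j. h i j \<omega> = 0) \<and>
     (AE \<omega> in \<mu>. \<forall>i i'.
        (\<forall>\<zeta>\<in>dual_kernel \<alpha>.
           summable (\<lambda>j. h i j (dual_mult \<omega> \<zeta>) * cnj (h i' j (dual_mult \<omega> \<zeta>)))) \<and>
        (\<Sum>\<zeta>\<in>dual_kernel \<alpha>. \<Sum>j. h i j (dual_mult \<omega> \<zeta>) * cnj (h i' j (dual_mult \<omega> \<zeta>))) =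
          of_nat N * (if i = i' then 1 else 0) * indicator (level_set m i) (dual_hom \<alpha> \<omega>))"

section \<open>The Hilbert space and the Ruelle operator\<close>

text \<open>Elements of the Hilbert direct sum of the spaces \<open>L\<^sup>2(\<sigma>\<^sub>i, \<mu>)\<close> are handled through
  representatives, extended by \<open>0\<close> to the whole dual group; equality of elements is
  \<open>l2_eq\<close>.\<close>

definition l2_space ::
  "('g::ab_group_add \<Rightarrow> complex) measure \<Rightarrow> (('g \<Rightarrow> complex) \<Rightarrow> enat)
    \<Rightarrow> (nat \<Rightarrow> ('g \<Rightarrow> complex) \<Rightarrow> complex) set" where
  "l2_space \<mu> m = {f.
     (\<forall>i. f i \<in> borel_measurable \<mu>) \<and>
     (\<forall>i. \<forall>\<omega>\<in>dual_group - level_set m i. f i \<omega> = 0) \<and>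
     (\<Sum>i. \<integral>\<^sup>+\<omega>. ennreal ((cmod (f i \<omega>))\<^sup>2) \<partial>\<mu>) < \<infinity>}"

definition l2_eq ::
  "('g \<Rightarrow> complex) measure \<Rightarrow> (nat \<Rightarrow> ('g \<Rightarrow> complex) \<Rightarrow> complex)
    \<Rightarrow> (nat \<Rightarrow> ('g \<Rightarrow> complex) \<Rightarrow> complex) \<Rightarrow> bool" where
  "l2_eq \<mu> f g \<longleftrightarrow> (\<forall>i. AE \<omega> in \<mu>. f i \<omega> = g i \<omega>)"

definition l2_norm ::
  "('g \<Rightarrow> complex) measure \<Rightarrow> (nat \<Rightarrow> ('g \<Rightarrow> complex) \<Rightarrow> complex) \<Rightarrow> real" where
  "l2_norm \<mu> f = sqrt (enn2real (\<Sum>i. \<integral>\<^sup>+\<omega>. ennreal ((cmod (f i \<omega>))\<^sup>2) \<partial>\<mu>))"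

definition ruelle ::
  "('g \<Rightarrow> 'g) \<Rightarrow> (nat \<Rightarrow> nat \<Rightarrow> ('g \<Rightarrow> complex) \<Rightarrow> complex)
    \<Rightarrow> (nat \<Rightarrow> ('g \<Rightarrow> complex) \<Rightarrow> complex) \<Rightarrow> (nat \<Rightarrow> ('g \<Rightarrow> complex) \<Rightarrow> complex)" where
  "ruelle \<alpha> h f = (\<lambda>j \<omega>. \<Sum>i. h i j \<omega> * f i (dual_hom \<alpha> \<omega>))"

definition ruelle_bounded ::
  "('g::ab_group_add \<Rightarrow> complex) measure \<Rightarrow> (('g \<Rightarrow> complex) \<Rightarrow> enat) \<Rightarrow> ('g \<Rightarrow> 'g)
    \<Rightarrow> (nat \<Rightarrow> nat \<Rightarrow> ('g \<Rightarrow> complex) \<Rightarrow> complex) \<Rightarrow> bool" where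
  "ruelle_bounded \<mu> m \<alpha> h \<longleftrightarrow>
     (\<forall>f\<in>l2_space \<mu> m.
        (AE \<omega> in \<mu>. \<forall>j. summable (\<lambda>i. h i j \<omega> * f i (dual_hom \<alpha> \<omega>))) \<and>
        ruelle \<alpha> h f \<in> l2_space \<mu> m) \<and>
     (\<exists>c. \<forall>f\<in>l2_space \<mu> m. l2_norm \<mu> (ruelle \<alpha> h f) \<le> c * l2_norm \<mu> f)"

text \<open>Isometries of a Hilbert space into itself are linear.\<close>

definition l2_isometry ::
  "('g::ab_group_add \<Rightarrow> complex) measure \<Rightarrow> (('g \<Rightarrow> complex) \<Rightarrow> enat)
    \<Rightarrow> ((nat \<Rightarrow> ('g \<Rightarrow> complex) \<Rightarrow> complex) \<Rightarrow> (nat \<Rightarrow> ('g \<Rightarrow> complex) \<Rightarrow> complex)) \<Rightarrow> bool" where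
  "l2_isometry \<mu> m T \<longleftrightarrow>
     (\<forall>f\<in>l2_space \<mu> m. T f \<in> l2_space \<mu> m \<and> l2_norm \<mu> (T f) = l2_norm \<mu> f) \<and>
     (\<forall>f\<in>l2_space \<mu> m. \<forall>g\<in>l2_space \<mu> m. \<forall>a b.
        l2_eq \<mu> (T (\<lambda>i \<omega>. a * f i \<omega> + b * g i \<omega>)) (\<lambda>i \<omega>. a * T f i \<omega> + b * T g i \<omega>))"

definition l2_range ::
  "('g::ab_group_add \<Rightarrow> complex) measure \<Rightarrow> (('g \<Rightarrow> complex) \<Rightarrow> enat)
    \<Rightarrow> ((nat \<Rightarrow> ('g \<Rightarrow> complex) \<Rightarrow> complex) \<Rightarrow> (nat \<Rightarrow> ('g \<Rightarrow> complex) \<Rightarrow> complex))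
    \<Rightarrow> (nat \<Rightarrow> ('g \<Rightarrow> complex) \<Rightarrow> complex) set" where
  "l2_range \<mu> m T = {g \<in> l2_space \<mu> m. \<exists>f\<in>l2_space \<mu> m. l2_eq \<mu> g (T f)}"

definition pure_isometry ::
  "('g::ab_group_add \<Rightarrow> complex) measure \<Rightarrow> (('g \<Rightarrow> complex) \<Rightarrow> enat)
    \<Rightarrow> ((nat \<Rightarrow> ('g \<Rightarrow> complex) \<Rightarrow> complex) \<Rightarrow> (nat \<Rightarrow> ('g \<Rightarrow> complex) \<Rightarrow> complex)) \<Rightarrow> bool" where
  "pure_isometry \<mu> m T \<longleftrightarrow>
     l2_isometry \<mu> m T \<and>
     (\<Inter>n\<in>{1..}. l2_range \<mu> m (T ^^ n)) = {g \<in> l2_space \<mu> m. l2_eq \<mu> g (\<lambda>i \<omega>. 0)}"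

definition l2_eigenvector ::
  "('g::ab_group_add \<Rightarrow> complex) measure \<Rightarrow> (('g \<Rightarrow> complex) \<Rightarrow> enat)
    \<Rightarrow> ((nat \<Rightarrow> ('g \<Rightarrow> complex) \<Rightarrow> complex) \<Rightarrow> (nat \<Rightarrow> ('g \<Rightarrow> complex) \<Rightarrow> complex))
    \<Rightarrow> (nat \<Rightarrow> ('g \<Rightarrow> complex) \<Rightarrow> complex) \<Rightarrow> complex \<Rightarrow> bool" where
  "l2_eigenvector \<mu> m T f z \<longleftrightarrow>
     f \<in> l2_space \<mu> m \<and> \<not> l2_eq \<mu> f (\<lambda>i \<omega>. 0) \<and> l2_eq \<mu> (T f) (\<lambda>i \<omega>. z * f i \<omega>)"

section \<open>Matrices\<close>

definition expansive :: "complex mat \<Rightarrow> bool" where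
  "expansive A \<longleftrightarrow> square_mat A \<and> (\<forall>z. eigenvalue A z \<longrightarrow> 1 < cmod z)"

definition seq_norm :: "'i set \<Rightarrow> ('i \<Rightarrow> complex) \<Rightarrow> ennreal" where
  "seq_norm I x = (if (\<lambda>i. (cmod (x i))\<^sup>2) summable_on I
                   then ennreal (sqrt (\<Sum>\<^sub>\<infinity>i\<in>I. (cmod (x i))\<^sup>2)) else \<infinity>)"

text \<open>Norms of the matrix with entries \<open>M i j\<close>, \<open>i \<in> I\<close>, \<open>j \<in> J\<close>, where \<open>I\<close> and \<open>J\<close> may be
  infinite.  In \<open>op_norm\<close> a row sum that does not converge gets the value \<open>0\<close>; this
  is harmless, since then the row is not square summable and its finite truncations already make
  the supremum infinite.\<close>

definition eucl_norm :: "nat set \<Rightarrow> nat set \<Rightarrow> (nat \<Rightarrow> nat \<Rightarrow> complex) \<Rightarrow> ennreal" where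
  "eucl_norm I J M = seq_norm (I \<times> J) (\<lambda>(i, j). M i j)"

definition op_norm :: "nat set \<Rightarrow> nat set \<Rightarrow> (nat \<Rightarrow> nat \<Rightarrow> complex) \<Rightarrow> ennreal" where
  "op_norm I J M = (SUP x\<in>{x. seq_norm J x \<le> 1}. seq_norm I (\<lambda>i. \<Sum>\<^sub>\<infinity>j\<in>J. M i j * x j))"

end

theory Submission
  imports Defs
begin

text \<open>Write \<open>\<beta>\<close> for the dual endomorphism and \<open>nsq f \<omega>\<close> for the squared norm of the vector \<open>f(\<omega>)\<close>.  The
  filter equation says that averaging \<open>nsq (S f)\<close> over the cosets of the kernel of \<open>\<beta>\<close> gives
  \<open>nsq f \<circ> \<beta>\<close>.  As the groups \<open>\<alpha>\<^sup>n(\<Gamma>)\<close> shrink to \<open>0\<close>, repeated averaging turns every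
  trigonometric polynomial into a constant, and by density it pushes every integrable function to
  its mean in \<open>L\<^sup>1\<close>.  Hence if \<open>f\<close> lies in all ranges and \<open>f = S\<^bsup>n+2\<^esup> r\<close> with \<open>n\<close> large, the
  pointwise norms of \<open>r\<close>, \<open>q = S r\<close> and \<open>p = S q\<close> are all close to one constant, off a small set.
  Choose a point \<open>\<omega>\<close> off that set with \<open>\<omega>\<close> and \<open>\<beta> \<omega>\<close> in \<open>F\<close>.  The smallness of \<open>B\<close> and \<open>D\<close>
  at \<open>\<beta> \<omega>\<close> concentrates \<open>q(\<beta> \<omega>)\<close> in the first block, which \<open>A(\<omega>)\<close> expands by \<open>1 + \<delta>\<close>, so
  \<open>p(\<omega>)\<close> is too long unless the constant is \<open>0\<close>.  An eigenvector would lie in all ranges.\<close>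

section \<open>Extending characters from subgroups of finite index\<close>

text \<open>Nothing is known about the preimages of f under \<open>S ^^ n\<close>, and they vary
  with n. The mixing bound must therefore be uniform: the number of steps depends only on
  \<open>nsq f\<close> and the tolerance, and every chain of averages that starts at
  \<open>nsq f\<close> obeys it. Averaging needs the kernel of \<beta> to have exactly N elements, a
  monomial to be killed unless its exponent lies in the range of \<alpha>, and \<beta> to be onto;
  all three come from one count of the extensions of a character from a subgroup of finite index.
  Three consecutive preimages are needed because the block estimates live at different points: B and
  D at \<beta> \<omega> bound the tail of q(\<beta> \<omega>) by the length of r two steps away,
  whereas A and C at \<omega> bound its head by the length of p(\<omega>) and the tail. The operator
  acts by the transposed matrix while the norms are those of H, and blocks may be infinite; so every
  norm hypothesis is first turned into a bound on finite bilinear forms, which is symmetric in rows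
  and columns.\<close>

primrec nmul :: "nat \<Rightarrow> 'a::monoid_add \<Rightarrow> 'a" where
  "nmul 0 x = 0"
| "nmul (Suc n) x = x + nmul n x"

lemma nmul_add: "nmul (a + b) x = nmul a x + nmul b x"
  by (induction a) (auto simp: add.assoc)

lemma nmul_mult: "nmul (a * b) x = nmul a (nmul b x)"
  by (induction a) (auto simp: nmul_add)

definition add_subgroup :: "'a::ab_group_add set \<Rightarrow> bool" where
  "add_subgroup H \<longleftrightarrow> 0 \<in> H \<and> (\<forall>x\<in>H. \<forall>y\<in>H. x - y \<in> H)"

lemma add_subgroupD:
  assumes "add_subgroup H"
  shows "0 \<in> H" "x \<in> H \<Longrightarrow> y \<in> H \<Longrightarrow> x - y \<in> H" "x \<in> H \<Longrightarrow> - x \<in> H"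
    "x \<in> H \<Longrightarrow> y \<in> H \<Longrightarrow> x + y \<in> H"
proof -
  show "0 \<in> H" using assms by (auto simp: add_subgroup_def)
  show diff: "x - y \<in> H" if "x \<in> H" "y \<in> H" for x y
    using assms that by (auto simp: add_subgroup_def)
  show uminus: "- x \<in> H" if "x \<in> H" for x
    using diff[OF \<open>0 \<in> H\<close> that] by simp
  show "x + y \<in> H" if "x \<in> H" "y \<in> H"
    using diff[OF that(1) uminus[OF that(2)]] by simp
qed

lemma add_subgroup_nmul: "add_subgroup H \<Longrightarrow> x \<in> H \<Longrightarrow> nmul n x \<in> H"
  by (induction n) (auto simp: add_subgroupD)

lemma coset_eq_iff:
  fixes H :: "'a::ab_group_add set"
  assumes "add_subgroup H"
  shows "(+) x ` H = (+) y ` H \<longleftrightarrow> x - y \<in> H"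
proof
  assume "(+) x ` H = (+) y ` H"
  moreover have "x \<in> (+) x ` H"
    using add_subgroupD(1)[OF assms] by (metis add.right_neutral image_eqI)
  ultimately obtain h where "x = y + h" "h \<in> H" by blast
  then show "x - y \<in> H" by simp
next
  assume *: "x - y \<in> H"
  have "(+) u ` H \<subseteq> (+) v ` H" if "u - v \<in> H" for u v
  proof
    fix z assume "z \<in> (+) u ` H"
    then obtain h where "h \<in> H" "z = u + h" by auto
    then have "z = v + ((u - v) + h)" "(u - v) + h \<in> H"
      using add_subgroupD(4)[OF assms that] by auto
    then show "z \<in> (+) v ` H" by blast
  qed
  from this[OF *] this[of y x] show "(+) x ` H = (+) y ` H"
    using add_subgroupD(3)[OF assms *] by auto
qed

section \<open>Adjoining one element to a subgroup of finite index\<close>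

definition cosets :: "'a::ab_group_add set \<Rightarrow> 'a set set" where
  "cosets H = range (\<lambda>x. (+) x ` H)"

text \<open>Natural multiples suffice: when H has finite index, some positive multiple of x lies in
  H, so a negative multiple differs from a natural one by an element of H.\<close>

definition adjoin :: "'a::ab_group_add set \<Rightarrow> 'a \<Rightarrow> 'a set" where
  "adjoin H x = {h + nmul j x | h j. h \<in> H}"

definition order_mod :: "'a::ab_group_add set \<Rightarrow> 'a \<Rightarrow> nat" where
  "order_mod H x = (LEAST d. d > 0 \<and> nmul d x \<in> H)"

context
  fixes H :: "'a::ab_group_add set" and x :: 'a and d :: nat
  assumes H: "add_subgroup H" and fin: "finite (cosets H)"
  defines "d \<equiv> order_mod H x"
begin

text \<open>Pigeonhole: the multiples of x fall into finitely many cosets, so two different ones are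
  congruent modulo H, and their difference is a positive multiple of x in H.\<close>

lemma order_mod: "d > 0" "nmul d x \<in> H"
proof -
  have "range (\<lambda>j. (+) (nmul j x) ` H) \<subseteq> cosets H" by (auto simp: cosets_def)
  then have "\<not> inj (\<lambda>j. (+) (nmul j x) ` H)"
    using fin finite_subset range_inj_infinite by blast
  then obtain i j where "i \<noteq> j" "(+) (nmul i x) ` H = (+) (nmul j x) ` H"
    by (auto simp: inj_on_def)
  then have ij: "i \<noteq> j" "nmul i x - nmul j x \<in> H" "nmul j x - nmul i x \<in> H"
    using coset_eq_iff[OF H] by metis+
  have "\<exists>d>0. nmul d x \<in> H"
  proof (cases "i < j")
    case True
    then have "nmul j x = nmul (j - i) x + nmul i x" by (metis nmul_add le_add_diff_inverse2 less_imp_le)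
    with ij True show ?thesis by (intro exI[of _ "j - i"]) simp
  next
    case False
    then have "nmul i x = nmul (i - j) x + nmul j x"
      by (metis nmul_add le_add_diff_inverse2 not_le less_imp_le)
    with ij False show ?thesis by (intro exI[of _ "i - j"]) simp
  qed
  then have "d > 0 \<and> nmul d x \<in> H" unfolding d_def order_mod_def by (rule LeastI_ex)
  then show "d > 0" "nmul d x \<in> H" by auto
qed

lemma order_mod_dvd:
  assumes "nmul n x \<in> H" shows "d dvd n"
proof (rule ccontr)
  assume "\<not> d dvd n"
  then have pos: "n mod d > 0" by (simp add: dvd_eq_mod_eq_0)
  have "nmul n x = nmul (n div d) (nmul d x) + nmul (n mod d) x"
    by (simp flip: nmul_mult nmul_add)
  then have "nmul (n mod d) x = nmul n x - nmul (n div d) (nmul d x)" by simp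
  also have "\<dots> \<in> H" by (intro add_subgroupD(2)[OF H] assms add_subgroup_nmul[OF H] order_mod)
  finally have "d \<le> n mod d" using pos unfolding d_def order_mod_def by (intro Least_le) auto
  with order_mod(1) show False by (metis mod_less_divisor not_le)
qed

lemma add_subgroup_adjoin: "add_subgroup (adjoin H x)"
  unfolding add_subgroup_def
proof (intro conjI ballI)
  show "0 \<in> adjoin H x"
    using add_subgroupD(1)[OF H] unfolding adjoin_def by (auto intro!: exI[of _ 0])
next
  fix u v assume "u \<in> adjoin H x" "v \<in> adjoin H x"
  then obtain a i b j where *: "a \<in> H" "b \<in> H" "u = a + nmul i x" "v = b + nmul j x"
    unfolding adjoin_def by blast
  \<comment> \<open>The negative multiple -j x is rewritten as (j d - j) x minus j (d x), and d x is
    in H; this inequality makes the truncated subtraction exact.\<close>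
  have "j \<le> j * d" using order_mod(1) by simp
  then have "nmul (j * d) x = nmul j x + nmul (j * d - j) x"
    by (simp flip: nmul_add)
  then have "u - v = (a - b - nmul j (nmul d x)) + nmul (i + (j * d - j)) x"
    using * by (simp add: nmul_add algebra_simps flip: nmul_mult)
  moreover have "a - b - nmul j (nmul d x) \<in> H"
    by (intro add_subgroupD(2)[OF H] * add_subgroup_nmul[OF H order_mod(2)])
  ultimately show "u - v \<in> adjoin H x" unfolding adjoin_def by blast
qed

lemma adjoin_superset: "H \<subseteq> adjoin H x"
proof
  fix h assume "h \<in> H"
  then show "h \<in> adjoin H x" unfolding adjoin_def by (auto intro!: exI[of _ h] exI[of _ "0::nat"])
qed

lemma adjoin_mem: "x \<in> adjoin H x"
  using add_subgroupD(1)[OF H] unfolding adjoin_def by (auto intro!: exI[of _ 0] exI[of _ 1])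

text \<open>A coset of \<open>adjoin H x\<close> with representative r splits into the d cosets of H
  through r + j x for j < d: if two of them agree, d divides the difference of the indices, and any
  multiple of x can be reduced modulo d at the cost of an element of H.\<close>

lemma card_cosets_adjoin: "finite (cosets (adjoin H x))" "card (cosets H) = d * card (cosets (adjoin H x))"
proof -
  let ?H' = "adjoin H x"
  define r where "r C = (SOME y. C = (+) y ` ?H')" for C
  have r: "C = (+) (r C) ` ?H'" if "C \<in> cosets ?H'" for C
    using that unfolding r_def by (intro someI_ex[of "\<lambda>y. C = (+) y ` ?H'"]) (auto simp only: cosets_def)
  define f where "f = (\<lambda>(C, j). (+) (r C + nmul j x) ` H)"
  have "inj_on f (cosets ?H' \<times> {..<d})"
  proof (rule inj_onI, clarify)
    fix C i D j assume C: "C \<in> cosets ?H'" "D \<in> cosets ?H'" and i: "i < d" "j < d"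
      and "f (C, i) = f (D, j)"
    then have *: "r C + nmul i x - (r D + nmul j x) \<in> H"
      using coset_eq_iff[OF H] by (simp add: f_def)
    have "r C - r D = (r C + nmul i x - (r D + nmul j x)) - (nmul i x - nmul j x)" by simp
    moreover have "nmul k x \<in> ?H'" for k by (intro add_subgroup_nmul add_subgroup_adjoin adjoin_mem)
    ultimately have "r C - r D \<in> ?H'"
      using * add_subgroupD(2)[OF add_subgroup_adjoin] adjoin_superset by (metis subsetD)
    then have CD: "C = D" using r[OF C(1)] r[OF C(2)] coset_eq_iff[OF add_subgroup_adjoin] by metis
    have "i = j" if "nmul i x - nmul j x \<in> H" "i < d" "j < d" "i \<ge> j" for i j
    proof -
      have "nmul i x - nmul j x = nmul (i - j) x" using that(4)
        by (metis nmul_add le_add_diff_inverse2 add_diff_cancel_right')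
      then have "d dvd i - j" using that order_mod_dvd by auto
      then show ?thesis using that by (auto dest!: dvd_imp_le)
    qed
    moreover have "nmul i x - nmul j x \<in> H" using * CD by simp
    moreover from this have "nmul j x - nmul i x \<in> H" using add_subgroupD(3)[OF H] by fastforce
    ultimately have "i = j" using i by (metis nle_le)
    with CD show "C = D \<and> i = j" by simp
  qed
  moreover have "f ` (cosets ?H' \<times> {..<d}) = cosets H"
  proof
    show "f ` (cosets ?H' \<times> {..<d}) \<subseteq> cosets H" by (auto simp: f_def cosets_def)
  next
    show "cosets H \<subseteq> f ` (cosets ?H' \<times> {..<d})"
    proof
      fix D assume "D \<in> cosets H"
      then obtain y where D: "D = (+) y ` H" by (auto simp: cosets_def)
      define C where "C = (+) y ` ?H'"
      have C: "C \<in> cosets ?H'" by (auto simp: C_def cosets_def)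
      then have "y - r C \<in> ?H'"
        using r[OF C] coset_eq_iff[OF add_subgroup_adjoin] unfolding C_def by metis
      then obtain h j where h: "h \<in> H" "y - r C = h + nmul j x" unfolding adjoin_def by blast
      have "nmul j x = nmul (j div d) (nmul d x) + nmul (j mod d) x"
        by (simp flip: nmul_mult nmul_add)
      with h(2) have "y - (r C + nmul (j mod d) x) = h + nmul (j div d) (nmul d x)"
        by (simp add: algebra_simps)
      also have "\<dots> \<in> H" by (intro add_subgroupD(4)[OF H] h add_subgroup_nmul[OF H order_mod(2)])
      finally have "D = f (C, j mod d)" using D coset_eq_iff[OF H] by (simp add: f_def)
      moreover have "j mod d < d" using order_mod by simp
      ultimately show "D \<in> f ` (cosets ?H' \<times> {..<d})" using C by blast
    qed
  qed
  ultimately have bij: "bij_betw f (cosets ?H' \<times> {..<d}) (cosets H)" by (simp add: bij_betw_def)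
  have "finite (cosets ?H' \<times> {..<d})" using bij_betw_finite[OF bij] fin by simp
  moreover have "{..<d} \<noteq> {}" using order_mod by auto
  ultimately show "finite (cosets ?H')" by (auto simp: finite_cartesian_product_iff)
  show "card (cosets H) = d * card (cosets ?H')"
    using bij_betw_same_card[OF bij] by (simp add: card_cartesian_product mult.commute)
qed

end

section \<open>Counting the extensions of a character\<close>

definition character_on :: "'a::ab_group_add set \<Rightarrow> ('a \<Rightarrow> complex) \<Rightarrow> bool" where
  "character_on H \<rho> \<longleftrightarrow> (\<forall>x\<in>H. cmod (\<rho> x) = 1) \<and> (\<forall>x\<in>H. \<forall>y\<in>H. \<rho> (x + y) = \<rho> x * \<rho> y)"

definition extensions :: "'a::ab_group_add set \<Rightarrow> ('a \<Rightarrow> complex) \<Rightarrow> ('a \<Rightarrow> complex) set" where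
  "extensions H \<rho> = {\<omega> \<in> dual_group. \<forall>x\<in>H. \<omega> x = \<rho> x}"

lemma character_on_nmul:
  assumes "add_subgroup H" "character_on H \<rho>" "x \<in> H"
  shows "\<rho> (nmul n x) = \<rho> x ^ n"
proof (induction n)
  case 0
  have "\<rho> (0 + 0) = \<rho> 0 * \<rho> 0" "cmod (\<rho> 0) = 1"
    using assms(2) add_subgroupD(1)[OF assms(1)] unfolding character_on_def by metis+
  then show ?case by auto
next
  case (Suc n)
  then show ?case using assms add_subgroup_nmul[OF assms(1,3)] by (simp add: character_on_def)
qed

lemma character_on_zero: "add_subgroup H \<Longrightarrow> character_on H \<rho> \<Longrightarrow> \<rho> 0 = 1"
  using character_on_nmul[where n = 0 and x = 0] add_subgroupD(1) by fastforce

lemma add_subgroup_UNIV: "add_subgroup UNIV"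
  by (simp add: add_subgroup_def)

lemma dual_group_character_on: "\<omega> \<in> dual_group \<longleftrightarrow> character_on UNIV \<omega>"
  by (simp add: dual_group_def character_on_def)

text \<open>The value z at x has to respect that d x lies in H. This is also enough: if h + i x = g
  + j x, then d divides j - i, so both representations prescribe the same value.\<close>

lemma character_extend_step:
  fixes H :: "'a::ab_group_add set"
  assumes H: "add_subgroup H" "finite (cosets H)" and \<rho>: "character_on H \<rho>"
    and z: "z ^ order_mod H x = \<rho> (nmul (order_mod H x) x)"
  obtains \<rho>' where "character_on (adjoin H x) \<rho>'" "\<And>h j. h \<in> H \<Longrightarrow> \<rho>' (h + nmul j x) = \<rho> h * z ^ j"
proof -
  let ?d = "order_mod H x"
  note d = order_mod[OF H, of x]
  have cz: "cmod z = 1"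
  proof -
    have "cmod (z ^ ?d) = 1" using z \<rho> d by (simp add: character_on_def)
    then show ?thesis using d(1) using power_eq_imp_eq_base[of "cmod z" ?d 1] d(1) by (simp add: norm_power)
  qed
  have wd: "\<rho> h * z ^ i = \<rho> g * z ^ j"
    if hg: "h \<in> H" "g \<in> H" and e: "h + nmul i x = g + nmul j x" and "i \<le> j" for h g i j
  proof -
    have *: "nmul j x = nmul (j - i) x + nmul i x"
      using \<open>i \<le> j\<close> by (simp flip: nmul_add)
    then have h: "h = g + nmul (j - i) x" using e by (simp add: algebra_simps)
    then have "nmul (j - i) x \<in> H" using add_subgroupD(2)[OF H(1) hg] by simp
    then have "?d dvd j - i" using order_mod_dvd[OF H] by blast
    then obtain q where q: "j - i = q * ?d" by (auto simp: dvd_def mult.commute)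
    have "\<rho> h = \<rho> g * \<rho> (nmul (j - i) x)"
      using \<rho> hg \<open>nmul (j - i) x \<in> H\<close> unfolding h by (simp add: character_on_def)
    also have "\<rho> (nmul (j - i) x) = \<rho> (nmul ?d x) ^ q"
      unfolding q nmul_mult using character_on_nmul[OF H(1) \<rho> d(2)] .
    also have "\<dots> = z ^ (j - i)" unfolding q by (simp add: mult.commute[of q] power_mult flip: z)
    finally show ?thesis using \<open>i \<le> j\<close> by (simp flip: power_add)
  qed
  \<comment> \<open>\<open>SOME\<close> picks any representation of y; by \<open>wd\<close> the
    value does not depend on the choice.\<close>
  define \<rho>' where "\<rho>' y = (let (h, j) = SOME (h, j). h \<in> H \<and> y = h + nmul j x in \<rho> h * z ^ j)" for y
  have \<rho>': "\<rho>' (h + nmul j x) = \<rho> h * z ^ j" if "h \<in> H" for h j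
  proof -
    obtain g i where gi: "(SOME (g, i). g \<in> H \<and> h + nmul j x = g + nmul i x) = (g, i)" by fastforce
    have "case (g, i) of (g, i) \<Rightarrow> g \<in> H \<and> h + nmul j x = g + nmul i x"
      unfolding gi[symmetric] by (rule someI[of _ "(h, j)"]) (use that in auto)
    then have "\<rho> h * z ^ j = \<rho> g * z ^ i"
      using wd[of h g j i] wd[of g h i j] that by (cases "i \<le> j") auto
    then show ?thesis by (simp add: \<rho>'_def gi)
  qed
  have "character_on (adjoin H x) \<rho>'"
    unfolding character_on_def
  proof (intro conjI ballI)
    fix u assume "u \<in> adjoin H x"
    then obtain h j where "h \<in> H" "u = h + nmul j x" unfolding adjoin_def by blast
    then show "cmod (\<rho>' u) = 1"
      using \<rho>' cz \<rho> by (simp add: norm_mult norm_power character_on_def)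
  next
    fix u v assume "u \<in> adjoin H x" "v \<in> adjoin H x"
    then obtain a i b j where *: "a \<in> H" "b \<in> H" "u = a + nmul i x" "v = b + nmul j x"
      unfolding adjoin_def by blast
    have "u + v = (a + b) + nmul (i + j) x" using * by (simp add: nmul_add algebra_simps)
    then have "\<rho>' (u + v) = \<rho> (a + b) * z ^ (i + j)"
      using \<rho>' add_subgroupD(4)[OF H(1)] * by metis
    then show "\<rho>' (u + v) = \<rho>' u * \<rho>' v"
      using * \<rho>' \<rho> by (simp add: character_on_def power_add)
  qed
  then show ?thesis using that \<rho>' by blast
qed

text \<open>Induction on the index: an extension amounts to a value at a new x, which is a d-th root
  of \<rho>(d x), followed by an extension from \<open>adjoin H x\<close>. There are d roots, and
  the index drops by the same factor d. The exact count is used three times: its positivity shows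
  that \<beta> is onto, the trivial character gives the size of the kernel, and the strict drop
  separates points from the range of \<alpha>.\<close>

theorem card_extensions:
  fixes H :: "'a::ab_group_add set"
  assumes "add_subgroup H" "finite (cosets H)" "character_on H \<rho>"
  shows "finite (extensions H \<rho>) \<and> card (extensions H \<rho>) = card (cosets H)"
  using assms
proof (induction "card (cosets H)" arbitrary: H \<rho> rule: less_induct)
  case less
  note H = less.prems
  show ?case
  proof (cases "H = UNIV")
    case True
    have "(+) x ` UNIV = UNIV" for x :: 'a by (metis surj_plus)
    then have "cosets H = {UNIV}" using True by (auto simp: cosets_def)
    moreover have "extensions H \<rho> = {\<rho>}"
      using True H(3) by (auto simp: extensions_def dual_group_character_on)
    ultimately show ?thesis by simp
  next
    case False
    then obtain x where x: "x \<notin> H" by auto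
    let ?d = "order_mod H x" and ?H' = "adjoin H x"
    note d = order_mod[OF H(1,2), of x]
    note H' = add_subgroup_adjoin[OF H(1,2), of x] card_cosets_adjoin[OF H(1,2), of x]
    have "?d \<noteq> 1" using d(2) x by auto
    then have "?d \<ge> 2" using d(1) by simp
    moreover have "card (cosets ?H') > 0"
      using H'(2) by (simp add: card_gt_0_iff) (simp add: cosets_def)
    ultimately have less: "card (cosets ?H') < card (cosets H)" unfolding H'(3) by auto
    define Z where "Z = {z. z ^ ?d = \<rho> (nmul ?d x)}"
    have "cmod (\<rho> (nmul ?d x)) = 1" using H(3) d(2) by (simp add: character_on_def)
    then have "\<rho> (nmul ?d x) \<noteq> 0" by auto
    then have cZ: "card Z = ?d" unfolding Z_def using d(1) by (rule card_nth_roots)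
    then have fZ: "finite Z" using d(1) card_ge_0_finite by metis
    have "\<exists>\<rho>'. character_on ?H' \<rho>' \<and> (\<forall>h\<in>H. \<forall>j. \<rho>' (h + nmul j x) = \<rho> h * z ^ j)"
      if "z \<in> Z" for z
    proof -
      have "z ^ ?d = \<rho> (nmul ?d x)" using that by (simp add: Z_def)
      from character_extend_step[OF H this] show ?thesis by (metis (no_types))
    qed
    then have "\<forall>z\<in>Z. \<exists>\<rho>'. character_on ?H' \<rho>' \<and> (\<forall>h\<in>H. \<forall>j. \<rho>' (h + nmul j x) = \<rho> h * z ^ j)"
      by blast
    from bchoice[OF this] obtain X where X: "\<And>z. z \<in> Z \<Longrightarrow> character_on ?H' (X z)"
      "\<And>z h j. z \<in> Z \<Longrightarrow> h \<in> H \<Longrightarrow> X z (h + nmul j x) = \<rho> h * z ^ j" by blast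
    have Xx: "X z x = z" if "z \<in> Z" for z
      using X(2)[OF that add_subgroupD(1)[OF H(1)], of 1] character_on_zero[OF H(1,3)] by simp
    have IH: "finite (extensions ?H' (X z))" "card (extensions ?H' (X z)) = card (cosets ?H')" if "z \<in> Z" for z
      using less.hyps[OF less H'(1,2) X(1)[OF that]] by auto
    \<comment> \<open>The value at x sorts the extensions into classes, one for each root z;
      different roots give disjoint classes.\<close>
    have eq: "extensions H \<rho> = (\<Union>z\<in>Z. extensions ?H' (X z))"
    proof (intro equalityI subsetI)
      fix \<omega> assume w: "\<omega> \<in> extensions H \<rho>"
      then have ch: "character_on UNIV \<omega>" by (simp add: extensions_def dual_group_character_on)
      have n: "\<omega> (nmul j x) = \<omega> x ^ j" for j
        by (rule character_on_nmul[OF add_subgroup_UNIV ch]) simp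
      have "\<omega> (nmul ?d x) = \<rho> (nmul ?d x)" using w d(2) by (auto simp: extensions_def)
      then have "\<omega> x \<in> Z" using n by (simp add: Z_def)
      moreover have "\<omega> u = X (\<omega> x) u" if u: "u \<in> ?H'" for u
      proof -
        obtain h j where "h \<in> H" "u = h + nmul j x" using u unfolding adjoin_def by blast
        then show ?thesis
          using X(2)[OF \<open>\<omega> x \<in> Z\<close>] ch n w by (simp add: character_on_def extensions_def)
      qed
      ultimately show "\<omega> \<in> (\<Union>z\<in>Z. extensions ?H' (X z))" using w by (auto simp: extensions_def)
    next
      fix \<omega> assume "\<omega> \<in> (\<Union>z\<in>Z. extensions ?H' (X z))"
      then obtain z where z: "z \<in> Z" "\<omega> \<in> extensions ?H' (X z)" by auto
      have "\<omega> h = \<rho> h" if "h \<in> H" for h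
        using X(2)[OF z(1) that, of 0] z(2) subsetD[OF adjoin_superset[OF H(1,2)] that]
        by (simp add: extensions_def)
      then show "\<omega> \<in> extensions H \<rho>" using z by (auto simp: extensions_def)
    qed
    have "card (extensions H \<rho>) = (\<Sum>z\<in>Z. card (extensions ?H' (X z)))"
      unfolding eq
    proof (rule card_UN_disjoint[OF fZ])
      show "\<forall>z\<in>Z. finite (extensions ?H' (X z))" using IH by auto
      show "\<forall>z\<in>Z. \<forall>z'\<in>Z. z \<noteq> z' \<longrightarrow> extensions ?H' (X z) \<inter> extensions ?H' (X z') = {}"
      proof (intro ballI impI, rule ccontr)
        fix z z' assume z: "z \<in> Z" "z' \<in> Z" "z \<noteq> z'"
          and "extensions ?H' (X z) \<inter> extensions ?H' (X z') \<noteq> {}"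
        then obtain \<omega> where "\<omega> \<in> extensions ?H' (X z)" "\<omega> \<in> extensions ?H' (X z')" by auto
        then have "X z x = X z' x" using adjoin_mem[OF H(1,2)] by (simp add: extensions_def)
        with Xx z show False by metis
      qed
    qed
    also have "\<dots> = card (cosets H)" unfolding H'(3) using IH cZ by simp
    finally show ?thesis using eq fZ IH by auto
  qed
qed

section \<open>Haar measure and the dual endomorphism\<close>

lemma dual_mult_in_dual: "\<omega> \<in> dual_group \<Longrightarrow> \<zeta> \<in> dual_group \<Longrightarrow> dual_mult \<omega> \<zeta> \<in> dual_group"
  by (auto simp: dual_group_def dual_mult_def norm_mult algebra_simps)

lemma dual_mult_commute: "dual_mult \<omega> \<zeta> = dual_mult \<zeta> \<omega>"
  by (auto simp: dual_mult_def)

lemma dual_mult_assoc: "dual_mult (dual_mult \<omega> \<zeta>) \<eta> = dual_mult \<omega> (dual_mult \<zeta> \<eta>)"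
  by (auto simp: dual_mult_def)

lemma dual_mult_one: "dual_mult \<omega> dual_one = \<omega>"
  by (auto simp: dual_mult_def dual_one_def)

definition dual_inv :: "('g \<Rightarrow> complex) \<Rightarrow> 'g \<Rightarrow> complex" where
  "dual_inv \<omega> = (\<lambda>\<gamma>. cnj (\<omega> \<gamma>))"

lemma dual_inv_in_dual: "\<omega> \<in> dual_group \<Longrightarrow> dual_inv \<omega> \<in> dual_group"
  by (auto simp: dual_group_def dual_inv_def)

lemma dual_mult_inv: "\<omega> \<in> dual_group \<Longrightarrow> dual_mult \<omega> (dual_inv \<omega>) = dual_one"
  by (auto simp: dual_group_def dual_inv_def dual_mult_def dual_one_def complex_norm_square[symmetric])

lemma dual_group_zero: "\<omega> \<in> dual_group \<Longrightarrow> \<omega> 0 = 1"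
  using character_on_zero[OF add_subgroup_UNIV] by (simp add: dual_group_character_on)

lemma dual_group_uminus: "\<omega> \<in> dual_group \<Longrightarrow> \<omega> (- \<gamma>) = cnj (\<omega> \<gamma>)"
proof -
  assume w: "\<omega> \<in> dual_group"
  have "\<omega> (\<gamma> + - \<gamma>) = \<omega> \<gamma> * \<omega> (- \<gamma>)" using w unfolding dual_group_def by blast
  then have *: "\<omega> \<gamma> * \<omega> (- \<gamma>) = 1" using dual_group_zero[OF w] by simp
  have "\<omega> \<gamma> * cnj (\<omega> \<gamma>) = 1" using w by (simp add: dual_group_def complex_norm_square[symmetric])
  with * show ?thesis by (metis mult_cancel_left mult_zero_left zero_neq_one)
qed

text \<open>By Tychonoff the product of unit circles is compact, and the homomorphism equations cut
  out a closed subset. Compactness feeds Stone-Weierstrass and makes the dual a Borel set.\<close>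

lemma compact_dual_group: "compact (dual_group :: ('g::{ab_group_add,countable} \<Rightarrow> complex) set)"
proof -
  let ?P = "PiE UNIV (\<lambda>_. sphere 0 1) :: ('g \<Rightarrow> complex) set"
  have "compactin (product_topology (\<lambda>_. euclidean) UNIV) ?P"
    by (subst compactin_PiE) auto
  then have "compact ?P" by (simp add: euclidean_product_topology)
  moreover have "closed (\<Inter>\<gamma> \<gamma>'. {\<omega> :: 'g \<Rightarrow> complex. \<omega> (\<gamma> + \<gamma>') = \<omega> \<gamma> * \<omega> \<gamma>'})"
    by (intro closed_INT ballI closed_Collect_eq continuous_intros continuous_on_product_coordinates)
  ultimately have "compact (?P \<inter> (\<Inter>\<gamma> \<gamma>'. {\<omega> :: 'g \<Rightarrow> complex. \<omega> (\<gamma> + \<gamma>') = \<omega> \<gamma> * \<omega> \<gamma>'}))"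
    by blast
  also have "\<dots> = dual_group" by (auto simp: dual_group_def PiE_iff)
  finally show ?thesis .
qed

lemma dual_group_borel: "(dual_group :: ('g::{ab_group_add,countable} \<Rightarrow> complex) set) \<in> sets borel"
  using compact_dual_group by (intro borel_closed compact_imp_closed)

section \<open>Haar measure and rotations\<close>

locale haar_dual =
  fixes \<mu> :: "('g::{ab_group_add,countable} \<Rightarrow> complex) measure"
  assumes haar: "haar_prob \<mu>"
begin

lemma space_mu: "space \<mu> = dual_group"
  and sets_mu: "sets \<mu> = sets (restrict_space borel dual_group)"
  and prob_mu: "prob_space \<mu>"
  using haar by (auto simp: haar_prob_def)

sublocale prob_space \<mu> by (rule prob_mu)

text \<open>Countability of the group enters here: the Borel sets of a countable product are
  generated by the coordinates, so measurability can be tested at each \<gamma>.\<close>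

lemma measurable_into_mu:
  assumes "\<And>x. x \<in> space M \<Longrightarrow> f x \<in> dual_group" "\<And>\<gamma>. (\<lambda>x. f x \<gamma>) \<in> borel_measurable M"
  shows "f \<in> measurable M \<mu>"
proof -
  have "f \<in> borel_measurable M" by (rule measurable_coordinatewise_then_product) fact
  then have "f \<in> measurable M (restrict_space borel dual_group)"
    using assms(1) by (intro measurable_restrict_space2) auto
  then show ?thesis using sets_mu by (metis measurable_cong_sets)
qed

lemma continuous_measurable_mu:
  assumes "continuous_on dual_group (f :: _ \<Rightarrow> 'b::topological_space)"
  shows "f \<in> borel_measurable \<mu>"
  using borel_measurable_continuous_on_restrict[OF assms] sets_mu by (metis measurable_cong_sets)

lemma coordinate_measurable: "(\<lambda>\<omega>. \<omega> \<gamma>) \<in> borel_measurable \<mu>"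
  by (intro continuous_measurable_mu continuous_on_product_coordinates continuous_on_subset[OF _ subset_UNIV])

lemma measurable_rotation: 
  assumes "\<eta> \<in> dual_group" shows "(\<lambda>\<omega>. dual_mult \<omega> \<eta>) \<in> measurable \<mu> \<mu>"
proof (rule measurable_into_mu)
  show "dual_mult x \<eta> \<in> dual_group" if "x \<in> space \<mu>" for x
    using that assms dual_mult_in_dual by (simp add: space_mu)
  show "(\<lambda>x. dual_mult x \<eta> \<gamma>) \<in> borel_measurable \<mu>" for \<gamma>
    unfolding dual_mult_def using coordinate_measurable by measurable
qed

lemma distr_rotation:
  assumes "\<eta> \<in> dual_group" shows "distr \<mu> \<mu> (\<lambda>\<omega>. dual_mult \<omega> \<eta>) = \<mu>"
proof (rule measure_eqI)
  fix A assume "A \<in> sets (distr \<mu> \<mu> (\<lambda>\<omega>. dual_mult \<omega> \<eta>))"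
  then have A: "A \<in> sets \<mu>" by simp
  have sub: "A \<subseteq> dual_group" using sets.sets_into_space[OF A] by (simp add: space_mu)
  have "(\<lambda>\<omega>. dual_mult \<omega> \<eta>) -` A \<inter> space \<mu> = dual_mult (dual_inv \<eta>) ` A"
  proof (intro equalityI subsetI)
    fix \<omega> assume w: "\<omega> \<in> (\<lambda>\<omega>. dual_mult \<omega> \<eta>) -` A \<inter> space \<mu>"
    have "\<omega> = dual_mult (dual_inv \<eta>) (dual_mult \<omega> \<eta>)"
      using dual_mult_inv[OF assms] by (metis dual_mult_assoc dual_mult_commute dual_mult_one)
    then show "\<omega> \<in> dual_mult (dual_inv \<eta>) ` A" using w by blast
  next
    fix \<omega> assume "\<omega> \<in> dual_mult (dual_inv \<eta>) ` A"
    then obtain a where a: "a \<in> A" "\<omega> = dual_mult (dual_inv \<eta>) a" by auto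
    then have "dual_mult \<omega> \<eta> = a"
      using dual_mult_inv[OF assms] by (metis dual_mult_assoc dual_mult_commute dual_mult_one)
    moreover have "\<omega> \<in> dual_group" using a sub dual_mult_in_dual dual_inv_in_dual[OF assms] by auto
    ultimately show "\<omega> \<in> (\<lambda>\<omega>. dual_mult \<omega> \<eta>) -` A \<inter> space \<mu>" using a by (simp add: space_mu)
  qed
  then show "emeasure (distr \<mu> \<mu> (\<lambda>\<omega>. dual_mult \<omega> \<eta>)) A = emeasure \<mu> A"
    using haar A dual_inv_in_dual[OF assms]
    by (simp add: emeasure_distr measurable_rotation[OF assms] haar_prob_def)
qed simp

lemma nn_integral_rotation:
  assumes "\<eta> \<in> dual_group" "f \<in> borel_measurable \<mu>"
  shows "(\<integral>\<^sup>+\<omega>. f (dual_mult \<omega> \<eta>) \<partial>\<mu>) = (\<integral>\<^sup>+\<omega>. f \<omega> \<partial>\<mu>)"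
  using nn_integral_distr[OF measurable_rotation[OF assms(1)], of f] assms
  by (simp add: distr_rotation)

lemma AE_rotation:
  assumes "\<eta> \<in> dual_group" "AE \<omega> in \<mu>. P \<omega>"
  shows "AE \<omega> in \<mu>. P (dual_mult \<omega> \<eta>)"
  using AE_distrD[OF measurable_rotation[OF assms(1)], of P] assms
  unfolding distr_rotation[OF assms(1)] by blast

end

section \<open>The dual endomorphism and its kernel\<close>

locale dual_endo = haar_dual \<mu> for \<mu> :: "('g::{ab_group_add,countable} \<Rightarrow> complex) measure" +
  fixes \<alpha> :: "'g \<Rightarrow> 'g" and N :: nat
  assumes hom: "\<And>x y. \<alpha> (x + y) = \<alpha> x + \<alpha> y" and inj: "inj \<alpha>"
    and index: "subgroup_index (range \<alpha>) = N" "N > 1"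
    and inter: "(\<Inter>n. range (\<alpha> ^^ n)) = {0}"
begin

abbreviation "\<beta> \<equiv> dual_hom \<alpha>"
abbreviation "K \<equiv> dual_kernel \<alpha>"

lemma hom_zero: "\<alpha> 0 = 0" using hom[of 0 0] by simp

lemma hom_diff: "\<alpha> (x - y) = \<alpha> x - \<alpha> y" using hom[of "x - y" y] by (simp add: algebra_simps)

lemma subgroup_range: "add_subgroup (range \<alpha>)"
  unfolding add_subgroup_def
  by (auto intro: range_eqI[where x = 0] simp: hom_zero simp flip: hom_diff)

lemma card_cosets_range: "card (cosets (range \<alpha>)) = N" "finite (cosets (range \<alpha>))"
proof -
  show "card (cosets (range \<alpha>)) = N" using index(1) by (simp add: subgroup_index_def cosets_def)
  then show "finite (cosets (range \<alpha>))" using index(2) by (metis card.infinite not_less0)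
qed

text \<open>The kernel consists of the extensions of the trivial character of
  \<open>range \<alpha>\<close>, so its size is the index.\<close>

lemma finite_kernel: "finite K" and card_kernel: "card K = N"
proof -
  have "K = extensions (range \<alpha>) (\<lambda>_. 1)"
    by (auto simp: dual_kernel_def extensions_def dual_hom_def dual_one_def fun_eq_iff)
  moreover have "character_on (range \<alpha>) (\<lambda>_. 1)" by (simp add: character_on_def)
  ultimately show "finite K" "card K = N"
    using card_extensions[OF subgroup_range card_cosets_range(2)] card_cosets_range by metis+
qed

lemma kernel_dual: "\<zeta> \<in> K \<Longrightarrow> \<zeta> \<in> dual_group" by (simp add: dual_kernel_def)

lemma dual_hom_in_dual: "\<omega> \<in> dual_group \<Longrightarrow> \<beta> \<omega> \<in> dual_group"
  by (auto simp: dual_group_def dual_hom_def hom)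

lemma dual_hom_mult: "\<beta> (dual_mult \<omega> \<zeta>) = dual_mult (\<beta> \<omega>) (\<beta> \<zeta>)"
  by (simp add: dual_hom_def dual_mult_def)

lemma dual_hom_kernel: "\<zeta> \<in> K \<Longrightarrow> \<beta> (dual_mult \<omega> \<zeta>) = \<beta> \<omega>"
  by (simp add: dual_hom_mult dual_kernel_def dual_mult_one)

text \<open>A preimage of \<omega> is an extension of the character that takes \<alpha> x to
  \<omega> x on the range; there are N > 0 of them.\<close>

lemma dual_hom_surj:
  assumes "\<omega> \<in> dual_group" obtains \<eta> where "\<eta> \<in> dual_group" "\<beta> \<eta> = \<omega>"
proof -
  let ?r = "\<lambda>x. \<omega> (inv_into UNIV \<alpha> x)"
  have "character_on (range \<alpha>) ?r"
    unfolding character_on_def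
  proof (intro conjI ballI)
    fix x y assume "x \<in> range \<alpha>" "y \<in> range \<alpha>"
    then obtain a b where "x = \<alpha> a" "y = \<alpha> b" by auto
    moreover from this have "x + y = \<alpha> (a + b)" by (simp add: hom)
    ultimately show "?r (x + y) = ?r x * ?r y"
      using assms inj by (simp add: dual_group_def)
  qed (use assms in \<open>auto simp: dual_group_def\<close>)
  from card_extensions[OF subgroup_range card_cosets_range(2) this]
  have "card (extensions (range \<alpha>) ?r) > 0" using card_cosets_range(1) index(2) by simp
  then obtain \<eta> where "\<eta> \<in> extensions (range \<alpha>) ?r" by (auto simp: card_gt_0_iff)
  then have "\<eta> \<in> dual_group" "\<beta> \<eta> = \<omega>"
    using inj by (auto simp: extensions_def dual_hom_def)
  then show ?thesis by (rule that)
qed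

text \<open>If all of K were 1 at \<gamma>, its N elements would extend the trivial character of the
  strictly larger subgroup \<open>adjoin (range \<alpha>) \<gamma>\<close>, whose index, and so its
  number of extensions, is below N.\<close>

lemma kernel_separates:
  assumes "\<gamma> \<notin> range \<alpha>" obtains \<zeta> where "\<zeta> \<in> K" "\<zeta> \<gamma> \<noteq> 1"
proof -
  let ?H' = "adjoin (range \<alpha>) \<gamma>" and ?d = "order_mod (range \<alpha>) \<gamma>"
  note H = subgroup_range card_cosets_range(2)
  note H' = add_subgroup_adjoin[OF H, of \<gamma>] card_cosets_adjoin[OF H, of \<gamma>]
  note d = order_mod[OF H, of \<gamma>]
  have "?d \<noteq> 1" using d(2) assms by auto
  then have "?d \<ge> 2" using d(1) by simp
  moreover have "card (cosets ?H') > 0" using H'(2) by (simp add: card_gt_0_iff) (simp add: cosets_def)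
  ultimately have less: "card (cosets ?H') < N" using H'(3) card_cosets_range(1) by (metis One_nat_def Suc_1 less_eq_Suc_le mult.commute mult.right_neutral mult_less_cancel1)
  have "\<exists>\<zeta>\<in>K. \<zeta> \<gamma> \<noteq> 1"
  proof (rule ccontr)
    assume "\<not> ?thesis"
    then have triv: "\<zeta> \<gamma> = 1" if "\<zeta> \<in> K" for \<zeta> using that by blast
    have "K \<subseteq> extensions ?H' (\<lambda>_. 1)"
    proof
      fix \<zeta> assume z: "\<zeta> \<in> K"
      then have ch: "character_on UNIV \<zeta>" using kernel_dual dual_group_character_on by blast
      have "\<zeta> u = 1" if u: "u \<in> ?H'" for u
      proof -
        obtain a j where "u = \<alpha> a + nmul j \<gamma>" using u unfolding adjoin_def by blast
        moreover have "\<zeta> (\<alpha> a) = 1" using z by (auto simp: dual_kernel_def dual_hom_def dual_one_def fun_eq_iff)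
        moreover have "\<zeta> (nmul j \<gamma>) = 1"
          using character_on_nmul[OF add_subgroup_UNIV ch] triv[OF z] by simp
        ultimately show ?thesis using ch by (simp add: character_on_def)
      qed
      then show "\<zeta> \<in> extensions ?H' (\<lambda>_. 1)" using z kernel_dual by (auto simp: extensions_def)
    qed
    moreover have "character_on ?H' (\<lambda>_. 1)" by (simp add: character_on_def)
    ultimately have "N \<le> card (cosets ?H')"
      using card_extensions[OF H'(1,2)] card_kernel by (metis card_mono)
    with less show False by simp
  qed
  then show ?thesis using that by blast
qed

lemma kernel_mult_bij:
  assumes "\<zeta> \<in> K" shows "bij_betw (dual_mult \<zeta>) K K"
proof -
  have "inj_on (dual_mult \<zeta>) K"
  proof (rule inj_onI)
    fix x y assume "dual_mult \<zeta> x = dual_mult \<zeta> y"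
    then have "dual_mult (dual_inv \<zeta>) (dual_mult \<zeta> x) = dual_mult (dual_inv \<zeta>) (dual_mult \<zeta> y)" by simp
    then show "x = y" using dual_mult_inv[OF kernel_dual[OF assms]]
      by (metis dual_mult_assoc dual_mult_commute dual_mult_one)
  qed
  moreover have "dual_mult \<zeta> ` K \<subseteq> K"
    using assms dual_mult_in_dual by (auto simp: dual_kernel_def dual_hom_mult dual_mult_one)
  ultimately show ?thesis
    using finite_kernel by (simp add: bij_betw_def endo_inj_surj)
qed

text \<open>Character orthogonality: for \<gamma> outside the range, multiplication by a \<zeta> in
  K with \<open>\<zeta> \<gamma> \<noteq> 1\<close> permutes K but multiplies the sum by \<zeta>
  \<gamma>, so the sum vanishes.\<close>

lemma sum_kernel: "(\<Sum>\<zeta>\<in>K. \<zeta> \<gamma>) = (if \<gamma> \<in> range \<alpha> then of_nat N else 0)"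
proof (cases "\<gamma> \<in> range \<alpha>")
  case True
  then have "(\<Sum>\<zeta>\<in>K. \<zeta> \<gamma>) = (\<Sum>\<zeta>\<in>K. 1)"
    by (intro sum.cong) (auto simp: dual_kernel_def dual_hom_def dual_one_def fun_eq_iff)
  then show ?thesis using True card_kernel by simp
next
  case False
  then obtain \<zeta> where z: "\<zeta> \<in> K" "\<zeta> \<gamma> \<noteq> 1" by (rule kernel_separates)
  have "(\<Sum>\<xi>\<in>K. \<xi> \<gamma>) = (\<Sum>\<xi>\<in>K. dual_mult \<zeta> \<xi> \<gamma>)"
    by (rule sum.reindex_bij_betw[OF kernel_mult_bij[OF z(1)], symmetric])
  also have "\<dots> = \<zeta> \<gamma> * (\<Sum>\<xi>\<in>K. \<xi> \<gamma>)" by (simp add: dual_mult_def sum_distrib_left)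
  finally show ?thesis using z(2) False by auto
qed

lemma measurable_dual_hom: "\<beta> \<in> measurable \<mu> \<mu>"
proof (rule measurable_into_mu)
  show "\<beta> x \<in> dual_group" if "x \<in> space \<mu>" for x
    using that dual_hom_in_dual by (simp add: space_mu)
  show "(\<lambda>x. \<beta> x \<gamma>) \<in> borel_measurable \<mu>" for \<gamma>
    unfolding dual_hom_def by (rule coordinate_measurable)
qed

text \<open>Uniqueness of Haar measure: integrate \<open>indicator A (\<beta> x * y)\<close> over \<open>x\<close> and \<open>y\<close> in both orders.\<close>
lemma distr_dual_hom: "distr \<mu> \<mu> \<beta> = \<mu>"
proof (rule measure_eqI)
  fix A assume "A \<in> sets (distr \<mu> \<mu> \<beta>)"
  then have A: "A \<in> sets \<mu>" by simp
  interpret pair_sigma_finite \<mu> \<mu> ..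
  have "(\<lambda>p. dual_mult (\<beta> (fst p)) (snd p)) \<in> measurable (\<mu> \<Otimes>\<^sub>M \<mu>) \<mu>"
  proof (rule measurable_into_mu)
    show "dual_mult (\<beta> (fst p)) (snd p) \<in> dual_group" if "p \<in> space (\<mu> \<Otimes>\<^sub>M \<mu>)" for p
      using that by (intro dual_mult_in_dual dual_hom_in_dual) (auto simp: space_pair_measure space_mu)
    show "(\<lambda>p. dual_mult (\<beta> (fst p)) (snd p) \<gamma>) \<in> borel_measurable (\<mu> \<Otimes>\<^sub>M \<mu>)" for \<gamma>
      unfolding dual_mult_def dual_hom_def
      by (intro borel_measurable_times measurable_compose[OF measurable_fst coordinate_measurable]
          measurable_compose[OF measurable_snd coordinate_measurable])
  qed
  from measurable_compose[OF this, of "indicator A :: _ \<Rightarrow> ennreal" borel] A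
  have *: "(\<lambda>(x, y). indicator A (dual_mult (\<beta> x) y) :: ennreal) \<in> borel_measurable (\<mu> \<Otimes>\<^sub>M \<mu>)"
    by (simp add: case_prod_beta)
  have "emeasure \<mu> A = (\<integral>\<^sup>+x. emeasure \<mu> A \<partial>\<mu>)" by (simp add: emeasure_space_1)
  also have "\<dots> = (\<integral>\<^sup>+x. (\<integral>\<^sup>+y. indicator A (dual_mult (\<beta> x) y) \<partial>\<mu>) \<partial>\<mu>)"
  proof (intro nn_integral_cong)
    fix x assume "x \<in> space \<mu>"
    then have "\<beta> x \<in> dual_group" using dual_hom_in_dual by (simp add: space_mu)
    from nn_integral_rotation[OF this borel_measurable_indicator[OF A]]
    show "emeasure \<mu> A = (\<integral>\<^sup>+y. indicator A (dual_mult (\<beta> x) y) \<partial>\<mu>)"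
      using A by (simp add: dual_mult_commute)
  qed
  also have "\<dots> = (\<integral>\<^sup>+y. (\<integral>\<^sup>+x. indicator A (dual_mult (\<beta> x) y) \<partial>\<mu>) \<partial>\<mu>)"
    using Fubini'[OF *] by simp
  also have "\<dots> = (\<integral>\<^sup>+y. emeasure (distr \<mu> \<mu> \<beta>) A \<partial>\<mu>)"
  proof (intro nn_integral_cong)
    fix y assume "y \<in> space \<mu>"
    then have "y \<in> dual_group" by (simp add: space_mu)
    \<comment> \<open>Since y is \<beta> y', the product of \<beta> x and y is \<beta> of the
      product of x and y'; rotating x by y' then removes y from the integral.\<close>
    then obtain y' where y': "y' \<in> dual_group" "\<beta> y' = y" by (rule dual_hom_surj)
    have "(\<lambda>x. indicator A (\<beta> x) :: ennreal) \<in> borel_measurable \<mu>"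
      by (rule measurable_compose[OF measurable_dual_hom borel_measurable_indicator[OF A]])
    from nn_integral_rotation[OF y'(1) this]
    have "(\<integral>\<^sup>+x. indicator A (dual_mult (\<beta> x) y) \<partial>\<mu>) = (\<integral>\<^sup>+x. indicator A (\<beta> x) \<partial>\<mu>)"
      by (simp add: dual_hom_mult y'(2))
    also have "\<dots> = (\<integral>\<^sup>+x. indicator A x \<partial>(distr \<mu> \<mu> \<beta>))"
      by (rule nn_integral_distr[symmetric]) (use A measurable_dual_hom in auto)
    finally show "(\<integral>\<^sup>+x. indicator A (dual_mult (\<beta> x) y) \<partial>\<mu>) = emeasure (distr \<mu> \<mu> \<beta>) A"
      using A by simp
  qed
  also have "\<dots> = emeasure (distr \<mu> \<mu> \<beta>) A" by (simp add: emeasure_space_1)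
  finally show "emeasure (distr \<mu> \<mu> \<beta>) A = emeasure \<mu> A" by simp
qed simp

lemma nn_integral_dual_hom:
  assumes "f \<in> borel_measurable \<mu>"
  shows "(\<integral>\<^sup>+\<omega>. f (\<beta> \<omega>) \<partial>\<mu>) = (\<integral>\<^sup>+\<omega>. f \<omega> \<partial>\<mu>)"
  using nn_integral_distr[OF measurable_dual_hom, of f] assms by (simp add: distr_dual_hom)

lemma AE_dual_hom:
  assumes "AE \<omega> in \<mu>. P \<omega>" shows "AE \<omega> in \<mu>. P (\<beta> \<omega>)"
  using AE_distrD[OF measurable_dual_hom, of P] assms unfolding distr_dual_hom by blast

lemma AE_kernel:
  assumes "AE \<omega> in \<mu>. P \<omega>" shows "AE \<omega> in \<mu>. \<forall>\<zeta>\<in>K. P (dual_mult \<omega> \<zeta>)"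
  using finite_kernel AE_rotation[OF kernel_dual assms] by (simp add: AE_finite_all)

end

section \<open>The Ruelle operator is an isometry\<close>

text \<open>The filter equation over one fibre: \<open>R \<zeta> i j\<close> is the entry
  \<open>h i j\<close> at the point \<omega>\<zeta>, w is the vector f(\<beta> \<omega>) common to
  all \<zeta>, and \<open>y \<zeta>\<close> is its image. For finitely many rows this is a Gram
  matrix computation. The series for y converges only entrywise, so infinitely many rows need norm
  control of the remainder, which the finite case supplies. The factor c carries the indicator of
  the level set.\<close>

lemma orthogonal_rows_isometry:
  fixes R :: "'k \<Rightarrow> nat \<Rightarrow> nat \<Rightarrow> complex"
  assumes K: "finite K"
    and sm: "\<And>\<zeta> i i'. \<zeta> \<in> K \<Longrightarrow> summable (\<lambda>j. R \<zeta> i j * cnj (R \<zeta> i' j))"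
    and orth: "\<And>i i'. (\<Sum>\<zeta>\<in>K. \<Sum>j. R \<zeta> i j * cnj (R \<zeta> i' j)) = of_nat N * (if i = i' then 1 else 0) * c i"
    and c: "\<And>i. w i \<noteq> 0 \<Longrightarrow> c i = 1" and w: "summable (\<lambda>i. (cmod (w i))\<^sup>2)"
    and y: "\<And>\<zeta> j. \<zeta> \<in> K \<Longrightarrow> (\<lambda>i. R \<zeta> i j * w i) sums y \<zeta> j"
  shows "\<And>\<zeta>. \<zeta> \<in> K \<Longrightarrow> summable (\<lambda>j. (cmod (y \<zeta> j))\<^sup>2)"
    and "(\<Sum>\<zeta>\<in>K. \<Sum>j. (cmod (y \<zeta> j))\<^sup>2) = real N * (\<Sum>i. (cmod (w i))\<^sup>2)"
proof -
  define W where "W = (\<Sum>i. (cmod (w i))\<^sup>2)"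
  define Y where "Y I \<zeta> j = (\<Sum>i\<in>I. R \<zeta> i j * w i)" for I \<zeta> j
  define tail where "tail m = W - (\<Sum>i<m. (cmod (w i))\<^sup>2)" for m
  have Wlim: "(\<lambda>m. \<Sum>i<m. (cmod (w i))\<^sup>2) \<longlonglongrightarrow> W" unfolding W_def by (rule summable_LIMSEQ[OF w])
  have Wle: "(\<Sum>i<m. (cmod (w i))\<^sup>2) \<le> W" for m unfolding W_def by (rule sum_le_suminf[OF w]) auto
  have fin: "\<And>\<zeta>. \<zeta> \<in> K \<Longrightarrow> summable (\<lambda>j. (cmod (Y I \<zeta> j))\<^sup>2)"
    "(\<Sum>\<zeta>\<in>K. \<Sum>j. (cmod (Y I \<zeta> j))\<^sup>2) = N * (\<Sum>i\<in>I. (cmod (w i))\<^sup>2)" if I: "finite I" for I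
  proof -
    let ?G = "\<lambda>\<zeta> i i'. \<Sum>j. R \<zeta> i j * cnj (R \<zeta> i' j)"
    have s: "(\<lambda>j. complex_of_real ((cmod (Y I \<zeta> j))\<^sup>2)) sums (\<Sum>i\<in>I. \<Sum>i'\<in>I. ?G \<zeta> i i' * (w i * cnj (w i')))"
      if "\<zeta> \<in> K" for \<zeta>
    proof -
      have "complex_of_real ((cmod (Y I \<zeta> j))\<^sup>2) = (\<Sum>i\<in>I. \<Sum>i'\<in>I. R \<zeta> i j * cnj (R \<zeta> i' j) * (w i * cnj (w i')))" for j
        unfolding complex_norm_square Y_def cnj_sum sum_product by (intro sum.cong refl) (simp add: ac_simps)
      then show ?thesis by (simp only:) (intro sums_sum sums_mult2 summable_sums sm[OF that])
    qed
    show sum: "summable (\<lambda>j. (cmod (Y I \<zeta> j))\<^sup>2)" if "\<zeta> \<in> K" for \<zeta>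
      using sums_summable[OF s[OF that]] by (simp only: summable_of_real_iff)
    have "complex_of_real (\<Sum>\<zeta>\<in>K. \<Sum>j. (cmod (Y I \<zeta> j))\<^sup>2) = (\<Sum>\<zeta>\<in>K. \<Sum>i\<in>I. \<Sum>i'\<in>I. ?G \<zeta> i i' * (w i * cnj (w i')))"
      unfolding of_real_sum
    proof (intro sum.cong refl)
      fix \<zeta> assume "\<zeta> \<in> K"
      from sums_unique[OF s[OF this]] suminf_of_real[OF sum[OF this], where 'a = complex]
      show "complex_of_real (\<Sum>j. (cmod (Y I \<zeta> j))\<^sup>2) = (\<Sum>i\<in>I. \<Sum>i'\<in>I. ?G \<zeta> i i' * (w i * cnj (w i')))"
        by simp
    qed
    also have "\<dots> = (\<Sum>i\<in>I. \<Sum>\<zeta>\<in>K. \<Sum>i'\<in>I. ?G \<zeta> i i' * (w i * cnj (w i')))" by (rule sum.swap)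
    also have "\<dots> = (\<Sum>i\<in>I. \<Sum>i'\<in>I. \<Sum>\<zeta>\<in>K. ?G \<zeta> i i' * (w i * cnj (w i')))"
      by (intro sum.cong refl sum.swap)
    also have "\<dots> = (\<Sum>i\<in>I. \<Sum>i'\<in>I. (of_nat N * (if i = i' then 1 else 0) * c i) * (w i * cnj (w i')))"
      by (simp only: orth sum_distrib_right[symmetric])
    also have "\<dots> = (\<Sum>i\<in>I. \<Sum>i'\<in>I. if i = i' then of_nat N * (w i * cnj (w i)) else 0)"
      by (intro sum.cong refl) (use c in auto)
    also have "\<dots> = (\<Sum>i\<in>I. of_nat N * (w i * cnj (w i)))" using I by simp
    also have "\<dots> = complex_of_real (N * (\<Sum>i\<in>I. (cmod (w i))\<^sup>2))"
      by (simp add: sum_distrib_left flip: complex_norm_square)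
    finally show "(\<Sum>\<zeta>\<in>K. \<Sum>j. (cmod (Y I \<zeta> j))\<^sup>2) = N * (\<Sum>i\<in>I. (cmod (w i))\<^sup>2)"
      unfolding of_real_eq_iff .
  qed
  have partial: "(\<Sum>\<zeta>\<in>K. \<Sum>j<J. (cmod (Y I \<zeta> j))\<^sup>2) \<le> N * (\<Sum>i\<in>I. (cmod (w i))\<^sup>2)" if "finite I" for I J
    unfolding fin(2)[OF that, symmetric] by (intro sum_mono sum_le_suminf fin(1)[OF that]) auto
  \<comment> \<open>A Fatou-type argument: for n \<ge> m the difference of partial sums is a
    combination of the rows from m to n - 1, whose energy the finite case bounds by N times the
    tail; then n tends to infinity with J fixed.\<close>
  have D: "(\<Sum>\<zeta>\<in>K. \<Sum>j<J. (cmod (y \<zeta> j - Y {..<m} \<zeta> j))\<^sup>2) \<le> N * tail m" for J m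
  proof (rule LIMSEQ_le_const2)
    show "(\<lambda>n. \<Sum>\<zeta>\<in>K. \<Sum>j<J. (cmod (Y {..<n} \<zeta> j - Y {..<m} \<zeta> j))\<^sup>2) \<longlonglongrightarrow>
      (\<Sum>\<zeta>\<in>K. \<Sum>j<J. (cmod (y \<zeta> j - Y {..<m} \<zeta> j))\<^sup>2)"
      unfolding Y_def using y[unfolded sums_def]
      by (intro tendsto_sum tendsto_power tendsto_norm tendsto_diff tendsto_const)
    show "\<exists>n0. \<forall>n\<ge>n0. (\<Sum>\<zeta>\<in>K. \<Sum>j<J. (cmod (Y {..<n} \<zeta> j - Y {..<m} \<zeta> j))\<^sup>2) \<le> N * tail m"
    proof (intro exI allI impI)
      fix n assume n: "m \<le> n"
      have "Y {..<n} \<zeta> j - Y {..<m} \<zeta> j = Y {m..<n} \<zeta> j" for \<zeta> j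
        unfolding Y_def lessThan_atLeast0 using n by (simp add: sum_diff_nat_ivl)
      then have "(\<Sum>\<zeta>\<in>K. \<Sum>j<J. (cmod (Y {..<n} \<zeta> j - Y {..<m} \<zeta> j))\<^sup>2) \<le> N * (\<Sum>i\<in>{m..<n}. (cmod (w i))\<^sup>2)"
        using partial by simp
      also have "(\<Sum>i\<in>{m..<n}. (cmod (w i))\<^sup>2) = (\<Sum>i<n. (cmod (w i))\<^sup>2) - (\<Sum>i<m. (cmod (w i))\<^sup>2)"
        unfolding lessThan_atLeast0 using n by (simp add: sum_diff_nat_ivl)
      also have "N * \<dots> \<le> N * tail m" using Wle by (intro mult_left_mono) (auto simp: tail_def)
      finally show "(\<Sum>\<zeta>\<in>K. \<Sum>j<J. (cmod (Y {..<n} \<zeta> j - Y {..<m} \<zeta> j))\<^sup>2) \<le> N * tail m" .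
    qed
  qed
  \<comment> \<open>With m = 0 the partial sum is empty and the tail is all of W. This gives the
    upper half of the identity.\<close>
  have bound: "(\<Sum>\<zeta>\<in>K. \<Sum>j<J. (cmod (y \<zeta> j))\<^sup>2) \<le> N * W" for J
    using D[where m = 0] by (simp add: Y_def tail_def)
  show summ: "summable (\<lambda>j. (cmod (y \<zeta> j))\<^sup>2)" if "\<zeta> \<in> K" for \<zeta>
  proof (rule summableI_nonneg_bounded)
    fix J
    have "(\<Sum>j<J. (cmod (y \<zeta> j))\<^sup>2) \<le> (\<Sum>\<zeta>\<in>K. \<Sum>j<J. (cmod (y \<zeta> j))\<^sup>2)"
      using that K by (intro member_le_sum sum_nonneg) auto
    then show "(\<Sum>j<J. (cmod (y \<zeta> j))\<^sup>2) \<le> N * W" using bound by (rule order_trans)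
  qed auto
  define V where "V = (\<Sum>\<zeta>\<in>K. \<Sum>j. (cmod (y \<zeta> j))\<^sup>2)"
  have upper: "V \<le> N * W"
    by (rule LIMSEQ_le_const2[where X = "\<lambda>J. \<Sum>\<zeta>\<in>K. \<Sum>j<J. (cmod (y \<zeta> j))\<^sup>2"])
      (use bound in \<open>auto simp: V_def intro!: tendsto_sum summable_LIMSEQ summ\<close>)
  \<comment> \<open>The lower half: the norm of the m-th partial sum is at most that of y plus that
    of the remainder. Afterwards J and then m tend to infinity.\<close>
  have "sqrt (\<Sum>\<zeta>\<in>K. \<Sum>j<J. (cmod (Y {..<m} \<zeta> j))\<^sup>2) \<le> sqrt V + sqrt (N * tail m)" for J m
  proof -
    let ?A = "K \<times> {..<J}"
    have L: "sqrt (\<Sum>\<zeta>\<in>K. \<Sum>j<J. (f \<zeta> j)\<^sup>2) = L2_set (\<lambda>(\<zeta>, j). f \<zeta> j) ?A" for f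
      by (simp add: L2_set_def sum.cartesian_product split_def)
    have "sqrt (\<Sum>\<zeta>\<in>K. \<Sum>j<J. (cmod (Y {..<m} \<zeta> j))\<^sup>2) \<le>
      L2_set (\<lambda>(\<zeta>, j). cmod (y \<zeta> j) + cmod (y \<zeta> j - Y {..<m} \<zeta> j)) ?A"
      unfolding L by (intro L2_set_mono) (auto simp: norm_minus_commute[of "y _ _"] intro: norm_triangle_sub)
    also have "\<dots> \<le> L2_set (\<lambda>(\<zeta>, j). cmod (y \<zeta> j)) ?A + L2_set (\<lambda>(\<zeta>, j). cmod (y \<zeta> j - Y {..<m} \<zeta> j)) ?A"
      using L2_set_triangle_ineq[of "\<lambda>(\<zeta>, j). cmod (y \<zeta> j)" "\<lambda>(\<zeta>, j). cmod (y \<zeta> j - Y {..<m} \<zeta> j)" ?A]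
      by (simp add: split_def)
    also have "\<dots> \<le> sqrt V + sqrt (N * tail m)"
      unfolding L[symmetric]
    proof (intro add_mono real_sqrt_le_mono D)
      show "(\<Sum>\<zeta>\<in>K. \<Sum>j<J. (cmod (y \<zeta> j))\<^sup>2) \<le> V"
        unfolding V_def by (intro sum_mono sum_le_suminf summ) auto
    qed
    finally show ?thesis .
  qed
  then have *: "sqrt (N * (\<Sum>i<m. (cmod (w i))\<^sup>2)) \<le> sqrt V + sqrt (N * tail m)" for m
    unfolding fin(2)[OF finite_lessThan, symmetric]
    by (intro LIMSEQ_le_const2[where X = "\<lambda>J. sqrt (\<Sum>\<zeta>\<in>K. \<Sum>j<J. (cmod (Y {..<m} \<zeta> j))\<^sup>2)"]
        tendsto_real_sqrt tendsto_sum summable_LIMSEQ fin(1)[OF finite_lessThan]) auto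
  have "sqrt (N * W) \<le> sqrt V + sqrt (N * (W - W))"
  proof (rule LIMSEQ_le)
    show "(\<lambda>m. sqrt (N * (\<Sum>i<m. (cmod (w i))\<^sup>2))) \<longlonglongrightarrow> sqrt (N * W)"
      by (intro tendsto_real_sqrt tendsto_mult tendsto_const Wlim)
    show "(\<lambda>m. sqrt V + sqrt (N * tail m)) \<longlonglongrightarrow> sqrt V + sqrt (N * (W - W))"
      unfolding tail_def by (intro tendsto_real_sqrt tendsto_add tendsto_diff tendsto_mult tendsto_const Wlim)
  qed (use * in blast)
  then show "(\<Sum>\<zeta>\<in>K. \<Sum>j. (cmod (y \<zeta> j))\<^sup>2) = real N * (\<Sum>i. (cmod (w i))\<^sup>2)"
    using upper by (simp add: V_def W_def)
qed

text \<open>Where the squares are not summable the value is unspecified; for an element of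
  \<open>l2_space\<close> this happens only on a null set, by \<open>l2_summable\<close>.\<close>

definition nsq :: "(nat \<Rightarrow> 'a \<Rightarrow> complex) \<Rightarrow> 'a \<Rightarrow> real" where
  "nsq f \<omega> = (\<Sum>i. (cmod (f i \<omega>))\<^sup>2)"

lemma
  assumes f: "f \<in> l2_space \<mu> m"
  shows l2_measurable: "f i \<in> borel_measurable \<mu>"
    and nsq_measurable: "nsq f \<in> borel_measurable \<mu>"
    and l2_summable: "AE \<omega> in \<mu>. summable (\<lambda>i. (cmod (f i \<omega>))\<^sup>2)"
    and nn_integral_nsq: "(\<integral>\<^sup>+\<omega>. ennreal (nsq f \<omega>) \<partial>\<mu>) = (\<Sum>i. \<integral>\<^sup>+\<omega>. ennreal ((cmod (f i \<omega>))\<^sup>2) \<partial>\<mu>)"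
    and nn_integral_nsq_finite: "(\<integral>\<^sup>+\<omega>. ennreal (nsq f \<omega>) \<partial>\<mu>) < \<infinity>"
    and nsq_nonneg: "AE \<omega> in \<mu>. nsq f \<omega> \<ge> 0"
proof -
  show m [measurable]: "f i \<in> borel_measurable \<mu>" for i using f by (simp add: l2_space_def)
  show "nsq f \<in> borel_measurable \<mu>" unfolding nsq_def[abs_def] by measurable
  have fin: "(\<Sum>i. \<integral>\<^sup>+\<omega>. ennreal ((cmod (f i \<omega>))\<^sup>2) \<partial>\<mu>) < \<infinity>" using f by (simp add: l2_space_def)
  also have "(\<Sum>i. \<integral>\<^sup>+\<omega>. ennreal ((cmod (f i \<omega>))\<^sup>2) \<partial>\<mu>) = (\<integral>\<^sup>+\<omega>. (\<Sum>i. ennreal ((cmod (f i \<omega>))\<^sup>2)) \<partial>\<mu>)"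
    by (rule nn_integral_suminf[symmetric]) measurable
  finally have "AE \<omega> in \<mu>. (\<Sum>i. ennreal ((cmod (f i \<omega>))\<^sup>2)) \<noteq> \<infinity>"
    by (intro nn_integral_PInf_AE) (auto simp: less_top)
  then show s: "AE \<omega> in \<mu>. summable (\<lambda>i. (cmod (f i \<omega>))\<^sup>2)"
    by eventually_elim (auto intro: summable_suminf_not_top)
  have "(\<integral>\<^sup>+\<omega>. ennreal (nsq f \<omega>) \<partial>\<mu>) = (\<integral>\<^sup>+\<omega>. (\<Sum>i. ennreal ((cmod (f i \<omega>))\<^sup>2)) \<partial>\<mu>)"
    using s by (intro nn_integral_cong_AE) (auto simp: nsq_def suminf_ennreal2 elim!: eventually_mono)
  also have "\<dots> = (\<Sum>i. \<integral>\<^sup>+\<omega>. ennreal ((cmod (f i \<omega>))\<^sup>2) \<partial>\<mu>)"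
    by (rule nn_integral_suminf) measurable
  finally show *: "(\<integral>\<^sup>+\<omega>. ennreal (nsq f \<omega>) \<partial>\<mu>) = (\<Sum>i. \<integral>\<^sup>+\<omega>. ennreal ((cmod (f i \<omega>))\<^sup>2) \<partial>\<mu>)" .
  show "(\<integral>\<^sup>+\<omega>. ennreal (nsq f \<omega>) \<partial>\<mu>) < \<infinity>" unfolding * by (rule fin)
  show "AE \<omega> in \<mu>. nsq f \<omega> \<ge> 0"
    using s by eventually_elim (auto simp: nsq_def intro: suminf_nonneg)
qed

lemma l2_norm_nsq:
  "f \<in> l2_space \<mu> m \<Longrightarrow> l2_norm \<mu> f = sqrt (enn2real (\<integral>\<^sup>+\<omega>. ennreal (nsq f \<omega>) \<partial>\<mu>))"
  by (simp add: l2_norm_def nn_integral_nsq)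

section \<open>Averaging over the fibres of \<beta>\<close>

context dual_endo
begin

text \<open>This is the transfer operator of \<beta>: the value of \<psi> at \<beta> \<omega> is the
  mean of \<phi> over the fibre through \<omega>. A relation avoids choosing preimages under \<beta>
  and ignores null sets.\<close>

definition transfer :: "(('g \<Rightarrow> complex) \<Rightarrow> real) \<Rightarrow> (('g \<Rightarrow> complex) \<Rightarrow> real) \<Rightarrow> bool" where
  "transfer \<phi> \<psi> \<longleftrightarrow> (AE \<omega> in \<mu>. (\<Sum>\<zeta>\<in>K. \<phi> (dual_mult \<omega> \<zeta>)) = real N * \<psi> (\<beta> \<omega>))"

text \<open>The absolute value of a mean is at most the mean of the absolute values; after
  integration the claim follows because \<beta> and the rotations by the kernel preserve
  \<mu>.\<close>

lemma transfer_contraction: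
  assumes "transfer \<phi> \<psi>" "transfer \<phi>' \<psi>'"
    and [measurable]: "\<phi> \<in> borel_measurable \<mu>" "\<psi> \<in> borel_measurable \<mu>"
      "\<phi>' \<in> borel_measurable \<mu>" "\<psi>' \<in> borel_measurable \<mu>"
  shows "(\<integral>\<^sup>+\<omega>. ennreal \<bar>\<psi> \<omega> - \<psi>' \<omega>\<bar> \<partial>\<mu>) \<le> (\<integral>\<^sup>+\<omega>. ennreal \<bar>\<phi> \<omega> - \<phi>' \<omega>\<bar> \<partial>\<mu>)"
proof -
  let ?u = "\<lambda>\<omega>. ennreal \<bar>\<psi> \<omega> - \<psi>' \<omega>\<bar>" and ?v = "\<lambda>\<omega>. ennreal \<bar>\<phi> \<omega> - \<phi>' \<omega>\<bar>"
  have v: "?v \<in> borel_measurable \<mu>" by measurable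
  have "of_nat N * (\<integral>\<^sup>+\<omega>. ?u \<omega> \<partial>\<mu>) = of_nat N * (\<integral>\<^sup>+\<omega>. ?u (\<beta> \<omega>) \<partial>\<mu>)"
    by (subst nn_integral_dual_hom) measurable
  also have "\<dots> = (\<integral>\<^sup>+\<omega>. of_nat N * ?u (\<beta> \<omega>) \<partial>\<mu>)"
    by (rule nn_integral_cmult[symmetric]) (use measurable_dual_hom in measurable)
  also have "\<dots> \<le> (\<integral>\<^sup>+\<omega>. (\<Sum>\<zeta>\<in>K. ?v (dual_mult \<omega> \<zeta>)) \<partial>\<mu>)"
  proof (rule nn_integral_mono_AE)
    show "AE \<omega> in \<mu>. of_nat N * ?u (\<beta> \<omega>) \<le> (\<Sum>\<zeta>\<in>K. ?v (dual_mult \<omega> \<zeta>))"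
      using assms(1,2) unfolding transfer_def
    proof eventually_elim
      case (elim \<omega>)
      have "real N * \<bar>\<psi> (\<beta> \<omega>) - \<psi>' (\<beta> \<omega>)\<bar> = \<bar>real N * \<psi> (\<beta> \<omega>) - real N * \<psi>' (\<beta> \<omega>)\<bar>"
        by (simp add: abs_mult flip: right_diff_distrib)
      also have "\<dots> \<le> (\<Sum>\<zeta>\<in>K. \<bar>\<phi> (dual_mult \<omega> \<zeta>) - \<phi>' (dual_mult \<omega> \<zeta>)\<bar>)"
        unfolding elim(1)[symmetric] elim(2)[symmetric] sum_subtractf[symmetric] by (rule sum_abs)
      finally have "ennreal (real N * \<bar>\<psi> (\<beta> \<omega>) - \<psi>' (\<beta> \<omega>)\<bar>) \<le> ennreal (\<Sum>\<zeta>\<in>K. \<bar>\<phi> (dual_mult \<omega> \<zeta>) - \<phi>' (dual_mult \<omega> \<zeta>)\<bar>)"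
        by (rule ennreal_leI)
      then show ?case by (simp add: ennreal_mult ennreal_of_nat_eq_real_of_nat sum_ennreal)
    qed
  qed
  also have "\<dots> = (\<Sum>\<zeta>\<in>K. \<integral>\<^sup>+\<omega>. ?v (dual_mult \<omega> \<zeta>) \<partial>\<mu>)"
    using measurable_rotation[OF kernel_dual] by (intro nn_integral_sum measurable_compose[OF _ v]) auto
  also have "\<dots> = (\<Sum>\<zeta>\<in>K. \<integral>\<^sup>+\<omega>. ?v \<omega> \<partial>\<mu>)"
    by (intro sum.cong refl nn_integral_rotation kernel_dual v)
  also have "\<dots> = of_nat N * (\<integral>\<^sup>+\<omega>. ?v \<omega> \<partial>\<mu>)" by (simp add: card_kernel)
  finally show ?thesis
    using index(2) by (simp add: ennreal_mult_le_mult_iff)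
qed

end

section \<open>The Ruelle operator of a filter\<close>

locale ruelle_op = dual_endo \<mu> \<alpha> N for \<mu> :: "('g::{ab_group_add,countable} \<Rightarrow> complex) measure" and \<alpha> N +
  fixes m :: "('g \<Rightarrow> complex) \<Rightarrow> enat" and h :: "nat \<Rightarrow> nat \<Rightarrow> ('g \<Rightarrow> complex) \<Rightarrow> complex"
  assumes filt: "is_filter \<mu> m \<alpha> N h" and bounded: "ruelle_bounded \<mu> m \<alpha> h"
begin

abbreviation "S \<equiv> ruelle \<alpha> h"

lemma ruelle_l2: "f \<in> l2_space \<mu> m \<Longrightarrow> S f \<in> l2_space \<mu> m"
  using bounded by (auto simp: ruelle_bounded_def)

lemma ruelle_sums:
  assumes "f \<in> l2_space \<mu> m"
  shows "AE \<omega> in \<mu>. \<forall>j. (\<lambda>i. h i j \<omega> * f i (\<beta> \<omega>)) sums S f j \<omega>"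
proof -
  have "AE \<omega> in \<mu>. \<forall>j. summable (\<lambda>i. h i j \<omega> * f i (\<beta> \<omega>))"
    using bounded assms by (auto simp: ruelle_bounded_def)
  then show ?thesis by eventually_elim (simp add: ruelle_def summable_sums)
qed

text \<open>All points of a fibre have the same image under \<beta>, so one vector f(\<beta>
  \<omega>) is fed into all N matrices, and \<open>orthogonal_rows_isometry\<close> applies at
  almost every \<omega>.\<close>

lemma transfer_ruelle:
  assumes f: "f \<in> l2_space \<mu> m"
  shows "transfer (nsq (S f)) (nsq f)"
proof -
  have filt': "AE \<omega> in \<mu>. \<forall>i i'.
        (\<forall>\<zeta>\<in>K. summable (\<lambda>j. h i j (dual_mult \<omega> \<zeta>) * cnj (h i' j (dual_mult \<omega> \<zeta>)))) \<and>
        (\<Sum>\<zeta>\<in>K. \<Sum>j. h i j (dual_mult \<omega> \<zeta>) * cnj (h i' j (dual_mult \<omega> \<zeta>))) =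
          of_nat N * (if i = i' then 1 else 0) * indicator (level_set m i) (\<beta> \<omega>)"
    using filt by (simp add: is_filter_def)
  show ?thesis
    unfolding transfer_def
    using filt' AE_kernel[OF ruelle_sums[OF f]] AE_dual_hom[OF l2_summable[OF f]] AE_space
  proof eventually_elim
    case (elim \<omega>)
    have "\<beta> \<omega> \<in> dual_group" using elim(4) dual_hom_in_dual by (simp add: space_mu)
    then have lev: "f i (\<beta> \<omega>) \<noteq> 0 \<Longrightarrow> (indicator (level_set m i) (\<beta> \<omega>) :: complex) = 1" for i
      using f by (auto simp: l2_space_def indicator_def)
    show ?case
      unfolding nsq_def
      by (rule orthogonal_rows_isometry(2)[where R = "\<lambda>\<zeta> i j. h i j (dual_mult \<omega> \<zeta>)"
            and c = "\<lambda>i. indicator (level_set m i) (\<beta> \<omega>)"])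
        (use elim lev finite_kernel dual_hom_kernel in auto)
  qed
qed

text \<open>The transfer identity is integrated: rotation invariance turns one side into N times the
  integral of \<open>nsq (S f)\<close>, invariance under \<beta> turns the other into N times that
  of \<open>nsq f\<close>.\<close>

lemma nn_integral_ruelle:
  assumes f: "f \<in> l2_space \<mu> m"
  shows "(\<integral>\<^sup>+\<omega>. ennreal (nsq (S f) \<omega>) \<partial>\<mu>) = (\<integral>\<^sup>+\<omega>. ennreal (nsq f \<omega>) \<partial>\<mu>)"
proof -
  let ?v = "\<lambda>\<omega>. ennreal (nsq (S f) \<omega>)" and ?u = "\<lambda>\<omega>. ennreal (nsq f \<omega>)"
  have [measurable]: "nsq f \<in> borel_measurable \<mu>" "nsq (S f) \<in> borel_measurable \<mu>"
    using nsq_measurable f ruelle_l2 by blast+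
  have v: "?v \<in> borel_measurable \<mu>" by measurable
  have "of_nat N * (\<integral>\<^sup>+\<omega>. ?v \<omega> \<partial>\<mu>) = (\<Sum>\<zeta>\<in>K. \<integral>\<^sup>+\<omega>. ?v \<omega> \<partial>\<mu>)" by (simp add: card_kernel)
  also have "\<dots> = (\<Sum>\<zeta>\<in>K. \<integral>\<^sup>+\<omega>. ?v (dual_mult \<omega> \<zeta>) \<partial>\<mu>)"
    by (intro sum.cong refl nn_integral_rotation[symmetric] kernel_dual v)
  also have "\<dots> = (\<integral>\<^sup>+\<omega>. (\<Sum>\<zeta>\<in>K. ?v (dual_mult \<omega> \<zeta>)) \<partial>\<mu>)"
    using measurable_rotation[OF kernel_dual] by (intro nn_integral_sum[symmetric] measurable_compose[OF _ v]) auto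
  also have "\<dots> = (\<integral>\<^sup>+\<omega>. of_nat N * ?u (\<beta> \<omega>) \<partial>\<mu>)"
  proof (rule nn_integral_cong_AE)
    show "AE \<omega> in \<mu>. (\<Sum>\<zeta>\<in>K. ?v (dual_mult \<omega> \<zeta>)) = of_nat N * ?u (\<beta> \<omega>)"
      using transfer_ruelle[OF f] AE_kernel[OF nsq_nonneg[OF ruelle_l2[OF f]]] AE_dual_hom[OF nsq_nonneg[OF f]]
      unfolding transfer_def
    proof eventually_elim
      case (elim \<omega>)
      have "(\<Sum>\<zeta>\<in>K. ?v (dual_mult \<omega> \<zeta>)) = ennreal (\<Sum>\<zeta>\<in>K. nsq (S f) (dual_mult \<omega> \<zeta>))"
        using elim(2) by (intro sum_ennreal) auto
      then show ?case using elim by (simp add: ennreal_mult ennreal_of_nat_eq_real_of_nat)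
    qed
  qed
  also have "\<dots> = of_nat N * (\<integral>\<^sup>+\<omega>. ?u (\<beta> \<omega>) \<partial>\<mu>)"
    by (rule nn_integral_cmult) (use measurable_dual_hom in measurable)
  also have "\<dots> = of_nat N * (\<integral>\<^sup>+\<omega>. ?u \<omega> \<partial>\<mu>)"
    by (subst nn_integral_dual_hom) measurable
  finally show ?thesis
    using index(2) by (simp add: ennreal_mult_cancel_left)
qed

lemma ruelle_norm: "f \<in> l2_space \<mu> m \<Longrightarrow> l2_norm \<mu> (S f) = l2_norm \<mu> f"
  using l2_norm_nsq ruelle_l2 nn_integral_ruelle by metis

lemma ruelle_linear:
  assumes "f \<in> l2_space \<mu> m" "g \<in> l2_space \<mu> m"
  shows "l2_eq \<mu> (S (\<lambda>i \<omega>. a * f i \<omega> + b * g i \<omega>)) (\<lambda>i \<omega>. a * S f i \<omega> + b * S g i \<omega>)"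
  unfolding l2_eq_def
proof
  fix j
  show "AE \<omega> in \<mu>. S (\<lambda>i \<omega>. a * f i \<omega> + b * g i \<omega>) j \<omega> = a * S f j \<omega> + b * S g j \<omega>"
    using ruelle_sums[OF assms(1)] ruelle_sums[OF assms(2)]
  proof eventually_elim
    case (elim \<omega>)
    have "(\<lambda>i. a * (h i j \<omega> * f i (\<beta> \<omega>)) + b * (h i j \<omega> * g i (\<beta> \<omega>))) sums (a * S f j \<omega> + b * S g j \<omega>)"
      using elim by (intro sums_add sums_mult) auto
    then show ?case unfolding ruelle_def by (auto simp: algebra_simps dest: sums_unique)
  qed
qed

lemma ruelle_isometry: "l2_isometry \<mu> m S"
  using ruelle_l2 ruelle_norm ruelle_linear by (simp add: l2_isometry_def)

end

section \<open>Trigonometric polynomials and mixing\<close>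

text \<open>Functions are prescribed only on \<open>dual_group\<close>, because products and
  conjugates of monomials are monomials for characters only; elsewhere the values are
  arbitrary.\<close>

inductive_set trig_poly :: "(('g::ab_group_add \<Rightarrow> complex) \<Rightarrow> complex) set" where
  monomial: "(\<And>\<omega>. \<omega> \<in> dual_group \<Longrightarrow> f \<omega> = c * \<omega> \<gamma>) \<Longrightarrow> f \<in> trig_poly"
| add: "f \<in> trig_poly \<Longrightarrow> g \<in> trig_poly \<Longrightarrow> (\<And>\<omega>. \<omega> \<in> dual_group \<Longrightarrow> k \<omega> = f \<omega> + g \<omega>) \<Longrightarrow> k \<in> trig_poly"

lemma trig_poly_const: "(\<lambda>_. c) \<in> trig_poly"
  by (rule trig_poly.monomial[where \<gamma> = 0 and c = c]) (simp add: dual_group_zero)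

lemma trig_poly_mult_monomial:
  assumes "g \<in> trig_poly" "\<And>\<omega>. \<omega> \<in> dual_group \<Longrightarrow> k \<omega> = c * \<omega> \<gamma> * g \<omega>"
  shows "k \<in> trig_poly"
  using assms
proof (induction arbitrary: k)
  case (monomial f d \<delta>)
  then show ?case
    by (intro trig_poly.monomial[where c = "c * d" and \<gamma> = "\<gamma> + \<delta>"]) (simp add: dual_group_def)
next
  case (add f g k')
  show ?case
  proof (rule trig_poly.add)
    show "(\<lambda>\<omega>. c * \<omega> \<gamma> * f \<omega>) \<in> trig_poly" "(\<lambda>\<omega>. c * \<omega> \<gamma> * g \<omega>) \<in> trig_poly"
      using add.IH by auto
  qed (simp add: add.hyps add.prems algebra_simps)
qed

lemma trig_poly_mult:
  assumes "f \<in> trig_poly" "g \<in> trig_poly" "\<And>\<omega>. \<omega> \<in> dual_group \<Longrightarrow> k \<omega> = f \<omega> * g \<omega>"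
  shows "k \<in> trig_poly"
  using assms(1,3)
proof (induction arbitrary: k)
  case (monomial f c \<gamma>)
  then show ?case using trig_poly_mult_monomial[OF assms(2), of k c \<gamma>] by simp
next
  case (add f f' k')
  show ?case
  proof (rule trig_poly.add)
    show "(\<lambda>\<omega>. f \<omega> * g \<omega>) \<in> trig_poly" "(\<lambda>\<omega>. f' \<omega> * g \<omega>) \<in> trig_poly"
      using add.IH by auto
  qed (simp add: add.hyps add.prems algebra_simps)
qed

lemma trig_poly_continuous:
  "f \<in> trig_poly \<Longrightarrow> continuous_on dual_group (f :: ('g::{ab_group_add,countable} \<Rightarrow> complex) \<Rightarrow> complex)"
proof (induction rule: trig_poly.induct)
  case (monomial f c \<gamma>)
  have "continuous_on dual_group (\<lambda>\<omega>::'g \<Rightarrow> complex. c * \<omega> \<gamma>)"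
    by (intro continuous_on_mult continuous_on_const continuous_on_subset[OF continuous_on_product_coordinates subset_UNIV])
  then show ?case using monomial by (simp cong: continuous_on_cong)
next
  case (add f g k)
  then have "continuous_on dual_group (\<lambda>\<omega>. f \<omega> + g \<omega>)" by (intro continuous_on_add)
  then show ?case using add by (simp cong: continuous_on_cong)
qed

text \<open>On the dual the conjugate of \<omega> \<gamma> is \<omega> (- \<gamma>), so real parts
  of monomials stay trigonometric polynomials. They supply the separating functions for the real
  Stone-Weierstrass theorem.\<close>

lemma trig_poly_Re_coordinate: "(\<lambda>\<omega>. complex_of_real (Re (c * \<omega> \<gamma>))) \<in> trig_poly"
proof (rule trig_poly.add)
  show "(\<lambda>\<omega>. c / 2 * \<omega> \<gamma>) \<in> trig_poly" "(\<lambda>\<omega>. cnj c / 2 * \<omega> (- \<gamma>)) \<in> trig_poly"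
    by (rule trig_poly.monomial, rule refl)+
  show "complex_of_real (Re (c * \<omega> \<gamma>)) = c / 2 * \<omega> \<gamma> + cnj c / 2 * \<omega> (- \<gamma>)" if "\<omega> \<in> dual_group" for \<omega>
    using dual_group_uminus[OF that] complex_add_cnj[of "c * \<omega> \<gamma>"] by (simp add: field_simps)
qed

lemma trig_poly_dense_uniform:
  fixes g :: "('g::{ab_group_add,countable} \<Rightarrow> complex) \<Rightarrow> real"
  assumes "continuous_on dual_group g" "e > 0"
  obtains f where "f \<in> trig_poly" "\<And>\<omega>. \<omega> \<in> dual_group \<Longrightarrow> \<bar>g \<omega> - Re (f \<omega>)\<bar> < e"
proof -
  define R :: "(('g \<Rightarrow> complex) \<Rightarrow> real) set" where "R = {g. (\<lambda>\<omega>. complex_of_real (g \<omega>)) \<in> trig_poly}"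
  interpret function_ring_on R dual_group
  proof
    show "compact (dual_group :: ('g \<Rightarrow> complex) set)" by (rule compact_dual_group)
    show "continuous_on dual_group f" if "f \<in> R" for f
    proof -
      have "continuous_on dual_group (\<lambda>\<omega>. complex_of_real (f \<omega>))"
        using that by (intro trig_poly_continuous) (simp add: R_def)
      from continuous_on_Re[OF this] show ?thesis by simp
    qed
    show "(\<lambda>x. f x + g x) \<in> R" if "f \<in> R" "g \<in> R" for f g
      using that trig_poly.add[of _ _ "\<lambda>\<omega>. complex_of_real (f \<omega> + g \<omega>)"] unfolding R_def by auto
    show "(\<lambda>x. f x * g x) \<in> R" if "f \<in> R" "g \<in> R" for f g
      using that trig_poly_mult[of _ _ "\<lambda>\<omega>. complex_of_real (f \<omega> * g \<omega>)"] unfolding R_def by auto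
    show "(\<lambda>_. c) \<in> R" for c using trig_poly_const by (simp add: R_def)
    show "\<exists>f\<in>R. f x \<noteq> f y" if xy: "x \<noteq> y" for x y :: "'g \<Rightarrow> complex"
    proof -
      obtain \<gamma> where "x \<gamma> \<noteq> y \<gamma>" using xy by auto
      \<comment> \<open>Distinct complex numbers differ in the real or the imaginary part; the
        factor - \<i> turns the imaginary part into a real part.\<close>
      then have "Re (1 * x \<gamma>) \<noteq> Re (1 * y \<gamma>) \<or> Re (- \<i> * x \<gamma>) \<noteq> Re (- \<i> * y \<gamma>)"
        by (simp add: complex_eq_iff)
      then obtain c where "Re (c * x \<gamma>) \<noteq> Re (c * y \<gamma>)" by blast
      moreover have "(\<lambda>\<omega>. Re (c * \<omega> \<gamma>)) \<in> R"
        using trig_poly_Re_coordinate by (simp add: R_def)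
      ultimately show ?thesis by (intro bexI[of _ "\<lambda>\<omega>. Re (c * \<omega> \<gamma>)"])
    qed
  qed
  obtain p where p: "p \<in> R" "\<forall>\<omega>\<in>dual_group. \<bar>g \<omega> - p \<omega>\<bar> < e"
    using Stone_Weierstrass_basic[OF assms] by blast
  show ?thesis
    using that[of "\<lambda>\<omega>. complex_of_real (p \<omega>)"] p by (simp add: R_def)
qed

section \<open>Density of trigonometric polynomials in L^1\<close>

context haar_dual
begin

definition approximable :: "(('g \<Rightarrow> complex) \<Rightarrow> real) \<Rightarrow> bool" where
  "approximable \<phi> \<longleftrightarrow> (\<forall>e>0. \<exists>g. continuous_on dual_group g \<and> (\<integral>\<^sup>+\<omega>. ennreal \<bar>\<phi> \<omega> - g \<omega>\<bar> \<partial>\<mu>) < ennreal e)"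

lemma L1_triangle:
  assumes [measurable]: "a \<in> borel_measurable \<mu>" "b \<in> borel_measurable \<mu>" "c \<in> borel_measurable \<mu>"
    and "(\<integral>\<^sup>+\<omega>. ennreal \<bar>a \<omega> - b \<omega>\<bar> \<partial>\<mu>) < ennreal d" "(\<integral>\<^sup>+\<omega>. ennreal \<bar>b \<omega> - c \<omega>\<bar> \<partial>\<mu>) < ennreal e"
    and "d > 0" "e > 0"
  shows "(\<integral>\<^sup>+\<omega>. ennreal \<bar>a \<omega> - c \<omega>\<bar> \<partial>\<mu>) < ennreal (d + e)"
proof -
  have "(\<integral>\<^sup>+\<omega>. ennreal \<bar>a \<omega> - c \<omega>\<bar> \<partial>\<mu>) \<le> (\<integral>\<^sup>+\<omega>. ennreal \<bar>a \<omega> - b \<omega>\<bar> + ennreal \<bar>b \<omega> - c \<omega>\<bar> \<partial>\<mu>)"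
    by (intro nn_integral_mono) (auto simp flip: ennreal_plus intro: ennreal_leI)
  also have "\<dots> = (\<integral>\<^sup>+\<omega>. ennreal \<bar>a \<omega> - b \<omega>\<bar> \<partial>\<mu>) + (\<integral>\<^sup>+\<omega>. ennreal \<bar>b \<omega> - c \<omega>\<bar> \<partial>\<mu>)"
    by (rule nn_integral_add) measurable
  also have "\<dots> < ennreal d + ennreal e" by (rule add_strict_mono) fact+
  finally show ?thesis using assms(6,7) by simp
qed

lemma approximable_limit:
  assumes [measurable]: "\<phi> \<in> borel_measurable \<mu>" and s: "\<And>i::nat. s i \<in> borel_measurable \<mu>" "\<And>i. approximable (s i)"
    and lim: "(\<lambda>i. \<integral>\<^sup>+\<omega>. ennreal (norm (\<phi> \<omega> - s i \<omega>)) \<partial>\<mu>) \<longlonglongrightarrow> 0"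
  shows "approximable \<phi>"
  unfolding approximable_def
proof (intro allI impI)
  fix e :: real assume e: "e > 0"
  have "eventually (\<lambda>i. (\<integral>\<^sup>+\<omega>. ennreal (norm (\<phi> \<omega> - s i \<omega>)) \<partial>\<mu>) < ennreal (e / 2)) sequentially"
    using e by (intro order_tendstoD(2)[OF lim]) simp
  then obtain i where i: "(\<integral>\<^sup>+\<omega>. ennreal \<bar>\<phi> \<omega> - s i \<omega>\<bar> \<partial>\<mu>) < ennreal (e / 2)"
    by (auto simp: eventually_sequentially)
  obtain g where g: "continuous_on dual_group g" "(\<integral>\<^sup>+\<omega>. ennreal \<bar>s i \<omega> - g \<omega>\<bar> \<partial>\<mu>) < ennreal (e / 2)"
    using s(2)[of i] e unfolding approximable_def by (meson half_gt_zero)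
  have "(\<integral>\<^sup>+\<omega>. ennreal \<bar>\<phi> \<omega> - g \<omega>\<bar> \<partial>\<mu>) < ennreal (e / 2 + e / 2)"
    using i g e s(1) by (intro L1_triangle[of \<phi> "s i" g]) (auto intro: continuous_measurable_mu)
  then show "\<exists>g. continuous_on dual_group g \<and> (\<integral>\<^sup>+\<omega>. ennreal \<bar>\<phi> \<omega> - g \<omega>\<bar> \<partial>\<mu>) < ennreal e"
    using g(1) by auto
qed

lemma borel_of_sets: "A \<in> sets \<mu> \<Longrightarrow> A \<in> sets borel"
  using sets_mu sets_restrict_space_iff[of "dual_group :: ('g \<Rightarrow> complex) set" borel A] dual_group_borel by auto

lemma sets_of_borel: "A \<in> sets borel \<Longrightarrow> A \<subseteq> dual_group \<Longrightarrow> A \<in> sets \<mu>"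
  using sets_mu sets_restrict_space_iff[of "dual_group :: ('g \<Rightarrow> complex) set" borel A] dual_group_borel by auto

text \<open>The functions \<open>s n\<close> are Urysohn functions of ever thinner neighbourhoods of
  C. They converge pointwise to the indicator since C is closed, and they are bounded by 1, so
  dominated convergence applies.\<close>

lemma approximable_compact:
  assumes "compact C" "C \<subseteq> dual_group"
  shows "approximable (indicator C)"
\<comment> \<open>\<open>infdist\<close> to the empty set is 0 by convention, which would make every
  \<open>s n\<close> constantly 1.\<close>
proof (cases "C = {}")
  case True
  then show ?thesis unfolding approximable_def by (intro allI impI exI[of _ "\<lambda>_. 0"]) auto
next
  case False
  define s where "s n \<omega> = max 0 (1 - real n * infdist \<omega> C)" for n \<omega>
  have cont: "continuous_on dual_group (s n)" for n
    unfolding s_def by (intro continuous_intros)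
  have C: "C \<in> sets \<mu>" using assms by (intro sets_of_borel borel_closed compact_imp_closed)
  show ?thesis
  proof (rule approximable_limit)
    show "(indicator C :: _ \<Rightarrow> real) \<in> borel_measurable \<mu>" using C by measurable
    show m: "s i \<in> borel_measurable \<mu>" for i by (rule continuous_measurable_mu[OF cont])
    show "approximable (s i)" for i
      unfolding approximable_def using cont by (intro allI impI exI[of _ "s i"]) auto
    show "(\<lambda>i. \<integral>\<^sup>+\<omega>. ennreal (norm (indicator C \<omega> - s i \<omega>)) \<partial>\<mu>) \<longlonglongrightarrow> 0"
    proof (rule nn_integral_dominated_convergence_norm[where w = "\<lambda>_. 1"])
      show "AE \<omega> in \<mu>. norm (s j \<omega>) \<le> 1" for j
        by (auto simp: s_def infdist_nonneg)
      show "AE \<omega> in \<mu>. (\<lambda>i. s i \<omega>) \<longlonglongrightarrow> indicator C \<omega>"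
      proof (rule AE_I2)
        fix \<omega>
        show "(\<lambda>i. s i \<omega>) \<longlonglongrightarrow> indicator C \<omega>"
        proof (cases "\<omega> \<in> C")
          case False
          then have pos: "infdist \<omega> C > 0"
            using assms(1) \<open>C \<noteq> {}\<close> by (intro infdist_pos_not_in_closed compact_imp_closed)
          obtain n0 :: nat where n0: "1 / infdist \<omega> C < n0" using reals_Archimedean2 by blast
          have "s n \<omega> = 0" if "n \<ge> n0" for n
          proof -
            have "1 / infdist \<omega> C \<le> n" using n0 that by linarith
            then show ?thesis using pos by (simp add: s_def field_simps)
          qed
          then have "eventually (\<lambda>n. s n \<omega> = 0) sequentially" by (auto simp: eventually_sequentially)
          then show ?thesis using False by (simp add: tendsto_eventually)
        qed (simp add: s_def)
      qed
    qed (use m C in \<open>auto simp: emeasure_space_1\<close>)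
  qed
qed

text \<open>Inner regularity gives compact subsets of A of nearly full measure, and the L^1 error is
  the measure of what they leave out.\<close>

lemma approximable_indicator:
  assumes A: "A \<in> sets \<mu>" shows "approximable (indicator A)"
proof -
  have "\<exists>C. compact C \<and> C \<subseteq> A \<and> emeasure \<mu> A < emeasure \<mu> C + ennreal e" if "e > 0" for e
  proof -
    have id: "(\<lambda>\<omega>. \<omega>) \<in> borel_measurable \<mu>" by (intro continuous_measurable_mu continuous_on_id)
    \<comment> \<open>Inner regularity is about Borel measures on a whole Polish space, so \<mu> is
      pushed forward from the dual to the space of all functions.\<close>
    let ?M = "distr \<mu> borel (\<lambda>\<omega>. \<omega>)"
    have em: "emeasure ?M B = emeasure \<mu> B" if "B \<in> sets borel" "B \<subseteq> dual_group" for B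
      using emeasure_distr[OF id that(1)] that(2) by (simp add: space_mu Int_absorb2)
    have sub: "A \<subseteq> dual_group" using sets.sets_into_space[OF A] by (simp add: space_mu)
    have sup: "emeasure ?M A = (SUP C\<in>{C. C \<subseteq> A \<and> compact C}. emeasure ?M C)"
      using emeasure_distr[OF id, of UNIV] emeasure_space_1
      by (intro inner_regular borel_of_sets A) auto
    have "{C. C \<subseteq> A \<and> compact C} \<noteq> {}" by (auto intro: exI[of _ "{}"])
    moreover have "emeasure ?M A \<noteq> \<infinity>" using em[OF borel_of_sets[OF A] sub] by simp
    ultimately have "\<exists>C\<in>{C. C \<subseteq> A \<and> compact C}. emeasure ?M A < emeasure ?M C + ennreal e"
      by (rule SUP_approx_ennreal[OF that _ sup])
    then obtain C where "C \<subseteq> A" "compact C" "emeasure \<mu> A < emeasure ?M C + ennreal e"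
      unfolding em[OF borel_of_sets[OF A] sub] by blast
    moreover from this have "emeasure ?M C = emeasure \<mu> C"
      using sub by (intro em borel_closed compact_imp_closed) auto
    ultimately show ?thesis by auto
  qed
  then have "\<forall>n. \<exists>C. compact C \<and> C \<subseteq> A \<and> emeasure \<mu> A < emeasure \<mu> C + ennreal (1 / Suc n)" by simp
  then obtain C where C: "\<And>n. compact (C n)" "\<And>n. C n \<subseteq> A"
    "\<And>n. emeasure \<mu> A < emeasure \<mu> (C n) + ennreal (1 / Suc n)" by metis
  have sub: "A \<subseteq> dual_group" using sets.sets_into_space[OF A] by (simp add: space_mu)
  have Cs: "C n \<in> sets \<mu>" for n
    using C(1,2) sub by (intro sets_of_borel borel_closed compact_imp_closed) auto
  show ?thesis
  proof (rule approximable_limit)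
    show "(indicator A :: _ \<Rightarrow> real) \<in> borel_measurable \<mu>" using A by measurable
    show "(indicator (C n) :: _ \<Rightarrow> real) \<in> borel_measurable \<mu>" for n using Cs by measurable
    show "approximable (indicator (C n))" for n
      using C(1,2) sub by (intro approximable_compact) auto
    show "(\<lambda>n. \<integral>\<^sup>+\<omega>. ennreal (norm (indicator A \<omega> - indicator (C n) \<omega> :: real)) \<partial>\<mu>) \<longlonglongrightarrow> 0"
    proof (rule tendsto_sandwich[OF _ _ tendsto_const])
      have "(\<lambda>n. ennreal (1 / Suc n)) \<longlonglongrightarrow> ennreal 0"
        by (intro tendsto_ennrealI LIMSEQ_Suc[OF lim_1_over_n])
      then show "(\<lambda>n. ennreal (1 / Suc n)) \<longlonglongrightarrow> 0" by simp
      have "(\<integral>\<^sup>+\<omega>. ennreal (norm (indicator A \<omega> - indicator (C n) \<omega> :: real)) \<partial>\<mu>) \<le> ennreal (1 / Suc n)" for n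
      proof -
        have "(\<integral>\<^sup>+\<omega>. ennreal (norm (indicator A \<omega> - indicator (C n) \<omega> :: real)) \<partial>\<mu>) = (\<integral>\<^sup>+\<omega>. indicator (A - C n) \<omega> \<partial>\<mu>)"
          using C(2)[of n] by (intro nn_integral_cong) (auto simp: indicator_def)
        also have "\<dots> = emeasure \<mu> (A - C n)" using A Cs by simp
        also have "\<dots> = emeasure \<mu> A - emeasure \<mu> (C n)"
          using A Cs C(2) by (intro emeasure_Diff) auto
        also have "\<dots> \<le> ennreal (1 / Suc n)"
          using C(3)[of n] by (subst ennreal_minus_le_iff) (auto intro: less_imp_le)
        finally show ?thesis .
      qed
      then show "eventually (\<lambda>n. (\<integral>\<^sup>+\<omega>. ennreal (norm (indicator A \<omega> - indicator (C n) \<omega> :: real)) \<partial>\<mu>) \<le> ennreal (1 / Suc n)) sequentially"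
        by simp
    qed simp
  qed
qed

lemma approximable_integrable:
  assumes "integrable \<mu> \<phi>" shows "approximable \<phi>"
  using assms
proof (induction rule: integrable_induct)
  case (base A c)
  show ?case unfolding approximable_def
  proof (intro allI impI)
    fix e :: real assume e: "e > 0"
    \<comment> \<open>The summand 1 covers c = 0 and makes the final inequality strict.\<close>
    then have "e / (\<bar>c\<bar> + 1) > 0" by simp
    with approximable_indicator[OF base(1)] obtain g where
      g: "continuous_on dual_group g" "(\<integral>\<^sup>+\<omega>. ennreal \<bar>indicator A \<omega> - g \<omega>\<bar> \<partial>\<mu>) < ennreal (e / (\<bar>c\<bar> + 1))"
      unfolding approximable_def by blast
    have [measurable]: "g \<in> borel_measurable \<mu>" "A \<in> sets \<mu>"
      using g base continuous_measurable_mu by auto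
    have "(\<integral>\<^sup>+\<omega>. ennreal \<bar>indicator A \<omega> *\<^sub>R c - g \<omega> * c\<bar> \<partial>\<mu>) = (\<integral>\<^sup>+\<omega>. ennreal \<bar>c\<bar> * ennreal \<bar>indicator A \<omega> - g \<omega>\<bar> \<partial>\<mu>)"
      by (intro nn_integral_cong) (simp add: ennreal_mult[symmetric] abs_mult[symmetric] algebra_simps)
    also have "\<dots> = ennreal \<bar>c\<bar> * (\<integral>\<^sup>+\<omega>. ennreal \<bar>indicator A \<omega> - g \<omega>\<bar> \<partial>\<mu>)"
      by (rule nn_integral_cmult) measurable
    also have "\<dots> \<le> ennreal \<bar>c\<bar> * ennreal (e / (\<bar>c\<bar> + 1))" using g by (intro mult_left_mono) auto
    also have "\<dots> = ennreal (\<bar>c\<bar> * (e / (\<bar>c\<bar> + 1)))" 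
      using e by (subst ennreal_mult) auto
    also have "\<dots> < ennreal e" using e by (intro ennreal_lessI) (auto simp: field_simps add_pos_nonneg)
    finally show "\<exists>g. continuous_on dual_group g \<and> (\<integral>\<^sup>+\<omega>. ennreal \<bar>indicator A \<omega> *\<^sub>R c - g \<omega>\<bar> \<partial>\<mu>) < ennreal e"
      using g(1) by (intro exI[of _ "\<lambda>\<omega>. g \<omega> * c"]) (auto intro: continuous_intros)
  qed
next
  case (add f g)
  show ?case unfolding approximable_def
  proof (intro allI impI)
    fix e :: real assume e: "e > 0"
    obtain f' where f': "continuous_on dual_group f'" "(\<integral>\<^sup>+\<omega>. ennreal \<bar>f \<omega> - f' \<omega>\<bar> \<partial>\<mu>) < ennreal (e / 2)"
      using add(3) e unfolding approximable_def by (meson half_gt_zero)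
    obtain g' where g': "continuous_on dual_group g'" "(\<integral>\<^sup>+\<omega>. ennreal \<bar>g \<omega> - g' \<omega>\<bar> \<partial>\<mu>) < ennreal (e / 2)"
      using add(4) e unfolding approximable_def by (meson half_gt_zero)
    have [measurable]: "f \<in> borel_measurable \<mu>" "g \<in> borel_measurable \<mu>"
      "f' \<in> borel_measurable \<mu>" "g' \<in> borel_measurable \<mu>"
      using add f' g' continuous_measurable_mu by auto
    have "(\<integral>\<^sup>+\<omega>. ennreal \<bar>f \<omega> + g \<omega> - (f' \<omega> + g' \<omega>)\<bar> \<partial>\<mu>) < ennreal (e / 2 + e / 2)"
      using f' g' e by (intro L1_triangle[where b = "\<lambda>\<omega>. f' \<omega> + g \<omega>"]) auto
    then show "\<exists>k. continuous_on dual_group k \<and> (\<integral>\<^sup>+\<omega>. ennreal \<bar>f \<omega> + g \<omega> - k \<omega>\<bar> \<partial>\<mu>) < ennreal e"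
      using f' g' by (intro exI[of _ "\<lambda>\<omega>. f' \<omega> + g' \<omega>"]) (auto intro: continuous_intros)
  qed
next
  case (lim f s)
  show ?case
  proof (rule approximable_limit)
    show "f \<in> borel_measurable \<mu>" "s i \<in> borel_measurable \<mu>" "approximable (s i)" for i
      using lim by auto
    show "(\<lambda>i. \<integral>\<^sup>+\<omega>. ennreal (norm (f \<omega> - s i \<omega>)) \<partial>\<mu>) \<longlonglongrightarrow> 0"
    proof (rule nn_integral_dominated_convergence_norm[where w = "\<lambda>\<omega>. 2 * norm (f \<omega>)"])
      have "integrable \<mu> (\<lambda>\<omega>. 2 * norm (f \<omega>))" by (intro integrable_mult_right integrable_norm lim)
      then show "(\<integral>\<^sup>+\<omega>. ennreal (2 * norm (f \<omega>)) \<partial>\<mu>) < \<infinity>" unfolding integrable_iff_bounded by simp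
    qed (use lim in auto)
  qed
qed

lemma trig_poly_dense_L1:
  assumes "integrable \<mu> \<phi>" "e > 0"
  obtains f where "f \<in> trig_poly" "(\<integral>\<^sup>+\<omega>. ennreal \<bar>\<phi> \<omega> - Re (f \<omega>)\<bar> \<partial>\<mu>) < ennreal e"
proof -
  obtain g where g: "continuous_on dual_group g" "(\<integral>\<^sup>+\<omega>. ennreal \<bar>\<phi> \<omega> - g \<omega>\<bar> \<partial>\<mu>) < ennreal (e / 2)"
    using approximable_integrable[OF assms(1)] assms(2) unfolding approximable_def by (meson half_gt_zero)
  \<comment> \<open>A quarter rather than a half: integrating the pointwise bound yields only a weak
    inequality, and \<open>L1_triangle\<close> asks for strict ones.\<close>
  obtain f where f: "f \<in> trig_poly" "\<And>\<omega>. \<omega> \<in> dual_group \<Longrightarrow> \<bar>g \<omega> - Re (f \<omega>)\<bar> < e / 4"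
    using trig_poly_dense_uniform[OF g(1), of "e / 4"] assms(2) by auto
  have m: "(\<lambda>\<omega>. Re (f \<omega>)) \<in> borel_measurable \<mu>"
    using trig_poly_continuous[OF f(1)] by (intro continuous_measurable_mu continuous_intros)
  have "(\<integral>\<^sup>+\<omega>. ennreal \<bar>g \<omega> - Re (f \<omega>)\<bar> \<partial>\<mu>) \<le> (\<integral>\<^sup>+\<omega>. ennreal (e / 4) \<partial>\<mu>)"
    using f(2) by (intro nn_integral_mono ennreal_leI less_imp_le) (simp add: space_mu)
  also have "\<dots> = ennreal (e / 4)" by (simp add: emeasure_space_1)
  also have "\<dots> < ennreal (e / 2)" using assms(2) by (intro ennreal_lessI) auto
  finally have "(\<integral>\<^sup>+\<omega>. ennreal \<bar>\<phi> \<omega> - Re (f \<omega>)\<bar> \<partial>\<mu>) < ennreal (e / 2 + e / 2)"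
    using g assms m by (intro L1_triangle[of \<phi> g]) (auto intro: continuous_measurable_mu)
  then show ?thesis using that f(1) by auto
qed

end

section \<open>Mixing by repeated averaging\<close>

context dual_endo
begin

text \<open>By \<open>sum_kernel\<close> one averaging replaces the exponent \<gamma> by its
  preimage under \<alpha>, and gives 0 if there is none. As the ranges of the powers of \<alpha>
  meet only in 0, every nonzero exponent dies after finitely many steps, while the exponent 0 is a
  constant and persists.\<close>

lemma trig_poly_transfer:
  assumes "f \<in> trig_poly"
  shows "\<exists>Q n c. (\<forall>\<omega>\<in>dual_group. Q 0 \<omega> = f \<omega>) \<and> (\<forall>i. Q i \<in> trig_poly) \<and>
    (\<forall>i. \<forall>\<omega>\<in>dual_group. (\<Sum>\<zeta>\<in>K. Q i (dual_mult \<omega> \<zeta>)) = of_nat N * Q (Suc i) (\<beta> \<omega>)) \<and>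
    (\<forall>i\<ge>n. \<forall>\<omega>\<in>dual_group. Q i \<omega> = c)"
  using assms
proof (induction rule: trig_poly.induct)
  case (monomial f c \<gamma>)
  \<comment> \<open>The exponent after i steps, meaningful as long as \<gamma> lies in the range of
    \<open>\<alpha> ^^ i\<close>.\<close>
  define r where "r i = inv_into UNIV (\<alpha> ^^ i) \<gamma>" for i
  define Q where "Q i \<omega> = (if \<gamma> \<in> range (\<alpha> ^^ i) then c * \<omega> (r i) else 0)" for i and \<omega> :: "'g \<Rightarrow> complex"
  have injn: "inj (\<alpha> ^^ i)" for i using inj by (rule inj_fn)
  have zero: "(\<alpha> ^^ i) 0 = 0" for i by (induction i) (auto simp: hom_zero)
  have step: "(\<Sum>\<zeta>\<in>K. Q i (dual_mult \<omega> \<zeta>)) = of_nat N * Q (Suc i) (\<beta> \<omega>)" for i \<omega>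
  proof (cases "\<gamma> \<in> range (\<alpha> ^^ i)")
    case True
    then have ri: "(\<alpha> ^^ i) (r i) = \<gamma>" unfolding r_def by (rule f_inv_into_f)
    have iff: "\<gamma> \<in> range (\<alpha> ^^ Suc i) \<longleftrightarrow> r i \<in> range \<alpha>"
    proof
      assume "\<gamma> \<in> range (\<alpha> ^^ Suc i)"
      then obtain x where "(\<alpha> ^^ i) (\<alpha> x) = \<gamma>" by (auto simp: funpow_swap1)
      then show "r i \<in> range \<alpha>" using ri injD[OF injn] by (metis rangeI)
    next
      assume "r i \<in> range \<alpha>"
      then obtain x where "r i = \<alpha> x" by auto
      then have "\<gamma> = (\<alpha> ^^ Suc i) x" using ri by (simp add: funpow_swap1)
      then show "\<gamma> \<in> range (\<alpha> ^^ Suc i)" by blast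
    qed
    have *: "(\<Sum>\<zeta>\<in>K. Q i (dual_mult \<omega> \<zeta>)) = c * \<omega> (r i) * (\<Sum>\<zeta>\<in>K. \<zeta> (r i))"
      using True by (simp add: Q_def dual_mult_def sum_distrib_left mult.assoc)
    show ?thesis
    proof (cases "\<gamma> \<in> range (\<alpha> ^^ Suc i)")
      case True
      then have "(\<alpha> ^^ Suc i) (r (Suc i)) = \<gamma>" unfolding r_def by (rule f_inv_into_f)
      then have "(\<alpha> ^^ i) (\<alpha> (r (Suc i))) = (\<alpha> ^^ i) (r i)" using ri by (simp add: funpow_swap1)
      then have "\<alpha> (r (Suc i)) = r i" by (rule injD[OF injn])
      then show ?thesis using * True iff by (simp add: sum_kernel Q_def dual_hom_def)
    next
      case False
      then show ?thesis using * iff by (simp add: sum_kernel Q_def)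
    qed
  next
    case False
    then have "\<gamma> \<notin> range (\<alpha> ^^ Suc i)" by (auto simp: funpow_swap1)
    then show ?thesis using False by (simp add: Q_def)
  qed
  have mono: "Q i \<in> trig_poly" for i
    by (rule trig_poly.monomial[where c = "if \<gamma> \<in> range (\<alpha> ^^ i) then c else 0" and \<gamma> = "r i"]) (simp add: Q_def)
  have "\<exists>n d. \<forall>i\<ge>n. \<forall>\<omega>\<in>dual_group. Q i \<omega> = d"
  proof (cases "\<gamma> = 0")
    case True
    then have "\<gamma> \<in> range (\<alpha> ^^ i)" for i using zero by (metis rangeI)
    moreover have "r i = 0" for i unfolding r_def True using injn zero by (metis inv_f_f)
    ultimately show ?thesis by (intro exI[of _ 0] exI[of _ c]) (simp add: Q_def dual_group_zero)
  next
    case False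
    then obtain n where "\<gamma> \<notin> range (\<alpha> ^^ n)" using inter by blast
    moreover have "range (\<alpha> ^^ i) \<subseteq> range (\<alpha> ^^ n)" if "i \<ge> n" for i
    proof -
      have "\<alpha> ^^ i = \<alpha> ^^ n \<circ> \<alpha> ^^ (i - n)" using that by (simp flip: funpow_add)
      then show ?thesis by auto
    qed
    ultimately have "Q i \<omega> = 0" if "i \<ge> n" for i \<omega> using that by (auto simp: Q_def)
    then show ?thesis by blast
  qed
  moreover have "Q 0 \<omega> = f \<omega>" if "\<omega> \<in> dual_group" for \<omega>
    using monomial[OF that] by (simp add: Q_def r_def)
  ultimately show ?case using step mono by blast
next
  case (add f g k)
  from add.IH obtain P n c Q n' c' where
    P: "\<forall>\<omega>\<in>dual_group. P 0 \<omega> = f \<omega>" "\<forall>i. P i \<in> trig_poly"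
      "\<forall>i. \<forall>\<omega>\<in>dual_group. (\<Sum>\<zeta>\<in>K. P i (dual_mult \<omega> \<zeta>)) = of_nat N * P (Suc i) (\<beta> \<omega>)"
      "\<forall>i\<ge>n. \<forall>\<omega>\<in>dual_group. P i \<omega> = c" and
    Q: "\<forall>\<omega>\<in>dual_group. Q 0 \<omega> = g \<omega>" "\<forall>i. Q i \<in> trig_poly"
      "\<forall>i. \<forall>\<omega>\<in>dual_group. (\<Sum>\<zeta>\<in>K. Q i (dual_mult \<omega> \<zeta>)) = of_nat N * Q (Suc i) (\<beta> \<omega>)"
      "\<forall>i\<ge>n'. \<forall>\<omega>\<in>dual_group. Q i \<omega> = c'"
    by (elim exE conjE) blast
  show ?case
  proof (intro exI[of _ "\<lambda>i \<omega>. P i \<omega> + Q i \<omega>"] exI[of _ "max n n'"] exI[of _ "c + c'"] conjI allI ballI impI)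
    show "(\<lambda>\<omega>. P i \<omega> + Q i \<omega>) \<in> trig_poly" for i
      using P(2) Q(2) by (blast intro: trig_poly.add)
  qed (use P Q add.hyps in \<open>auto simp: sum.distrib distrib_left\<close>)
qed

text \<open>The order of quantifiers matters: \<open>n0\<close> and \<open>C\<close> are fixed
  before R, so each n may come with its own chain. They stem from a trigonometric polynomial near
  \<phi> whose averages are constant from \<open>n0\<close> on; since averaging contracts L^1, any
  chain starting at \<phi> stays as close to these averages as it began.\<close>

lemma transfer_mixing:
  assumes "integrable \<mu> \<phi>" "e > 0"
  shows "\<exists>n0 C. \<forall>R. \<forall>n\<ge>n0. (\<forall>i. R i \<in> borel_measurable \<mu>) \<longrightarrow> (AE \<omega> in \<mu>. R 0 \<omega> = \<phi> \<omega>) \<longrightarrow>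
    (\<forall>i<n. transfer (R i) (R (Suc i))) \<longrightarrow> (\<integral>\<^sup>+\<omega>. ennreal \<bar>R n \<omega> - C\<bar> \<partial>\<mu>) < ennreal e"
proof -
  obtain f where f: "f \<in> trig_poly" "(\<integral>\<^sup>+\<omega>. ennreal \<bar>\<phi> \<omega> - Re (f \<omega>)\<bar> \<partial>\<mu>) < ennreal e"
    using trig_poly_dense_L1[OF assms] .
  from trig_poly_transfer[OF f(1)] obtain Q n0 c where
    Q: "\<And>\<omega>. \<omega> \<in> dual_group \<Longrightarrow> Q 0 \<omega> = f \<omega>" "\<And>i. Q i \<in> trig_poly"
      "\<And>i \<omega>. \<omega> \<in> dual_group \<Longrightarrow> (\<Sum>\<zeta>\<in>K. Q i (dual_mult \<omega> \<zeta>)) = of_nat N * Q (Suc i) (\<beta> \<omega>)"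
      "\<And>i \<omega>. i \<ge> n0 \<Longrightarrow> \<omega> \<in> dual_group \<Longrightarrow> Q i \<omega> = c" by blast
  have Qm: "(\<lambda>\<omega>. Re (Q i \<omega>)) \<in> borel_measurable \<mu>" for i
    using trig_poly_continuous[OF Q(2)] by (intro continuous_measurable_mu continuous_intros)
  have Qt: "transfer (\<lambda>\<omega>. Re (Q i \<omega>)) (\<lambda>\<omega>. Re (Q (Suc i) \<omega>))" for i
    unfolding transfer_def
  proof (rule AE_I2)
    fix \<omega> assume "\<omega> \<in> space \<mu>"
    then have "Re (\<Sum>\<zeta>\<in>K. Q i (dual_mult \<omega> \<zeta>)) = Re (of_nat N * Q (Suc i) (\<beta> \<omega>))"
      using Q(3) by (simp add: space_mu)
    then show "(\<Sum>\<zeta>\<in>K. Re (Q i (dual_mult \<omega> \<zeta>))) = N * Re (Q (Suc i) (\<beta> \<omega>))" by simp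
  qed
  show ?thesis
  proof (intro exI allI impI)
    fix R n assume n: "n \<ge> n0" and "\<forall>i. R i \<in> borel_measurable \<mu>" and R0: "AE \<omega> in \<mu>. R 0 \<omega> = \<phi> \<omega>"
      and "\<forall>i<n. transfer (R i) (R (Suc i))"
    then have Rm: "\<And>i. R i \<in> borel_measurable \<mu>" and Rt: "\<And>i. i < n \<Longrightarrow> transfer (R i) (R (Suc i))"
      by auto
    have close: "(\<integral>\<^sup>+\<omega>. ennreal \<bar>R i \<omega> - Re (Q i \<omega>)\<bar> \<partial>\<mu>) < ennreal e" if "i \<le> n" for i
      using that
    proof (induction i)
      case 0
      have "(\<integral>\<^sup>+\<omega>. ennreal \<bar>R 0 \<omega> - Re (Q 0 \<omega>)\<bar> \<partial>\<mu>) = (\<integral>\<^sup>+\<omega>. ennreal \<bar>\<phi> \<omega> - Re (f \<omega>)\<bar> \<partial>\<mu>)"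
        using R0 AE_space by (intro nn_integral_cong_AE, eventually_elim) (simp add: Q(1) space_mu)
      then show ?case using f(2) by simp
    next
      case (Suc i)
      then have "(\<integral>\<^sup>+\<omega>. ennreal \<bar>R (Suc i) \<omega> - Re (Q (Suc i) \<omega>)\<bar> \<partial>\<mu>) \<le> (\<integral>\<^sup>+\<omega>. ennreal \<bar>R i \<omega> - Re (Q i \<omega>)\<bar> \<partial>\<mu>)"
        by (intro transfer_contraction Rt Qt Rm Qm) auto
      also have "\<dots> < ennreal e" using Suc by simp
      finally show ?case .
    qed
    have "(\<integral>\<^sup>+\<omega>. ennreal \<bar>R n \<omega> - Re (Q n \<omega>)\<bar> \<partial>\<mu>) = (\<integral>\<^sup>+\<omega>. ennreal \<bar>R n \<omega> - Re c\<bar> \<partial>\<mu>)"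
      using Q(4)[OF n] by (intro nn_integral_cong) (simp add: space_mu)
    then show "(\<integral>\<^sup>+\<omega>. ennreal \<bar>R n \<omega> - Re c\<bar> \<partial>\<mu>) < ennreal e" using close[of n] by simp
  qed
qed

text \<open>The constant C from \<open>transfer_mixing\<close> is not explicit, but the mean c of R
  is known. The distance from C to c is at most the L^1 distance from R to C, whence the factor
  2.\<close>

lemma L1_distance_mean:
  assumes R: "R \<in> borel_measurable \<mu>" "AE \<omega> in \<mu>. R \<omega> \<ge> 0" "(\<integral>\<^sup>+\<omega>. ennreal (R \<omega>) \<partial>\<mu>) = ennreal c" "c \<ge> 0"
    and C: "(\<integral>\<^sup>+\<omega>. ennreal \<bar>R \<omega> - C\<bar> \<partial>\<mu>) < ennreal e"
  shows "(\<integral>\<^sup>+\<omega>. ennreal \<bar>R \<omega> - c\<bar> \<partial>\<mu>) \<le> ennreal (2 * e)"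
proof -
  have int: "has_bochner_integral \<mu> R c"
    by (rule has_bochner_integral_nn_integral) (use R in auto)
  have e: "e > 0" using C by (metis ennreal_neg less_irrefl not_le not_less_zero)
  have i: "integrable \<mu> (\<lambda>\<omega>. \<bar>R \<omega> - C\<bar>)" using int by (auto simp: has_bochner_integral_iff)
  have "ennreal (LINT \<omega>|\<mu>. \<bar>R \<omega> - C\<bar>) < ennreal e"
    using C nn_integral_eq_integral[OF i] by simp
  then have le: "(LINT \<omega>|\<mu>. \<bar>R \<omega> - C\<bar>) < e" using e by (simp add: ennreal_less_iff)
  have "c - C = (LINT \<omega>|\<mu>. R \<omega> - C)"
    using int by (simp add: has_bochner_integral_iff prob_space)
  then have cC: "\<bar>C - c\<bar> \<le> (LINT \<omega>|\<mu>. \<bar>R \<omega> - C\<bar>)"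
    using integral_norm_bound[of \<mu> "\<lambda>\<omega>. R \<omega> - C"] by (simp add: abs_minus_commute)
  have i2: "integrable \<mu> (\<lambda>\<omega>. \<bar>R \<omega> - c\<bar>)" using int by (auto simp: has_bochner_integral_iff)
  have "(LINT \<omega>|\<mu>. \<bar>R \<omega> - c\<bar>) \<le> (LINT \<omega>|\<mu>. \<bar>R \<omega> - C\<bar> + \<bar>C - c\<bar>)"
    using i i2 by (intro integral_mono) auto
  also have "\<dots> = (LINT \<omega>|\<mu>. \<bar>R \<omega> - C\<bar>) + \<bar>C - c\<bar>" using i by (simp add: prob_space)
  also have "\<dots> \<le> 2 * e" using le cC by simp
  finally show ?thesis using nn_integral_eq_integral[OF i2] by (simp add: ennreal_leI)
qed

end

section \<open>Block matrices\<close>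

text \<open>A finite bound on \<open>seq_norm\<close> includes summability, since divergence has the
  value \<infinity>; so every finite truncation inherits it.\<close>

lemma seq_norm_finite_bound:
  assumes "seq_norm I y \<le> ennreal c" "c \<ge> 0" "finite I'" "I' \<subseteq> I"
  shows "L2_set (\<lambda>i. cmod (y i)) I' \<le> c"
proof -
  have s: "(\<lambda>i. (cmod (y i))\<^sup>2) summable_on I"
    using assms(1) by (auto simp: seq_norm_def top_unique split: if_splits)
  then have "sqrt (\<Sum>\<^sub>\<infinity>i\<in>I. (cmod (y i))\<^sup>2) \<le> c"
    using assms(1,2) by (simp add: seq_norm_def)
  moreover have "(\<Sum>i\<in>I'. (cmod (y i))\<^sup>2) \<le> (\<Sum>\<^sub>\<infinity>i\<in>I. (cmod (y i))\<^sup>2)"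
    by (intro finite_sum_le_infsum s assms) auto
  ultimately show ?thesis
    unfolding L2_set_def by (meson order_trans real_sqrt_le_mono)
qed

lemma L2_set_cmod_Cauchy_Schwarz:
  "cmod (\<Sum>i\<in>A. f i * g i) \<le> L2_set (\<lambda>i. cmod (f i)) A * L2_set (\<lambda>i. cmod (g i)) A"
proof -
  have "cmod (\<Sum>i\<in>A. f i * g i) \<le> (\<Sum>i\<in>A. \<bar>cmod (f i)\<bar> * \<bar>cmod (g i)\<bar>)"
    by (rule sum_norm_le) (simp add: norm_mult)
  also have "\<dots> \<le> L2_set (\<lambda>i. cmod (f i)) A * L2_set (\<lambda>i. cmod (g i)) A" by (rule L2_set_mult_ineq)
  finally show ?thesis .
qed

text \<open>The Euclidean norm gives this by Cauchy-Schwarz along the rows, the operator norm by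
  testing with the normalised truncation of x. The bilinear form treats rows and columns alike, so
  the transposed matrix is covered as well.\<close>

lemma matrix_norm_bilinear_bound:
  assumes nrm: "nrm \<in> {op_norm, eucl_norm}" and M: "nrm I J M \<le> ennreal c" "c \<ge> 0"
    and I': "finite I'" "I' \<subseteq> I" and J': "finite J'" "J' \<subseteq> J"
  shows "cmod (\<Sum>i\<in>I'. v i * (\<Sum>j\<in>J'. M i j * x j)) \<le>
    c * L2_set (\<lambda>i. cmod (v i)) I' * L2_set (\<lambda>j. cmod (x j)) J'"
proof -
  define X where "X = L2_set (\<lambda>j. cmod (x j)) J'"
  define V where "V = L2_set (\<lambda>i. cmod (v i)) I'"
  have X0: "X \<ge> 0" and V0: "V \<ge> 0" by (simp_all add: X_def V_def L2_set_nonneg)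
  have X2: "X\<^sup>2 = (\<Sum>j\<in>J'. (cmod (x j))\<^sup>2)" by (simp add: X_def L2_set_def sum_nonneg)
  have row: "L2_set (\<lambda>i. cmod (\<Sum>j\<in>J'. M i j * x j)) I' \<le> c * X"
  proof (cases "nrm = op_norm")
    case True
    show ?thesis
    proof (cases "X = 0")
      case True
      then have "x j = 0" if "j \<in> J'" for j
        using X2 that J'(1) by (simp add: sum_nonneg_eq_0_iff)
      then show ?thesis using True by (simp add: L2_set_def)
    next
      case False
      \<comment> \<open>Extended by zero, the normalised vector is an admissible test vector on J,
        and the infinite row sums collapse to finite ones.\<close>
      define x' where "x' j = (if j \<in> J' then x j / X else 0)" for j
      have hs: "((\<lambda>j. (cmod (x' j))\<^sup>2) has_sum 1) J"
      proof -
        have "(\<Sum>j\<in>J'. (cmod (x' j))\<^sup>2) = (\<Sum>j\<in>J'. (cmod (x j))\<^sup>2) / X\<^sup>2"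
          unfolding sum_divide_distrib using X0
          by (intro sum.cong refl) (simp add: x'_def norm_divide power_divide)
        also have "\<dots> = 1" using False by (simp flip: X2)
        finally show ?thesis
          using J' by (intro has_sum_finite_neutralI[of J']) (auto simp: x'_def)
      qed
      then have "seq_norm J x' \<le> 1"
        by (auto simp: seq_norm_def has_sum_imp_summable infsumI)
      then have "seq_norm I (\<lambda>i. \<Sum>\<^sub>\<infinity>j\<in>J. M i j * x' j) \<le> op_norm I J M"
        unfolding op_norm_def by (intro SUP_upper) auto
      also have "\<dots> \<le> ennreal c" using M(1) \<open>nrm = op_norm\<close> by simp
      finally have "L2_set (\<lambda>i. cmod (\<Sum>\<^sub>\<infinity>j\<in>J. M i j * x' j)) I' \<le> c"
        using M(2) I' by (rule seq_norm_finite_bound)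
      moreover have "(\<Sum>\<^sub>\<infinity>j\<in>J. M i j * x' j) = (\<Sum>j\<in>J'. M i j * x j) / X" for i
      proof -
        have "(\<Sum>\<^sub>\<infinity>j\<in>J. M i j * x' j) = (\<Sum>j\<in>J'. M i j * x' j)"
          using J' by (intro infsumI has_sum_finite_neutralI[of J']) (auto simp: x'_def)
        then show ?thesis by (simp add: x'_def sum_divide_distrib)
      qed
      ultimately have "L2_set (\<lambda>i. cmod (\<Sum>j\<in>J'. M i j * x j) * (1 / X)) I' \<le> c"
        using X0 by (simp add: norm_divide)
      then show ?thesis
        using X0 False L2_set_left_distrib[of "1 / X" "\<lambda>i. cmod (\<Sum>j\<in>J'. M i j * x j)" I']
        by (simp add: field_simps)
    qed
  next
    case False
    then have "eucl_norm I J M \<le> ennreal c" using nrm M by auto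
    then have "L2_set (\<lambda>p. cmod (case p of (i, j) \<Rightarrow> M i j)) (I' \<times> J') \<le> c"
      unfolding eucl_norm_def using M(2) I' J' by (intro seq_norm_finite_bound[of "I \<times> J"]) auto
    then have le: "sqrt (\<Sum>i\<in>I'. (L2_set (\<lambda>j. cmod (M i j)) J')\<^sup>2) \<le> c"
      by (simp add: L2_set_def sum.cartesian_product split_def sum_nonneg)
    have "L2_set (\<lambda>i. cmod (\<Sum>j\<in>J'. M i j * x j)) I' \<le> L2_set (\<lambda>i. L2_set (\<lambda>j. cmod (M i j)) J' * X) I'"
      unfolding X_def by (intro L2_set_mono L2_set_cmod_Cauchy_Schwarz) auto
    also have "\<dots> = L2_set (\<lambda>i. L2_set (\<lambda>j. cmod (M i j)) J') I' * X"
      using X0 by (simp add: L2_set_left_distrib)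
    also have "\<dots> \<le> c * X" using le X0 by (intro mult_right_mono) (simp_all add: L2_set_def[of _ I'])
    finally show ?thesis .
  qed
  have "cmod (\<Sum>i\<in>I'. v i * (\<Sum>j\<in>J'. M i j * x j)) \<le> V * L2_set (\<lambda>i. cmod (\<Sum>j\<in>J'. M i j * x j)) I'"
    unfolding V_def by (rule L2_set_cmod_Cauchy_Schwarz)
  also have "\<dots> \<le> V * (c * X)" by (intro mult_left_mono row V0)
  finally show ?thesis by (simp add: X_def V_def mult_ac)
qed

text \<open>Duality: pairing the image y of v under the transposed matrix with its own conjugate
  turns the bilinear bound into \<open>Y * Y\<close> \<le> c |v| Y.\<close>

lemma matrix_norm_transpose_bound:
  assumes "nrm \<in> {op_norm, eucl_norm}" "nrm I J M \<le> ennreal c" "c \<ge> 0"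
    and "finite I'" "I' \<subseteq> I" "finite J'" "J' \<subseteq> J"
  shows "L2_set (\<lambda>j. cmod (\<Sum>i\<in>I'. M i j * v i)) J' \<le> c * L2_set (\<lambda>i. cmod (v i)) I'"
proof -
  define y where "y j = (\<Sum>i\<in>I'. M i j * v i)" for j
  define Y where "Y = L2_set (\<lambda>j. cmod (y j)) J'"
  have Y0: "Y \<ge> 0" by (simp add: Y_def L2_set_nonneg)
  have "(\<Sum>i\<in>I'. v i * (\<Sum>j\<in>J'. M i j * cnj (y j))) = (\<Sum>i\<in>I'. \<Sum>j\<in>J'. M i j * v i * cnj (y j))"
    by (simp add: sum_distrib_left mult_ac)
  also have "\<dots> = (\<Sum>j\<in>J'. \<Sum>i\<in>I'. M i j * v i * cnj (y j))" by (rule sum.swap)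
  also have "\<dots> = (\<Sum>j\<in>J'. y j * cnj (y j))" by (simp add: y_def sum_distrib_right)
  also have "\<dots> = complex_of_real (Y\<^sup>2)"
    by (simp add: Y_def L2_set_def sum_nonneg flip: complex_norm_square)
  finally have "cmod (\<Sum>i\<in>I'. v i * (\<Sum>j\<in>J'. M i j * cnj (y j))) = Y\<^sup>2"
    by (simp only: norm_of_real abs_power2)
  with matrix_norm_bilinear_bound[OF assms, of v "\<lambda>j. cnj (y j)"]
  have "Y * Y \<le> (c * L2_set (\<lambda>i. cmod (v i)) I') * Y" by (simp add: Y_def power2_eq_square)
  then have "Y \<le> c * L2_set (\<lambda>i. cmod (v i)) I'"
    using Y0 assms(3) by (cases "Y = 0") (simp_all add: L2_set_nonneg)
  then show ?thesis by (simp add: Y_def y_def)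
qed

text \<open>Since \<open>A'\<close> is a right inverse, its transpose maps the image of v under the
  transposed matrix back to v; the bound on \<open>A'\<close>, used for its transpose, is thus an
  expansion by 1 + \<delta>.\<close>

lemma inverse_norm_transpose_bound:
  assumes "nrm \<in> {op_norm, eucl_norm}" "\<delta> > 0" "A' \<in> carrier_mat k k"
    and inv: "inverts_mat (mat k k (\<lambda>(i, j). M i j)) A'"
    and le: "nrm {..<k} {..<k} (\<lambda>i j. A' $$ (i, j)) \<le> ennreal (1 / (1 + \<delta>))"
  shows "(1 + \<delta>) * L2_set (\<lambda>i. cmod (v i)) {..<k} \<le> L2_set (\<lambda>j. cmod (\<Sum>i<k. M i j * v i)) {..<k}"
proof -
  let ?y = "\<lambda>j. \<Sum>i<k. M i j * v i"
  have id: "(\<Sum>j<k. M i j * A' $$ (j, l)) = (if i = l then 1 else 0)" if "i < k" "l < k" for i l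
  proof -
    have "(mat k k (\<lambda>(i, j). M i j) * A') $$ (i, l) = 1\<^sub>m k $$ (i, l)"
      using inv by (simp add: inverts_mat_def)
    then show ?thesis using that assms(3)
      by (simp add: scalar_prod_def lessThan_atLeast0)
  qed
  have "(\<Sum>j<k. A' $$ (j, l) * ?y j) = v l" if "l < k" for l
  proof -
    have "(\<Sum>j<k. A' $$ (j, l) * ?y j) = (\<Sum>j<k. \<Sum>i<k. (M i j * A' $$ (j, l)) * v i)"
      by (simp add: sum_distrib_left mult_ac)
    also have "\<dots> = (\<Sum>i<k. (\<Sum>j<k. M i j * A' $$ (j, l)) * v i)"
      by (subst sum.swap) (simp add: sum_distrib_right)
    also have "\<dots> = (\<Sum>i<k. if i = l then v l else 0)"
      using that by (intro sum.cong refl) (simp add: id)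
    also have "\<dots> = v l" using that by simp
    finally show ?thesis .
  qed
  then have "L2_set (\<lambda>l. cmod (v l)) {..<k} = L2_set (\<lambda>l. cmod (\<Sum>j<k. A' $$ (j, l) * ?y j)) {..<k}"
    by (intro L2_set_cong) auto
  also have "\<dots> \<le> 1 / (1 + \<delta>) * L2_set (\<lambda>j. cmod (?y j)) {..<k}"
    using assms(2) by (intro matrix_norm_transpose_bound[OF assms(1) le]) auto
  finally show ?thesis using assms(2) by (simp add: field_simps)
qed

lemma L2_set_le_suminf:
  assumes "summable (\<lambda>i. (f i)\<^sup>2)" "finite A"
  shows "L2_set f A \<le> sqrt (\<Sum>i. (f i)\<^sup>2)"
  unfolding L2_set_def using assms by (intro real_sqrt_le_mono sum_le_suminf) auto

text \<open>The rows from k on contribute an infinite series. Its finite truncations obey the bound,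
  which passes to the limit because only finitely many columns are tested.\<close>

lemma tail_norm_transpose_bound:
  assumes "nrm \<in> {op_norm, eucl_norm}" "nrm {k..} J M \<le> ennreal c" "c \<ge> 0" "finite J'" "J' \<subseteq> J"
    and w: "summable (\<lambda>i. (cmod (w i))\<^sup>2)" and y: "\<And>j. (\<lambda>i. M i j * w i) sums y j"
  shows "L2_set (\<lambda>j. cmod (y j - (\<Sum>i<k. M i j * w i))) J' \<le> c * sqrt (\<Sum>i. (cmod (w (i + k)))\<^sup>2)"
proof (rule LIMSEQ_le_const2)
  show "(\<lambda>n. L2_set (\<lambda>j. cmod ((\<Sum>i<n. M i j * w i) - (\<Sum>i<k. M i j * w i))) J') \<longlonglongrightarrow>
    L2_set (\<lambda>j. cmod (y j - (\<Sum>i<k. M i j * w i))) J'"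
    unfolding L2_set_def using y[unfolded sums_def]
    by (intro tendsto_real_sqrt tendsto_sum tendsto_power tendsto_norm tendsto_diff tendsto_const)
  show "\<exists>n0. \<forall>n\<ge>n0. L2_set (\<lambda>j. cmod ((\<Sum>i<n. M i j * w i) - (\<Sum>i<k. M i j * w i))) J'
    \<le> c * sqrt (\<Sum>i. (cmod (w (i + k)))\<^sup>2)"
  proof (intro exI allI impI)
    fix n assume "k \<le> n"
    then have eq: "(\<Sum>i<n. M i j * w i) - (\<Sum>i<k. M i j * w i) = (\<Sum>i\<in>{k..<n}. M i j * w i)" for j
      by (simp add: lessThan_atLeast0 sum_diff_nat_ivl)
    have "L2_set (\<lambda>i. cmod (w i)) {k..<n} = L2_set (\<lambda>i. cmod (w (i + k))) {..<n - k}"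
      unfolding L2_set_def
      using sum.shift_bounds_nat_ivl[of "\<lambda>i. (cmod (w i))\<^sup>2" 0 k "n - k"] \<open>k \<le> n\<close>
      by (simp add: lessThan_atLeast0)
    also have "\<dots> \<le> sqrt (\<Sum>i. (cmod (w (i + k)))\<^sup>2)"
      by (intro L2_set_le_suminf summable_ignore_initial_segment[OF w]) auto
    finally have "c * L2_set (\<lambda>i. cmod (w i)) {k..<n} \<le> c * sqrt (\<Sum>i. (cmod (w (i + k)))\<^sup>2)"
      using assms(3) by (rule mult_left_mono)
    moreover have "L2_set (\<lambda>j. cmod (\<Sum>i\<in>{k..<n}. M i j * w i)) J' \<le> c * L2_set (\<lambda>i. cmod (w i)) {k..<n}"
      by (rule matrix_norm_transpose_bound[OF assms(1-3)]) (use assms(4,5) in auto)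
    ultimately show "L2_set (\<lambda>j. cmod ((\<Sum>i<n. M i j * w i) - (\<Sum>i<k. M i j * w i))) J'
      \<le> c * sqrt (\<Sum>i. (cmod (w (i + k)))\<^sup>2)"
      unfolding eq by linarith
  qed
qed

section \<open>Heads, tails and the block estimates at one point\<close>

definition head_norm :: "nat \<Rightarrow> (nat \<Rightarrow> complex) \<Rightarrow> real" where
  "head_norm k w = L2_set (\<lambda>i. cmod (w i)) {..<k}"

definition tail_norm :: "nat \<Rightarrow> (nat \<Rightarrow> complex) \<Rightarrow> real" where
  "tail_norm k w = sqrt (\<Sum>i. (cmod (w (i + k)))\<^sup>2)"

lemma
  assumes w: "summable (\<lambda>i. (cmod (w i))\<^sup>2)"
  shows head_norm_le: "head_norm k w \<le> sqrt (\<Sum>i. (cmod (w i))\<^sup>2)"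
    and tail_norm_le: "tail_norm k w \<le> sqrt (\<Sum>i. (cmod (w i))\<^sup>2)"
    and head_tail_norm_ge: "sqrt (\<Sum>i. (cmod (w i))\<^sup>2) \<le> head_norm k w + tail_norm k w"
proof -
  let ?t = "\<Sum>i. (cmod (w (i + k)))\<^sup>2" and ?h = "\<Sum>i<k. (cmod (w i))\<^sup>2"
  have eq: "(\<Sum>i. (cmod (w i))\<^sup>2) = ?t + ?h" by (rule suminf_split_initial_segment[OF w])
  have t: "?t \<ge> 0" by (intro suminf_nonneg summable_ignore_initial_segment[OF w]) auto
  have h: "?h \<ge> 0" by (intro sum_nonneg) auto
  show "head_norm k w \<le> sqrt (\<Sum>i. (cmod (w i))\<^sup>2)" "tail_norm k w \<le> sqrt (\<Sum>i. (cmod (w i))\<^sup>2)"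
    using t h unfolding eq head_norm_def tail_norm_def L2_set_def by auto
  show "sqrt (\<Sum>i. (cmod (w i))\<^sup>2) \<le> head_norm k w + tail_norm k w"
    using sqrt_add_le_add_sqrt[OF h t] unfolding eq head_norm_def tail_norm_def L2_set_def
    by (simp add: add.commute)
qed

text \<open>The hypotheses on H(\<omega>) at a single \<omega>. The bound on the inverse and the
  bounds on the other blocks may refer to different norms.\<close>

locale block_matrix =
  fixes nrm nrm' :: "nat set \<Rightarrow> nat set \<Rightarrow> (nat \<Rightarrow> nat \<Rightarrow> complex) \<Rightarrow> ennreal"
    and M :: "nat \<Rightarrow> nat \<Rightarrow> complex" and k :: nat and \<delta> \<epsilon> :: real
  assumes norms: "nrm \<in> {op_norm, eucl_norm}" "nrm' \<in> {op_norm, eucl_norm}" and pos: "\<delta> > 0" "\<epsilon> \<ge> 0"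
    and A_inverse: "\<exists>A'\<in>carrier_mat k k. inverts_mat (mat k k (\<lambda>(i, j). M i j)) A' \<and>
        nrm' {..<k} {..<k} (\<lambda>i j. A' $$ (i, j)) \<le> ennreal (1 / (1 + \<delta>))"
    and small: "nrm {..<k} {k..} M \<le> ennreal \<epsilon>" "nrm {k..} {..<k} M \<le> ennreal \<epsilon>" "nrm {k..} {k..} M \<le> ennreal \<epsilon>"
begin

text \<open>Here y is the image of w under the transposed matrix. Its tail is B^t on the head of w
  plus D^t on the tail, each at most \<epsilon> |w|. Its head is A^t on the head of w plus C^t on
  the tail; as A^t expands by 1 + \<delta>, a long head of w makes y long.\<close>

lemma
  assumes w: "summable (\<lambda>i. (cmod (w i))\<^sup>2)" and y: "\<And>j. (\<lambda>i. M i j * w i) sums y j"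
    and s: "summable (\<lambda>j. (cmod (y j))\<^sup>2)"
  shows tail_image_le: "tail_norm k y \<le> 2 * \<epsilon> * sqrt (\<Sum>i. (cmod (w i))\<^sup>2)"
    and head_expands: "(1 + \<delta>) * head_norm k w \<le> sqrt (\<Sum>j. (cmod (y j))\<^sup>2) + \<epsilon> * tail_norm k w"
proof -
  let ?u = "\<lambda>j. \<Sum>i<k. M i j * w i"
  have tl: "L2_set (\<lambda>j. cmod (y j - ?u j)) J' \<le> \<epsilon> * tail_norm k w"
    if "finite J'" "J' \<subseteq> J" "nrm {k..} J M \<le> ennreal \<epsilon>" for J' J
    unfolding tail_norm_def by (rule tail_norm_transpose_bound[OF norms(1) that(3) pos(2) that(1,2) w y])
  show "tail_norm k y \<le> 2 * \<epsilon> * sqrt (\<Sum>i. (cmod (w i))\<^sup>2)"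
    unfolding tail_norm_def
  proof (rule LIMSEQ_le_const2)
    show "(\<lambda>n. sqrt (\<Sum>i<n. (cmod (y (i + k)))\<^sup>2)) \<longlonglongrightarrow> sqrt (\<Sum>i. (cmod (y (i + k)))\<^sup>2)"
      by (intro tendsto_real_sqrt summable_LIMSEQ summable_ignore_initial_segment[OF s])
    show "\<exists>n0. \<forall>n\<ge>n0. sqrt (\<Sum>i<n. (cmod (y (i + k)))\<^sup>2) \<le> 2 * \<epsilon> * sqrt (\<Sum>i. (cmod (w i))\<^sup>2)"
    proof (intro exI allI impI)
      fix n
      let ?J = "{k..<n + k}"
      have "sqrt (\<Sum>i<n. (cmod (y (i + k)))\<^sup>2) = L2_set (\<lambda>j. cmod (y j)) ?J"
        unfolding L2_set_def using sum.shift_bounds_nat_ivl[of "\<lambda>i. (cmod (y i))\<^sup>2" 0 k n]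
        by (simp add: lessThan_atLeast0)
      also have "\<dots> \<le> L2_set (\<lambda>j. cmod (y j - ?u j) + cmod (?u j)) ?J"
        by (intro L2_set_mono norm_ge_zero) (metis diff_add_cancel norm_triangle_ineq)
      also have "\<dots> \<le> L2_set (\<lambda>j. cmod (y j - ?u j)) ?J + L2_set (\<lambda>j. cmod (?u j)) ?J"
        by (rule L2_set_triangle_ineq)
      also have "L2_set (\<lambda>j. cmod (?u j)) ?J \<le> \<epsilon> * head_norm k w"
        unfolding head_norm_def by (rule matrix_norm_transpose_bound[OF norms(1) small(1) pos(2)]) auto
      also have "L2_set (\<lambda>j. cmod (y j - ?u j)) ?J \<le> \<epsilon> * tail_norm k w"
        by (rule tl[OF _ _ small(3)]) auto
      also have "\<epsilon> * head_norm k w \<le> \<epsilon> * sqrt (\<Sum>i. (cmod (w i))\<^sup>2)"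
        by (intro mult_left_mono head_norm_le w pos)
      also have "\<epsilon> * tail_norm k w \<le> \<epsilon> * sqrt (\<Sum>i. (cmod (w i))\<^sup>2)"
        by (intro mult_left_mono tail_norm_le w pos)
      finally show "sqrt (\<Sum>i<n. (cmod (y (i + k)))\<^sup>2) \<le> 2 * \<epsilon> * sqrt (\<Sum>i. (cmod (w i))\<^sup>2)" by simp
    qed
  qed
  obtain A' where A': "A' \<in> carrier_mat k k" "inverts_mat (mat k k (\<lambda>(i, j). M i j)) A'"
    "nrm' {..<k} {..<k} (\<lambda>i j. A' $$ (i, j)) \<le> ennreal (1 / (1 + \<delta>))" using A_inverse by blast
  have "(1 + \<delta>) * head_norm k w \<le> L2_set (\<lambda>j. cmod (?u j)) {..<k}"
    unfolding head_norm_def by (rule inverse_norm_transpose_bound[OF norms(2) pos(1) A'])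
  also have "\<dots> \<le> L2_set (\<lambda>j. cmod (y j) + cmod (y j - ?u j)) {..<k}"
    by (intro L2_set_mono norm_ge_zero) (metis norm_minus_commute norm_triangle_sub)
  also have "\<dots> \<le> L2_set (\<lambda>j. cmod (y j)) {..<k} + L2_set (\<lambda>j. cmod (y j - ?u j)) {..<k}"
    by (rule L2_set_triangle_ineq)
  also have "L2_set (\<lambda>j. cmod (y j - ?u j)) {..<k} \<le> \<epsilon> * tail_norm k w"
    by (rule tl[OF _ _ small(2)]) auto
  also have "L2_set (\<lambda>j. cmod (y j)) {..<k} \<le> sqrt (\<Sum>j. (cmod (y j))\<^sup>2)"
    by (intro L2_set_le_suminf s) auto
  finally show "(1 + \<delta>) * head_norm k w \<le> sqrt (\<Sum>j. (cmod (y j))\<^sup>2) + \<epsilon> * tail_norm k w" by simp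
qed

end

text \<open>Here a, b, d are the squared lengths of p(\<omega>), q(\<beta> \<omega>) and r(\<beta>
  (\<beta> \<omega>)), and U, V bound the head and tail of q(\<beta> \<omega>). Together the
  inequalities say that (1 + \<delta>) sqrt b is at most sqrt a + (1 + \<delta> + \<epsilon>) 2
  \<epsilon> sqrt d. The last coefficient is well below \<delta>, so this fails for equal lengths
  and also within a small relative error.\<close>

lemma expansion_contradiction:
  fixes a b d c \<delta> \<epsilon> U V :: real
  assumes pos: "c > 0" "\<delta> > 0" and \<epsilon>: "0 \<le> \<epsilon>" "\<epsilon> \<le> 1 / 8" "\<epsilon> \<le> \<delta> / 8"
    and close: "\<bar>a - c\<bar> < \<delta> / (8 + 8 * \<delta>) * c" "\<bar>b - c\<bar> < \<delta> / (8 + 8 * \<delta>) * c" "\<bar>d - c\<bar> < \<delta> / (8 + 8 * \<delta>) * c"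
    and split: "sqrt b \<le> U + V" and V: "V \<le> 2 * \<epsilon> * sqrt d"
    and U: "(1 + \<delta>) * U \<le> sqrt a + \<epsilon> * V"
  shows False
proof -
  define \<theta> where "\<theta> = \<delta> / (8 + 8 * \<delta>)"
  define s where "s = sqrt c"
  have s: "s > 0" "s\<^sup>2 = c" using pos by (auto simp: s_def)
  \<comment> \<open>The denominator 8 + 8 \<delta> is chosen for this identity, which keeps the
    errors proportional to \<delta> even when \<delta> is large.\<close>
  have \<theta>: "\<theta> * (1 + \<delta>) = \<delta> / 8" using pos by (simp add: \<theta>_def field_simps)
  have \<theta>0: "0 < \<theta>" "\<theta> < 1" using pos by (auto simp: \<theta>_def field_simps)
  have up: "sqrt x \<le> (1 + \<theta>) * s" if "\<bar>x - c\<bar> < \<theta> * c" for x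
  proof (rule real_le_lsqrt)
    have "x \<le> (1 + \<theta>) * c" using that by (simp add: algebra_simps)
    also have "\<dots> \<le> (1 + \<theta>)\<^sup>2 * c" using \<theta>0 pos by (intro mult_right_mono) (auto simp: power2_eq_square)
    finally show "x \<le> ((1 + \<theta>) * s)\<^sup>2" using s by (simp add: power_mult_distrib)
  qed (use \<theta>0 s in auto)
  have low: "(1 - \<theta>) * s \<le> sqrt b"
  proof (rule real_le_rsqrt)
    have "((1 - \<theta>) * s)\<^sup>2 = (1 - \<theta>)\<^sup>2 * c" using s by (simp add: power_mult_distrib)
    also have "\<dots> \<le> (1 - \<theta>) * c" using \<theta>0 pos by (intro mult_right_mono) (auto simp: power2_eq_square mult_le_cancel_left1)
    also have "\<dots> \<le> b" using close(2) unfolding \<theta>_def[symmetric] by (simp add: algebra_simps)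
    finally show "((1 - \<theta>) * s)\<^sup>2 \<le> b" .
  qed
  \<comment> \<open>The three terms are 2 \<epsilon> \<le> \<delta>/4, 2 \<epsilon> \<delta> \<le>
    \<delta>/4 and 2 \<epsilon>^2 \<le> \<delta>/32.\<close>
  have k: "(1 + \<delta> + \<epsilon>) * (2 * \<epsilon>) \<le> 17 / 32 * \<delta>"
  proof -
    have "\<epsilon> * \<delta> \<le> 1 / 8 * \<delta>" using \<epsilon> pos by (intro mult_right_mono) auto
    moreover have "\<epsilon> * \<epsilon> \<le> 1 / 8 * (\<delta> / 8)" using \<epsilon> by (intro mult_mono) auto
    ultimately show ?thesis using \<epsilon> by (simp add: algebra_simps)
  qed
  have "(1 + \<delta>) * ((1 - \<theta>) * s) \<le> (1 + \<delta>) * (U + V)" using low split pos by (intro mult_left_mono) auto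
  also have "\<dots> \<le> sqrt a + (1 + \<delta> + \<epsilon>) * V" using U by (simp add: algebra_simps)
  also have "\<dots> \<le> sqrt a + (1 + \<delta> + \<epsilon>) * (2 * \<epsilon> * sqrt d)" using V pos \<epsilon> by (intro add_left_mono mult_left_mono) auto
  also have "\<dots> \<le> (1 + \<theta>) * s + (1 + \<delta> + \<epsilon>) * (2 * \<epsilon> * ((1 + \<theta>) * s))"
    using up[of a] up[of d] close pos \<epsilon> by (intro add_mono mult_left_mono) (auto simp: \<theta>_def)
  also have "\<dots> = (1 + \<theta>) * s + ((1 + \<delta> + \<epsilon>) * (2 * \<epsilon>)) * ((1 + \<theta>) * s)" by simp
  also have "\<dots> \<le> (1 + \<theta>) * s + (17 / 32 * \<delta>) * ((1 + \<theta>) * s)"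
    using k \<theta>0 s by (intro add_left_mono mult_right_mono) auto
  finally have "((1 + \<delta>) * (1 - \<theta>)) * s \<le> ((1 + \<theta>) * (1 + 17 / 32 * \<delta>)) * s"
    by (simp add: algebra_simps)
  then have "(1 + \<delta>) * (1 - \<theta>) \<le> (1 + \<theta>) * (1 + 17 / 32 * \<delta>)" using s by simp
  \<comment> \<open>The coefficient 49/32 is 1 + 17/32. By the identity for \<theta> the first two
    terms are at most 2 (\<theta> + \<theta> \<delta>) = \<delta>/4, so the right side is at most
    25/32 \<delta>.\<close>
  then have "\<delta> \<le> 2 * \<theta> + 49 / 32 * (\<theta> * \<delta>) + 17 / 32 * \<delta>" by (simp add: field_simps)
  moreover have "\<theta> + \<theta> * \<delta> = \<delta> / 8" using \<theta> by (simp add: algebra_simps)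
  moreover have "\<theta> * \<delta> \<ge> 0" using \<theta>0 pos by simp
  ultimately show False using pos by linarith
qed

section \<open>Purity\<close>

lemma l2_eq_sym: "l2_eq \<mu> f g \<Longrightarrow> l2_eq \<mu> g f"
  unfolding l2_eq_def by (simp add: eq_commute)

lemma l2_eq_trans [trans]: "l2_eq \<mu> f g \<Longrightarrow> l2_eq \<mu> g k \<Longrightarrow> l2_eq \<mu> f k"
  unfolding l2_eq_def
proof
  fix i assume "\<forall>i. AE \<omega> in \<mu>. f i \<omega> = g i \<omega>" "\<forall>i. AE \<omega> in \<mu>. g i \<omega> = k i \<omega>"
  then have "AE \<omega> in \<mu>. f i \<omega> = g i \<omega>" "AE \<omega> in \<mu>. g i \<omega> = k i \<omega>" by auto
  then show "AE \<omega> in \<mu>. f i \<omega> = k i \<omega>" by eventually_elim simp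
qed

lemma l2_eq_AE_all: "l2_eq \<mu> f g \<Longrightarrow> AE \<omega> in \<mu>. \<forall>i. f i \<omega> = g i \<omega>"
  by (simp add: l2_eq_def AE_all_countable)

lemma l2_eq_nsq: "l2_eq \<mu> f g \<Longrightarrow> AE \<omega> in \<mu>. nsq f \<omega> = nsq g \<omega>"
  by (drule l2_eq_AE_all) (auto simp: nsq_def elim!: eventually_mono)

lemma l2_zero: "(\<lambda>i \<omega>. 0) \<in> l2_space \<mu> m"
  by (simp add: l2_space_def)

lemma l2_scale:
  assumes "f \<in> l2_space \<mu> m" shows "(\<lambda>i \<omega>. a * f i \<omega>) \<in> l2_space \<mu> m"
proof -
  have [measurable]: "f i \<in> borel_measurable \<mu>" for i using l2_measurable[OF assms] .
  have "(\<Sum>i. \<integral>\<^sup>+\<omega>. ennreal ((cmod (a * f i \<omega>))\<^sup>2) \<partial>\<mu>) =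
    (\<Sum>i. ennreal ((cmod a)\<^sup>2) * (\<integral>\<^sup>+\<omega>. ennreal ((cmod (f i \<omega>))\<^sup>2) \<partial>\<mu>))"
    by (intro suminf_cong, subst nn_integral_cmult[symmetric])
      (auto simp: norm_mult power_mult_distrib ennreal_mult)
  also have "\<dots> = ennreal ((cmod a)\<^sup>2) * (\<Sum>i. \<integral>\<^sup>+\<omega>. ennreal ((cmod (f i \<omega>))\<^sup>2) \<partial>\<mu>)"
    by (rule ennreal_suminf_cmult)
  also have "\<dots> < \<infinity>" using assms by (simp add: l2_space_def ennreal_mult_less_top)
  finally show ?thesis using assms by (simp add: l2_space_def)
qed

lemma l2_eq_zero_iff:
  assumes "f \<in> l2_space \<mu> m"
  shows "l2_eq \<mu> f (\<lambda>i \<omega>. 0) \<longleftrightarrow> (\<integral>\<^sup>+\<omega>. ennreal (nsq f \<omega>) \<partial>\<mu>) = 0"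
proof
  assume "l2_eq \<mu> f (\<lambda>i \<omega>. 0)"
  from l2_eq_nsq[OF this] have "AE \<omega> in \<mu>. ennreal (nsq f \<omega>) = 0"
    by eventually_elim (simp add: nsq_def)
  then show "(\<integral>\<^sup>+\<omega>. ennreal (nsq f \<omega>) \<partial>\<mu>) = 0"
    using nsq_measurable[OF assms] by (subst nn_integral_0_iff_AE) auto
next
  assume "(\<integral>\<^sup>+\<omega>. ennreal (nsq f \<omega>) \<partial>\<mu>) = 0"
  then have "AE \<omega> in \<mu>. nsq f \<omega> \<le> 0"
    using nsq_measurable[OF assms] by (subst (asm) nn_integral_0_iff_AE) (auto simp: ennreal_eq_0_iff)
  then have "AE \<omega> in \<mu>. \<forall>i. f i \<omega> = 0"
    using l2_summable[OF assms]
  proof eventually_elim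
    case (elim \<omega>)
    have "(\<Sum>i. (cmod (f i \<omega>))\<^sup>2) = 0"
      using elim suminf_nonneg[OF elim(2)] by (simp add: nsq_def)
    then show ?case using suminf_eq_zero_iff[OF elim(2)] by simp
  qed
  then show "l2_eq \<mu> f (\<lambda>i \<omega>. 0)" by (simp add: l2_eq_def AE_all_countable)
qed

context dual_endo
begin

text \<open>The hypothesis concerns the forward image, whereas points with both \<omega> and \<beta>
  \<omega> in F are needed. If these were negligible, almost no \<omega> would have a kernel
  translate among them; but any \<omega> with \<beta> \<omega> in \<open>?G\<close> has one, namely
  the \<eta> in F with the same image. So the preimage of \<open>?G\<close> would be null, and
  \<beta> preserves \<mu>.\<close>

lemma overlap_positive:
  assumes F: "F \<in> sets \<mu>" and overlap: "emeasure \<mu> (F \<inter> \<beta> ` F) > 0"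
  shows "emeasure \<mu> {\<omega> \<in> F. \<beta> \<omega> \<in> F} > 0" "{\<omega> \<in> F. \<beta> \<omega> \<in> F} \<in> sets \<mu>"
proof -
  let ?E = "{\<omega> \<in> F. \<beta> \<omega> \<in> F}" and ?G = "F \<inter> \<beta> ` F"
  have sub: "F \<subseteq> dual_group" using sets.sets_into_space[OF F] by (simp add: space_mu)
  have "?E = F \<inter> (\<beta> -` F \<inter> space \<mu>)" using sub by (auto simp: space_mu)
  also have "\<dots> \<in> sets \<mu>" using F measurable_sets[OF measurable_dual_hom F] by blast
  finally show E: "?E \<in> sets \<mu>" .
  \<comment> \<open>\<open>emeasure\<close> is 0 on nonmeasurable sets, so positivity already yields
    measurability.\<close>
  have G: "?G \<in> sets \<mu>" using overlap emeasure_notin_sets by fastforce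
  show "emeasure \<mu> ?E > 0"
  proof (rule ccontr)
    assume "\<not> emeasure \<mu> ?E > 0"
    then have "?E \<in> null_sets \<mu>" using E by (auto simp: null_sets_def)
    then have "AE \<omega> in \<mu>. \<omega> \<notin> ?E" by (rule AE_not_in)
    from AE_kernel[OF this] AE_space have "AE \<omega> in \<mu>. indicator ?G (\<beta> \<omega>) = (0 :: ennreal)"
    proof eventually_elim
      case (elim \<omega>)
      then have w: "\<omega> \<in> space \<mu>" and *: "\<forall>\<zeta>\<in>K. dual_mult \<omega> \<zeta> \<notin> ?E" by auto
      have "\<beta> \<omega> \<notin> ?G"
      proof
        assume "\<beta> \<omega> \<in> ?G"
        then obtain \<eta> where \<eta>: "\<beta> \<omega> \<in> F" "\<eta> \<in> F" "\<beta> \<omega> = \<beta> \<eta>" by auto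
        have wd: "\<omega> \<in> dual_group" "\<eta> \<in> dual_group" using w \<eta> sub by (auto simp: space_mu)
        have inv: "\<beta> (dual_inv \<omega>) = dual_inv (\<beta> \<omega>)" by (simp add: dual_inv_def dual_hom_def)
        have "\<beta> (dual_mult (dual_inv \<omega>) \<eta>) = dual_one"
          unfolding dual_hom_mult inv \<eta>(3)[symmetric]
          using dual_mult_inv[OF dual_hom_in_dual[OF wd(1)]] by (metis dual_mult_commute)
        then have "dual_mult (dual_inv \<omega>) \<eta> \<in> K"
          using dual_mult_in_dual[OF dual_inv_in_dual[OF wd(1)] wd(2)] by (simp add: dual_kernel_def)
        moreover have "dual_mult \<omega> (dual_mult (dual_inv \<omega>) \<eta>) = \<eta>"
          using dual_mult_inv[OF wd(1)] by (metis dual_mult_assoc dual_mult_commute dual_mult_one)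
        ultimately have "\<eta> \<notin> ?E" using * by metis
        with \<eta> show False by auto
      qed
      then show ?case by simp
    qed
    then have "(\<integral>\<^sup>+\<omega>. indicator ?G (\<beta> \<omega>) \<partial>\<mu>) = (\<integral>\<^sup>+\<omega>. 0 \<partial>\<mu>)" by (rule nn_integral_cong_AE)
    moreover have "emeasure \<mu> ?G = (\<integral>\<^sup>+\<omega>. indicator ?G (\<beta> \<omega>) \<partial>\<mu>)"
      using G by (subst nn_integral_dual_hom) auto
    ultimately show False using overlap by simp
  qed
qed

end

section \<open>Iterated ranges, eigenvectors and the final contradiction\<close>

context ruelle_op
begin

lemma ruelle_cong:
  assumes "l2_eq \<mu> f g" shows "l2_eq \<mu> (S f) (S g)"
  unfolding l2_eq_def
proof
  fix j
  show "AE \<omega> in \<mu>. S f j \<omega> = S g j \<omega>"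
    using AE_dual_hom[OF l2_eq_AE_all[OF assms]] by eventually_elim (simp add: ruelle_def)
qed

lemma ruelle_scale:
  "f \<in> l2_space \<mu> m \<Longrightarrow> l2_eq \<mu> (S (\<lambda>i \<omega>. a * f i \<omega>)) (\<lambda>i \<omega>. a * S f i \<omega>)"
  using ruelle_linear[of f f a 0] by simp

lemma ruelle_pow_l2: "f \<in> l2_space \<mu> m \<Longrightarrow> (S ^^ n) f \<in> l2_space \<mu> m"
  by (induction n) (auto intro: ruelle_l2)

lemma nn_integral_ruelle_pow:
  "f \<in> l2_space \<mu> m \<Longrightarrow> (\<integral>\<^sup>+\<omega>. ennreal (nsq ((S ^^ n) f) \<omega>) \<partial>\<mu>) = (\<integral>\<^sup>+\<omega>. ennreal (nsq f \<omega>) \<partial>\<mu>)"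
  by (induction n) (auto simp: nn_integral_ruelle ruelle_pow_l2)

lemma eigenvector_pow:
  assumes f: "f \<in> l2_space \<mu> m" and eig: "l2_eq \<mu> (S f) (\<lambda>i \<omega>. z * f i \<omega>)"
  shows "l2_eq \<mu> ((S ^^ n) (\<lambda>i \<omega>. a * f i \<omega>)) (\<lambda>i \<omega>. z ^ n * a * f i \<omega>)"
proof (induction n)
  case 0
  show ?case by (simp add: l2_eq_def)
next
  case (Suc n)
  have "l2_eq \<mu> ((S ^^ Suc n) (\<lambda>i \<omega>. a * f i \<omega>)) (S (\<lambda>i \<omega>. z ^ n * a * f i \<omega>))"
    using ruelle_cong[OF Suc.IH] by simp
  also have "l2_eq \<mu> (S (\<lambda>i \<omega>. z ^ n * a * f i \<omega>)) (\<lambda>i \<omega>. z ^ n * a * S f i \<omega>)"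
    by (rule ruelle_scale[OF f])
  also have "l2_eq \<mu> (\<lambda>i \<omega>. z ^ n * a * S f i \<omega>) (\<lambda>i \<omega>. z ^ Suc n * a * f i \<omega>)"
    using eig unfolding l2_eq_def by (auto elim!: eventually_mono simp: mult_ac)
  finally show ?case .
qed

text \<open>The eigenvalue is nonzero because S preserves norms, so dividing f by
  \<open>z ^ n\<close> gives a preimage under the n-th power.\<close>

lemma eigenvector_in_ranges:
  assumes "l2_eigenvector \<mu> m S f z"
  shows "f \<in> l2_range \<mu> m (S ^^ n)"
proof -
  have f: "f \<in> l2_space \<mu> m" "\<not> l2_eq \<mu> f (\<lambda>i \<omega>. 0)" "l2_eq \<mu> (S f) (\<lambda>i \<omega>. z * f i \<omega>)"
    using assms by (auto simp: l2_eigenvector_def)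
  have "z \<noteq> 0"
  proof
    assume "z = 0"
    then have "(\<integral>\<^sup>+\<omega>. ennreal (nsq (S f) \<omega>) \<partial>\<mu>) = 0"
      using f l2_eq_zero_iff[OF ruelle_l2[OF f(1)]] by simp
    with f show False using nn_integral_ruelle[OF f(1)] l2_eq_zero_iff[OF f(1)] by simp
  qed
  then have "l2_eq \<mu> ((S ^^ n) (\<lambda>i \<omega>. (1 / z ^ n) * f i \<omega>)) f"
    using eigenvector_pow[OF f(1,3), of n "1 / z ^ n"] by simp
  then show ?thesis
    unfolding l2_range_def using f(1) l2_scale[OF f(1)] l2_eq_sym by blast
qed

text \<open>The chain is read from f back to g: its i-th entry is the squared length of
  \<open>(S ^^ (n - i)) g\<close>. It starts at \<open>nsq f\<close> up to a null set, so the
  threshold depends on f and e alone.\<close>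

lemma range_norm_almost_constant:
  assumes f: "f \<in> l2_space \<mu> m" and c: "(\<integral>\<^sup>+\<omega>. ennreal (nsq f \<omega>) \<partial>\<mu>) = ennreal c" "c \<ge> 0" and "e > 0"
  shows "\<exists>n0. \<forall>n\<ge>n0. \<forall>g\<in>l2_space \<mu> m. l2_eq \<mu> f ((S ^^ n) g) \<longrightarrow>
    (\<integral>\<^sup>+\<omega>. ennreal \<bar>nsq g \<omega> - c\<bar> \<partial>\<mu>) \<le> ennreal e"
proof -
  have int: "integrable \<mu> (nsq f)"
    using has_bochner_integral_nn_integral[OF nsq_measurable[OF f] nsq_nonneg[OF f] c(2,1)]
    by (simp add: has_bochner_integral_iff)
  \<comment> \<open>Half, since \<open>L1_distance_mean\<close> doubles the error.\<close>
  have "e / 2 > 0" using assms by simp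
  from transfer_mixing[OF int this] obtain n0 C where mix: "\<forall>R. \<forall>n\<ge>n0. (\<forall>i. R i \<in> borel_measurable \<mu>) \<longrightarrow>
    (AE \<omega> in \<mu>. R 0 \<omega> = nsq f \<omega>) \<longrightarrow> (\<forall>i<n. transfer (R i) (R (Suc i))) \<longrightarrow>
    (\<integral>\<^sup>+\<omega>. ennreal \<bar>R n \<omega> - C\<bar> \<partial>\<mu>) < ennreal (e / 2)"
    by (elim exE) (rule that)
  show ?thesis
  proof (intro exI allI ballI impI)
    fix n g assume n: "n \<ge> n0" and g: "g \<in> l2_space \<mu> m" and eq: "l2_eq \<mu> f ((S ^^ n) g)"
    let ?R = "\<lambda>i. nsq ((S ^^ (n - i)) g)"
    have "(\<integral>\<^sup>+\<omega>. ennreal \<bar>?R n \<omega> - C\<bar> \<partial>\<mu>) < ennreal (e / 2)"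
    proof (rule mix[rule_format, OF n, of ?R])
      show "?R i \<in> borel_measurable \<mu>" for i by (rule nsq_measurable[OF ruelle_pow_l2[OF g]])
      show "AE \<omega> in \<mu>. ?R 0 \<omega> = nsq f \<omega>" using l2_eq_nsq[OF eq] by (auto elim: eventually_mono)
      show "transfer (?R i) (?R (Suc i))" if "i < n" for i
      proof -
        have "n - i = Suc (n - Suc i)" using that by simp
        then show ?thesis using transfer_ruelle[OF ruelle_pow_l2[OF g, of "n - Suc i"]] by simp
      qed
    qed
    then have "(\<integral>\<^sup>+\<omega>. ennreal \<bar>nsq g \<omega> - C\<bar> \<partial>\<mu>) < ennreal (e / 2)" by simp
    moreover have "(\<integral>\<^sup>+\<omega>. ennreal (nsq g \<omega>) \<partial>\<mu>) = ennreal c"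
      unfolding c(1)[symmetric] nn_integral_ruelle_pow[OF g, of n, symmetric]
      using l2_eq_nsq[OF eq] by (intro nn_integral_cong_AE) (auto elim: eventually_mono)
    ultimately show "(\<integral>\<^sup>+\<omega>. ennreal \<bar>nsq g \<omega> - c\<bar> \<partial>\<mu>) \<le> ennreal e"
      using L1_distance_mean[OF nsq_measurable[OF g] nsq_nonneg[OF g] _ c(2), of C "e / 2"] by simp
  qed
qed

lemma block_filter_pure:
  fixes \<delta> \<epsilon> :: real and k :: nat
  assumes F: "F \<in> sets \<mu>" and overlap: "emeasure \<mu> (F \<inter> \<beta> ` F) > 0"
    and block: "\<And>\<omega>. \<omega> \<in> F \<Longrightarrow> block_matrix nrm nrm' (\<lambda>i j. h i j \<omega>) k \<delta> \<epsilon>"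
    and \<epsilon>: "\<epsilon> \<le> 1 / 8" "\<epsilon> \<le> \<delta> / 8"
    and f: "f \<in> l2_space \<mu> m" and range: "\<And>n. n \<ge> 1 \<Longrightarrow> f \<in> l2_range \<mu> m (S ^^ n)"
  shows "l2_eq \<mu> f (\<lambda>i \<omega>. 0)"
proof (rule ccontr)
  assume nz: "\<not> l2_eq \<mu> f (\<lambda>i \<omega>. 0)"
  define c where "c = enn2real (\<integral>\<^sup>+\<omega>. ennreal (nsq f \<omega>) \<partial>\<mu>)"
  have c: "(\<integral>\<^sup>+\<omega>. ennreal (nsq f \<omega>) \<partial>\<mu>) = ennreal c"
    using nn_integral_nsq_finite[OF f] by (simp add: c_def)
  have "c \<noteq> 0" using nz c l2_eq_zero_iff[OF f] by auto
  then have c0: "c > 0" using enn2real_nonneg by (simp add: c_def order_less_le)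
  define E where "E = {\<omega> \<in> F. \<beta> \<omega> \<in> F}"
  have E: "E \<in> sets \<mu>" "emeasure \<mu> E > 0" using overlap_positive[OF F overlap] by (auto simp: E_def)
  then have Epos: "measure \<mu> E > 0" by (simp add: emeasure_eq_measure)
  obtain \<omega>\<^sub>0 where "\<omega>\<^sub>0 \<in> F" using E by (metis (no_types, lifting) E_def emeasure_empty ex_in_conv less_irrefl mem_Collect_eq)
  then have pos: "\<delta> > 0" "\<epsilon> \<ge> 0" using block block_matrix.pos by blast+
  define \<kappa> where "\<kappa> = \<delta> / (8 + 8 * \<delta>) * c"
  have \<kappa>: "\<kappa> > 0" using c0 pos by (simp add: \<kappa>_def)
  \<comment> \<open>Three errors of this size add up to three quarters of the lower bound
    \<open>\<kappa> * measure \<mu> E\<close>.\<close>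
  define e where "e = \<kappa> * measure \<mu> E / 4"
  have e: "e > 0" using \<kappa> Epos by (simp add: e_def)
  from range_norm_almost_constant[OF f c less_imp_le[OF c0] e]
  obtain n where n: "\<forall>j\<ge>n. \<forall>g\<in>l2_space \<mu> m. l2_eq \<mu> f ((S ^^ j) g) \<longrightarrow>
    (\<integral>\<^sup>+\<omega>. ennreal \<bar>nsq g \<omega> - c\<bar> \<partial>\<mu>) \<le> ennreal e"
    by (elim exE) (rule that)
  \<comment> \<open>Two extra steps, so that p, q and r are preimages of f under n, n + 1 and n + 2
    steps, all beyond the threshold.\<close>
  have "f \<in> l2_range \<mu> m (S ^^ (n + 2))" by (rule range) simp
  then obtain r where r: "r \<in> l2_space \<mu> m" "l2_eq \<mu> f ((S ^^ (n + 2)) r)"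
    by (auto simp: l2_range_def)
  define q where "q = S r"
  define p where "p = S q"
  have q: "q \<in> l2_space \<mu> m" "l2_eq \<mu> f ((S ^^ (n + 1)) q)"
    using r ruelle_l2 by (auto simp: q_def funpow_swap1)
  have p: "p \<in> l2_space \<mu> m" "l2_eq \<mu> f ((S ^^ n) p)"
    using q ruelle_l2 by (auto simp: p_def funpow_swap1)
  have meas: "nsq p \<in> borel_measurable \<mu>" "nsq q \<in> borel_measurable \<mu>" "nsq r \<in> borel_measurable \<mu>"
    using p q r nsq_measurable by blast+
  note [measurable] = meas measurable_dual_hom E(1)
  \<comment> \<open>Rather than exhibiting one good point, the contradiction is integrated: on E the
    three deviations from c cannot all be below \<kappa>, so their sum is at least \<kappa>
    there.\<close>
  have "AE \<omega> in \<mu>. \<omega> \<in> E \<longrightarrow> \<kappa> \<le> \<bar>nsq p \<omega> - c\<bar> + \<bar>nsq q (\<beta> \<omega>) - c\<bar> + \<bar>nsq r (\<beta> (\<beta> \<omega>)) - c\<bar>"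
    using l2_summable[OF p(1)] AE_dual_hom[OF l2_summable[OF q(1)]]
      AE_dual_hom[OF AE_dual_hom[OF l2_summable[OF r(1)]]]
      ruelle_sums[OF q(1)] AE_dual_hom[OF ruelle_sums[OF r(1)]]
  proof eventually_elim
    case (elim \<omega>)
    show ?case
    proof (intro impI, rule ccontr)
      assume "\<omega> \<in> E" and "\<not> \<kappa> \<le> \<bar>nsq p \<omega> - c\<bar> + \<bar>nsq q (\<beta> \<omega>) - c\<bar> + \<bar>nsq r (\<beta> (\<beta> \<omega>)) - c\<bar>"
      then have close: "\<bar>nsq p \<omega> - c\<bar> < \<kappa>" "\<bar>nsq q (\<beta> \<omega>) - c\<bar> < \<kappa>" "\<bar>nsq r (\<beta> (\<beta> \<omega>)) - c\<bar> < \<kappa>"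
        by linarith+
      have w: "\<omega> \<in> F" "\<beta> \<omega> \<in> F" using \<open>\<omega> \<in> E\<close> by (auto simp: E_def)
      interpret M0: block_matrix nrm nrm' "\<lambda>i j. h i j \<omega>" k \<delta> \<epsilon> by (rule block[OF w(1)])
      interpret M1: block_matrix nrm nrm' "\<lambda>i j. h i j (\<beta> \<omega>)" k \<delta> \<epsilon> by (rule block[OF w(2)])
      let ?w = "\<lambda>i. q i (\<beta> \<omega>)"
      have "sqrt (nsq q (\<beta> \<omega>)) \<le> head_norm k ?w + tail_norm k ?w"
        unfolding nsq_def by (rule head_tail_norm_ge[OF elim(2)])
      moreover have "tail_norm k ?w \<le> 2 * \<epsilon> * sqrt (nsq r (\<beta> (\<beta> \<omega>)))"
        unfolding nsq_def
        by (rule M1.tail_image_le[OF elim(3) _ elim(2)]) (use elim(5) in \<open>simp add: q_def\<close>)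
      moreover have "(1 + \<delta>) * head_norm k ?w \<le> sqrt (nsq p \<omega>) + \<epsilon> * tail_norm k ?w"
        unfolding nsq_def
        by (rule M0.head_expands[OF elim(2) _ elim(1)]) (use elim(4) in \<open>simp add: p_def\<close>)
      ultimately show False
        using expansion_contradiction[OF c0 pos(1) pos(2) \<epsilon>] close unfolding \<kappa>_def by blast
    qed
  qed
  then have "AE \<omega> in \<mu>. ennreal \<kappa> * indicator E \<omega> \<le>
    ennreal \<bar>nsq p \<omega> - c\<bar> + ennreal \<bar>nsq q (\<beta> \<omega>) - c\<bar> + ennreal \<bar>nsq r (\<beta> (\<beta> \<omega>)) - c\<bar>"
    by eventually_elim (auto simp: indicator_def simp flip: ennreal_plus intro!: ennreal_leI)
  then have "(\<integral>\<^sup>+\<omega>. ennreal \<kappa> * indicator E \<omega> \<partial>\<mu>) \<le>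
    (\<integral>\<^sup>+\<omega>. ennreal \<bar>nsq p \<omega> - c\<bar> + ennreal \<bar>nsq q (\<beta> \<omega>) - c\<bar> + ennreal \<bar>nsq r (\<beta> (\<beta> \<omega>)) - c\<bar> \<partial>\<mu>)"
    by (rule nn_integral_mono_AE)
  also have "\<dots> = (\<integral>\<^sup>+\<omega>. ennreal \<bar>nsq p \<omega> - c\<bar> \<partial>\<mu>) + (\<integral>\<^sup>+\<omega>. ennreal \<bar>nsq q (\<beta> \<omega>) - c\<bar> \<partial>\<mu>)
      + (\<integral>\<^sup>+\<omega>. ennreal \<bar>nsq r (\<beta> (\<beta> \<omega>)) - c\<bar> \<partial>\<mu>)"
    by (simp add: nn_integral_add)
  also have "\<dots> = (\<integral>\<^sup>+\<omega>. ennreal \<bar>nsq p \<omega> - c\<bar> \<partial>\<mu>) + (\<integral>\<^sup>+\<omega>. ennreal \<bar>nsq q \<omega> - c\<bar> \<partial>\<mu>)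
      + (\<integral>\<^sup>+\<omega>. ennreal \<bar>nsq r \<omega> - c\<bar> \<partial>\<mu>)"
    using nn_integral_dual_hom[of "\<lambda>\<omega>. ennreal \<bar>nsq q \<omega> - c\<bar>"]
      nn_integral_dual_hom[of "\<lambda>\<omega>. ennreal \<bar>nsq r \<omega> - c\<bar>"]
      nn_integral_dual_hom[of "\<lambda>\<omega>. ennreal \<bar>nsq r (\<beta> \<omega>) - c\<bar>"] by simp
  also have "\<dots> \<le> ennreal e + ennreal e + ennreal e"
    using n[rule_format, OF _ p] n[rule_format, OF _ q] n[rule_format, OF _ r] by (intro add_mono) auto
  also have "\<dots> = ennreal (3 * e)" using e by (simp flip: ennreal_plus)
  finally have "ennreal (\<kappa> * measure \<mu> E) \<le> ennreal (3 * e)"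
    using \<kappa> E(1) by (simp add: nn_integral_cmult_indicator emeasure_eq_measure ennreal_mult)
  then have "\<kappa> * measure \<mu> E \<le> 3 * e" using e by (simp add: ennreal_le_iff)
  then show False using \<kappa> Epos by (simp add: e_def)
qed

end

theorem theorem6:
  fixes \<alpha> :: "'g::{ab_group_add, countable} \<Rightarrow> 'g"
    and \<mu> :: "('g \<Rightarrow> complex) measure"
    and m :: "('g \<Rightarrow> complex) \<Rightarrow> enat"
    and N k :: nat
    and h :: "nat \<Rightarrow> nat \<Rightarrow> ('g \<Rightarrow> complex) \<Rightarrow> complex"
    and F :: "('g \<Rightarrow> complex) set"
    and \<delta> :: real
    and nrm nrm' :: "nat set \<Rightarrow> nat set \<Rightarrow> (nat \<Rightarrow> nat \<Rightarrow> complex) \<Rightarrow> ennreal"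
  assumes hom: "\<And>x y. \<alpha> (x + y) = \<alpha> x + \<alpha> y"
    and inj: "inj \<alpha>"
    and index: "subgroup_index (range \<alpha>) = N" "N > 1"
    and inter: "(\<Inter>n. range (\<alpha> ^^ n)) = {0}"
    and haar: "haar_prob \<mu>"
    and m_borel: "m \<in> measurable \<mu> (count_space UNIV)"
    and filt: "is_filter \<mu> m \<alpha> N h"
    and bounded: "ruelle_bounded \<mu> m \<alpha> h"
    and norms: "nrm \<in> {op_norm, eucl_norm}" "nrm' \<in> {op_norm, eucl_norm}"
    and delta: "\<delta> > 0"
    and F: "F \<in> sets \<mu>" "emeasure \<mu> F > 0"
    and A_expansive: "\<And>\<omega>. \<omega> \<in> F \<Longrightarrow> expansive (mat k k (\<lambda>(i, j). h i j \<omega>))"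
    and A_inverse: "\<And>\<omega>. \<omega> \<in> F \<Longrightarrow>
      \<exists>A'\<in>carrier_mat k k.
        inverts_mat (mat k k (\<lambda>(i, j). h i j \<omega>)) A' \<and>
        inverts_mat A' (mat k k (\<lambda>(i, j). h i j \<omega>)) \<and>
        nrm' {..<k} {..<k} (\<lambda>i j. A' $$ (i, j)) \<le> ennreal (1 / (1 + \<delta>))"
    and BCD_small: "\<And>\<omega>. \<omega> \<in> F \<Longrightarrow>
      Max {nrm {..<k} {k..} (\<lambda>i j. h i j \<omega>),
           nrm {k..} {..<k} (\<lambda>i j. h i j \<omega>),
           nrm {k..} {k..} (\<lambda>i j. h i j \<omega>)} < ennreal (min (1 / 8) (\<delta> / 8))"
    and overlap: "emeasure \<mu> (F \<inter> dual_hom \<alpha> ` F) > 0"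
  shows "pure_isometry \<mu> m (ruelle \<alpha> h) \<and> (\<nexists>f z. l2_eigenvector \<mu> m (ruelle \<alpha> h) f z)"
proof -
  interpret ruelle_op \<mu> \<alpha> N m h
    by unfold_locales (fact haar hom inj index inter filt bounded)+
  let ?\<epsilon> = "min (1 / 8) (\<delta> / 8)"
  have block: "block_matrix nrm nrm' (\<lambda>i j. h i j \<omega>) k \<delta> ?\<epsilon>" if "\<omega> \<in> F" for \<omega>
    using norms delta A_inverse[OF that] BCD_small[OF that]
    by (intro block_matrix.intro) (auto intro: less_imp_le)
  have pure: "l2_eq \<mu> f (\<lambda>i \<omega>. 0)"
    if "f \<in> l2_space \<mu> m" "\<And>n. n \<ge> 1 \<Longrightarrow> f \<in> l2_range \<mu> m (S ^^ n)" for f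
    using block_filter_pure[OF F(1) overlap block _ _ that] by simp
  \<comment> \<open>The zero function is fixed exactly, not only up to null sets, so it witnesses
    that every representative of 0 lies in all ranges.\<close>
  have zero_pow: "(S ^^ n) (\<lambda>i \<omega>. 0) = (\<lambda>i \<omega>. 0)" for n
    by (induction n) (auto simp: ruelle_def)
  have "(\<Inter>n\<in>{1..}. l2_range \<mu> m (S ^^ n)) = {g \<in> l2_space \<mu> m. l2_eq \<mu> g (\<lambda>i \<omega>. 0)}"
  proof (intro equalityI subsetI)
    fix g assume g: "g \<in> (\<Inter>n\<in>{1..}. l2_range \<mu> m (S ^^ n))"
    then have "g \<in> l2_range \<mu> m (S ^^ 1)" by (rule INT_D) simp
    then have "g \<in> l2_space \<mu> m" by (simp add: l2_range_def)
    then show "g \<in> {g \<in> l2_space \<mu> m. l2_eq \<mu> g (\<lambda>i \<omega>. 0)}" using pure g by auto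
  next
    fix g assume "g \<in> {g \<in> l2_space \<mu> m. l2_eq \<mu> g (\<lambda>i \<omega>. 0)}"
    then have "g \<in> l2_range \<mu> m (S ^^ n)" for n
      using l2_zero[of \<mu> m] zero_pow[of n] unfolding l2_range_def by (auto intro!: bexI[of _ "\<lambda>i \<omega>. 0"])
    then show "g \<in> (\<Inter>n\<in>{1..}. l2_range \<mu> m (S ^^ n))" by blast
  qed
  moreover have "\<nexists>f z. l2_eigenvector \<mu> m S f z"
    using pure eigenvector_in_ranges by (metis l2_eigenvector_def)
  ultimately show ?thesis using ruelle_isometry by (simp add: pure_isometry_def)
qed

end
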